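(* Let $\alpha>0$ be fixed and let $c<1/\sqrt{2}$. Then for every sufficiently large $N\geq 1$ (depending on $\alpha$ and $c$), \[ \max_{\sqrt{N}\leq \ell\leq N\log N}\left|\zeta\left(\tfrac12+i\alpha\ell\right)\right|\;\geq\;\exp\left(c\sqrt{\frac{\log N\,\log\log\log N}{\log\log N}}\right), \] where the maximum is over integers $\ell$ in the indicated range.
   Context: $\zeta$ denotes the Riemann zeta function. *)

theory Defs
  imports "HOL-Analysis.Analysis"
begin

text \<open>Dirichlet eta function: the (conditionally convergent for Re s > 0) alternating series
  sum_{n>=1} (-1)^(n-1) n^(-s), taken as the limit of its partial sums.\<close>
definition dirichlet_eta :: "complex \<Rightarrow> complex" where
  "dirichlet_eta s = lim (\<lambda>N. \<Sum>n=1..N. (-1)^(n-1) / (of_nat n) powr s)"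

text \<open>Riemann zeta function in the half-plane Re s > 0 (s \<noteq> 1 and 2^(1-s) \<noteq> 1), via its
  standard analytic continuation zeta(s) = eta(s) / (1 - 2^(1-s)). On the critical line
  Re s = 1/2 the denominator never vanishes, so this is the genuine zeta there.\<close>
definition riemann_zeta :: "complex \<Rightarrow> complex" where
  "riemann_zeta s = dirichlet_eta s / (1 - 2 powr (1 - s))"

end

theory Submission
  imports Defs "HOL-Number_Theory.Prime_Powers" "HOL-Real_Asymp.Real_Asymp"
begin

text \<open>
  The proof is a resonance argument in the style of Bondarenko and Seip, carried out on an
  arithmetic progression. On the critical line the zeta function is approximated, up to a bounded
  error and a polar term, by a smoothed partial sum \<open>P\<close> of its Dirichlet series of length slightly
  above \<open>N\<close>, whose coefficients are nonnegative. For a resonator \<open>R\<close> the sum of \<open>P |R|\<^sup>2\<close> over the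
  points \<open>\<alpha> l\<close> with \<open>|l| < N\<close>, weighted by a Fejer kernel, is a sum of nonnegative terms, and
  keeping only the exact coincidences \<open>k m = n\<close> bounds it from below by a GCD-type sum over the support
  of the resonator. From above it is bounded by the maximum of \<open>|P|\<close> over \<open>l \<ge> \<surd>N\<close> times the
  mean square of \<open>R\<close>, plus the contribution of \<open>l < \<surd>N\<close>, which is negligible by a mean square bound for
  \<open>P\<close> as soon as the resonator has at most \<open>N\<close> to the power \<open>1/2 - \<epsilon>\<close> elements; this is the origin of
  the constant \<open>1/\<surd>2\<close>. The resonator lives on products of primes taken from consecutive blocks
  of bounded logarithmic length just above \<open>log N log log N\<close>, with a limit on the number of primes
  from each block. Because the blocks may be chosen long, Mertens' first theorem replaces the
  prime number theorem.
\<close>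

section \<open>Truncations of the zeta function\<close>

lemma norm_diff_of_real_le:
  fixes f f' :: "complex \<Rightarrow> complex" and a b B :: real
  assumes "a \<le> b"
    and deriv: "\<And>y. a \<le> y \<Longrightarrow> y \<le> b \<Longrightarrow> (f has_field_derivative f' (of_real y)) (at (of_real y))"
    and bound: "\<And>y. a \<le> y \<Longrightarrow> y \<le> b \<Longrightarrow> norm (f' (of_real y)) \<le> B"
  shows "norm (f (of_real b) - f (of_real a)) \<le> B * (b - a)"
proof -
  let ?S = "closed_segment (of_real a :: complex) (of_real b)"
  have S: "?S = of_real ` {a..b}"
    using assms(1) by (simp add: closed_segment_of_real closed_segment_eq_real_ivl)
  have "norm (f (of_real b) - f (of_real a)) \<le> B * norm (of_real b - of_real a :: complex)"
  proof (rule field_differentiable_bound[where S = ?S and f' = f'])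
    show "(f has_field_derivative f' z) (at z within ?S)" if "z \<in> ?S" for z
      using deriv that unfolding S by (auto intro: has_field_derivative_at_within)
    show "norm (f' z) \<le> B" if "z \<in> ?S" for z
      using bound that unfolding S by auto
  qed auto
  also have "norm (of_real b - of_real a :: complex) = b - a"
    using assms(1) by (simp flip: of_real_diff)
  finally show ?thesis .
qed

fun powr_fdiff :: "nat \<Rightarrow> complex \<Rightarrow> complex \<Rightarrow> complex" where
  "powr_fdiff 0 s z = z powr (-s)"
| "powr_fdiff (Suc i) s z = powr_fdiff i s z - powr_fdiff i s (z + 1)"

lemma has_field_derivative_powr_fdiff:
  assumes "Re z > 0"
  shows "(powr_fdiff i s has_field_derivative -s * powr_fdiff i (s + 1) z) (at z)"
  using assms
proof (induction i arbitrary: z)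
  case 0
  have "z \<notin> \<real>\<^sub>\<le>\<^sub>0" using 0 by (auto simp: complex_nonpos_Reals_iff)
  from has_field_derivative_powr[OF this, of "-s"] show ?case
    by (simp add: fun_eq_iff[symmetric] powr_fdiff.simps(1)[abs_def] minus_diff_commute add.commute)
next
  case (Suc i)
  have "(powr_fdiff i s has_field_derivative -s * powr_fdiff i (s + 1) (z + 1)) (at (z + 1))"
    using Suc by simp
  hence "((\<lambda>z. powr_fdiff i s (z + 1)) has_field_derivative
      -s * powr_fdiff i (s + 1) (z + 1)) (at z)"
    by (subst (asm) DERIV_shift)
  moreover have "(powr_fdiff i s has_field_derivative -s * powr_fdiff i (s + 1) z) (at z)"
    using Suc by simp
  ultimately have "((\<lambda>z. powr_fdiff i s z - powr_fdiff i s (z + 1)) has_field_derivative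
      -s * powr_fdiff i (s + 1) z - -s * powr_fdiff i (s + 1) (z + 1)) (at z)"
    by (intro DERIV_diff)
  thus ?case by (simp add: algebra_simps)
qed

lemma pochhammer_mono_real:
  fixes a b :: real
  assumes "0 \<le> a" "a \<le> b"
  shows "pochhammer a n \<le> pochhammer b n"
  unfolding pochhammer_prod using assms by (intro prod_mono) auto

lemma pochhammer_le_power:
  fixes a :: real
  assumes "0 \<le> a" "i \<le> n"
  shows "pochhammer a i \<le> (a + n) ^ i"
proof -
  have "pochhammer a i \<le> (\<Prod>j\<in>{0..<i}. a + n)"
    unfolding pochhammer_prod using assms by (intro prod_mono) auto
  thus ?thesis by simp
qed

lemma norm_powr_fdiff_le:
  assumes "x > 0" "Re s \<ge> 0"
  shows "norm (powr_fdiff i s (of_real x)) \<le> pochhammer (norm s) i * x powr (-Re s - i)"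
  using assms
proof (induction i arbitrary: s x)
  case 0
  thus ?case by (simp add: norm_powr_real_powr)
next
  case (Suc i)
  let ?B = "norm s * (pochhammer (norm s + 1) i * x powr (-Re s - 1 - i))"
  have "norm (powr_fdiff i s (of_real (x + 1)) - powr_fdiff i s (of_real x)) \<le> ?B * (x + 1 - x)"
  proof (rule norm_diff_of_real_le)
    fix y assume y: "x \<le> y" "y \<le> x + 1"
    show "(powr_fdiff i s has_field_derivative
        -s * powr_fdiff i (s + 1) (of_real y)) (at (of_real y))"
      using Suc.prems y by (intro has_field_derivative_powr_fdiff) auto
    have "norm (powr_fdiff i (s + 1) (of_real y)) \<le>
        pochhammer (norm (s + 1)) i * y powr (-Re (s + 1) - i)"
      using Suc.prems y by (intro Suc.IH) auto
    also have "\<dots> \<le> pochhammer (norm s + 1) i * x powr (-Re s - 1 - i)"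
      using Suc.prems y norm_triangle_ineq[of s 1]
      by (intro mult_mono pochhammer_mono_real)
        (auto intro!: powr_mono2' pochhammer_nonneg add_nonneg_pos)
    finally show "norm (-s * powr_fdiff i (s + 1) (of_real y)) \<le> ?B"
      by (simp add: norm_mult mult_left_mono)
  qed simp
  thus ?case
    by (simp add: norm_minus_commute pochhammer_rec add.commute algebra_simps)
qed

lemma norm_powr_fdiff_le_1:
  fixes K :: nat
  assumes "1 \<le> x" "Re s \<ge> 0" "norm s + K \<le> x" "i \<le> K"
  shows "norm (powr_fdiff i s (of_real x)) \<le> 1"
proof -
  have "norm (powr_fdiff i s (of_real x)) \<le> pochhammer (norm s) i * x powr (-Re s - i)"
    using assms by (intro norm_powr_fdiff_le) auto
  also have "\<dots> \<le> x ^ i * x powr (- real i)"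
  proof (intro mult_mono)
    have "pochhammer (norm s) i \<le> (norm s + K) ^ i"
      using assms by (intro pochhammer_le_power) auto
    also have "\<dots> \<le> x ^ i" using assms by (intro power_mono) auto
    finally show "pochhammer (norm s) i \<le> x ^ i" .
  qed (use assms in \<open>auto intro!: powr_mono\<close>)
  also have "\<dots> = 1" using assms by (simp add: powr_minus powr_realpow)
  finally show ?thesis .
qed

lemma powr_fdiff_tendsto_0:
  assumes "Re s > 0"
  shows "(\<lambda>n. powr_fdiff i s (of_nat n)) \<longlonglongrightarrow> 0"
proof (rule Lim_null_comparison)
  show "\<forall>\<^sub>F n in sequentially.
      norm (powr_fdiff i s (of_nat n)) \<le> pochhammer (norm s) i * real n powr (-Re s - i)"
    using eventually_gt_at_top[of 0]
  proof eventually_elim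
    case (elim n)
    thus ?case using norm_powr_fdiff_le[of "real n" s i] assms by simp
  qed
  have "- Re s - real i < 0" using assms by simp
  thus "(\<lambda>n. pochhammer (norm s) i * real n powr (-Re s - i)) \<longlonglongrightarrow> 0"
    by (intro tendsto_mult_right_zero tendsto_neg_powr filterlim_real_sequentially)
qed

lemma alternating_sums_halving:
  fixes a :: "nat \<Rightarrow> complex"
  assumes lim: "a \<longlonglongrightarrow> 0" and sums: "(\<lambda>n. (-1)^n * (a n - a (Suc n))) sums d"
  shows "(\<lambda>n. (-1)^n * a n) sums ((a 0 + d) / 2)"
proof -
  have eq: "(\<Sum>k<n. (-1)^k * a k) =
      (a 0 - (-1)^n * a n + (\<Sum>k<n. (-1)^k * (a k - a (Suc k)))) / 2" for n
    by (induction n) (auto simp: field_simps)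
  have "(\<lambda>n. (-1)^n * a n) \<longlonglongrightarrow> 0"
    using lim by (subst tendsto_norm_zero_iff[symmetric])
      (simp add: norm_mult norm_power tendsto_norm_zero_iff)
  hence "(\<lambda>n. (a 0 - (-1)^n * a n + (\<Sum>k<n. (-1)^k * (a k - a (Suc k)))) / 2) \<longlonglongrightarrow> (a 0 - 0 + d) / 2"
    using sums unfolding sums_def by (intro tendsto_intros) auto
  thus ?thesis unfolding sums_def eq by simp
qed

definition zeta_three_halves :: real where
  "zeta_three_halves = (\<Sum>n. real (Suc n) powr (-3/2))"

lemma summable_powr_three_halves: "summable (\<lambda>n. real (Suc n) powr (-3/2))"
  by (subst summable_Suc_iff) (simp add: summable_real_powr_iff)

lemma zeta_three_halves_nonneg: "zeta_three_halves \<ge> 0"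
  unfolding zeta_three_halves_def by (intro suminf_nonneg summable_powr_three_halves) auto

lemma sum_powr_three_halves_le: "(\<Sum>k=1..n. real k powr (-3/2)) \<le> zeta_three_halves"
proof -
  have "(\<Sum>k=1..n. real k powr (-3/2)) = (\<Sum>k<n. real (Suc k) powr (-3/2))"
    by (rule sum.reindex_bij_witness[of _ Suc "\<lambda>k. k - 1"]) auto
  also have "\<dots> \<le> zeta_three_halves"
    unfolding zeta_three_halves_def by (intro sum_le_suminf summable_powr_three_halves) auto
  finally show ?thesis .
qed

text \<open>The condition makes the \<open>K\<close>-th differences of \<open>n powr (-s)\<close> at \<open>n \<ge> Y\<close> summable uniformly
  in \<open>s\<close>: if \<open>Re s \<ge> 1/2\<close>, they are at most \<open>(norm s + K)\<^sup>K\<close> times \<open>n powr (-1/2 - K)\<close>.\<close>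

definition admissible_length :: "nat \<Rightarrow> complex \<Rightarrow> nat \<Rightarrow> bool" where
  "admissible_length K s Y \<longleftrightarrow> K \<ge> 2 \<and> (norm s + K) ^ K \<le> real Y ^ (K - 1)"

lemma admissible_length_imp_le:
  assumes "admissible_length K s Y"
  shows "norm s + K \<le> Y"
proof -
  have K: "K \<ge> 2" and Y: "(norm s + K) ^ K \<le> real Y ^ (K - 1)"
    using assms unfolding admissible_length_def by auto
  have "norm s + K \<ge> 1" using K norm_ge_zero[of s] by linarith
  hence "(norm s + K) ^ (K - 1) \<le> (norm s + K) ^ K"
    by (intro power_increasing) auto
  hence "(norm s + K) ^ (K - 1) \<le> real Y ^ (K - 1)" using Y by linarith
  thus ?thesis using K by (subst (asm) power_mono_iff) auto
qed

lemma admissible_length_imp_pos: "admissible_length K s Y \<Longrightarrow> Y > 0"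
  using admissible_length_imp_le[of K s Y] norm_ge_zero[of s]
  by (cases Y) (auto simp: admissible_length_def)

lemma admissible_length_mono:
  assumes "admissible_length K s Y" "Y \<le> Y'"
  shows "admissible_length K s Y'"
  using assms power_mono[of "real Y" "real Y'" "K - 1"] unfolding admissible_length_def
  by (auto intro: order_trans)

lemma norm_top_powr_fdiff_le:
  assumes s: "Re s \<ge> 1/2" and adm: "admissible_length K s M"
  shows "norm (powr_fdiff K s (of_nat (M + n))) \<le> real (Suc n) powr (-3/2)"
proof -
  have K: "K \<ge> 2" and M: "(norm s + K) ^ K \<le> real M ^ (K - 1)"
    using adm unfolding admissible_length_def by auto
  have M1: "real M \<ge> 1" using admissible_length_imp_pos[OF adm] by simp
  have "norm (powr_fdiff K s (of_nat (M + n))) \<le>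
      pochhammer (norm s) K * real (M + n) powr (-Re s - K)"
    using norm_powr_fdiff_le[of "real (M + n)" s K] s M1 by simp
  also have "real (M + n) powr (-Re s - K) \<le> real (M + n) powr (-1/2 - K)"
    using s M1 by (intro powr_mono) auto
  also have "real (M + n) powr (-1/2 - K) =
      real (M + n) powr (-3/2) * real (M + n) powr (- real (K - 1))"
    using K by (simp add: powr_add[symmetric] of_nat_diff)
  also have "\<dots> \<le> real (Suc n) powr (-3/2) * real M powr (- real (K - 1))"
    using M1 by (intro mult_mono powr_mono2') auto
  also have "real M powr (- real (K - 1)) = 1 / real M ^ (K - 1)"
    using M1 by (simp add: powr_minus powr_realpow field_simps)
  also have "pochhammer (norm s) K * (real (Suc n) powr (-3/2) * (1 / real M ^ (K - 1))) =
      real (Suc n) powr (-3/2) * (pochhammer (norm s) K / real M ^ (K - 1))" by simp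
  also have "\<dots> \<le> real (Suc n) powr (-3/2) * 1"
    using M1 M pochhammer_le_power[of "norm s" K K] by (intro mult_left_mono) auto
  finally show ?thesis using s by (cases "s = 0") (auto simp: mult_left_mono pochhammer_nonneg)
qed

lemma alternating_top_powr_fdiff_sums:
  assumes s: "Re s \<ge> 1/2" and adm: "admissible_length K s M"
  obtains t where "(\<lambda>n. (-1)^n * powr_fdiff K s (of_nat (M + n))) sums t"
    "norm t \<le> zeta_three_halves"
proof -
  let ?a = "\<lambda>n. (-1)^n * powr_fdiff K s (of_nat (M + n))"
  have le: "norm (?a n) \<le> real (Suc n) powr (-3/2)" for n
    using norm_top_powr_fdiff_le[OF assms] by (simp add: norm_mult norm_power)
  hence sm: "summable (\<lambda>n. norm (?a n))"
    by (intro summable_comparison_test'[OF summable_powr_three_halves, of 0]) simp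
  hence "norm (\<Sum>n. ?a n) \<le> zeta_three_halves" unfolding zeta_three_halves_def
    by (intro order_trans[OF summable_norm] suminf_le le summable_powr_three_halves)
  moreover have "?a sums (\<Sum>n. ?a n)"
    by (rule summable_sums[OF summable_norm_cancel[OF sm]])
  ultimately show ?thesis using that by blast
qed

lemma alternating_powr_sums:
  assumes s: "Re s \<ge> 1/2" and adm: "admissible_length K s M"
  obtains t where "(\<lambda>n. (-1)^n * of_nat (M + n) powr (-s)) sums t" "norm t \<le> 1 + zeta_three_halves"
proof -
  define a where "a = (\<lambda>i n. powr_fdiff i s (of_nat (M + n)))"
  have a_Suc: "a (Suc i) n = a i n - a i (Suc n)" for i n
    unfolding a_def by (simp add: add_ac)
  have a_lim: "a i \<longlonglongrightarrow> 0" for i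
    unfolding a_def using LIMSEQ_ignore_initial_segment[OF powr_fdiff_tendsto_0[of s i], of M] s
    by (simp add: add.commute)
  have "\<exists>t. (\<lambda>n. (-1)^n * a i n) sums t \<and> norm t \<le> 1 + zeta_three_halves" if "i \<le> K" for i
    using that
  proof (induction rule: inc_induct)
    case base
    show ?case
      using alternating_top_powr_fdiff_sums[OF assms] unfolding a_def
        by (metis add_increasing zero_le_one)
  next
    case (step i)
    then obtain d where d: "(\<lambda>n. (-1)^n * a (Suc i) n) sums d" "norm d \<le> 1 + zeta_three_halves"
      by blast
    have "norm (a i 0) \<le> 1"
      using norm_powr_fdiff_le_1[of "real M" s K i] s step.hyps
        admissible_length_imp_le[OF adm] admissible_length_imp_pos[OF adm] unfolding a_def by simp
    hence "norm ((a i 0 + d) / 2) \<le> 1 + zeta_three_halves"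
      using d(2) norm_triangle_ineq[of "a i 0" d] zeta_three_halves_nonneg
        by (simp add: norm_divide)
    moreover have "(\<lambda>n. (-1)^n * a i n) sums ((a i 0 + d) / 2)"
      using d(1) unfolding a_Suc by (intro alternating_sums_halving a_lim)
    ultimately show ?case by blast
  qed
  from this[of 0] show ?thesis using that unfolding a_def by auto
qed

lemma dirichlet_eta_partial_sum:
  assumes "(\<lambda>n. (-1)^n * of_nat (Suc M + n) powr (-s)) sums t"
  shows "dirichlet_eta s = (\<Sum>n=1..M. (-1)^(n-1) * of_nat n powr (-s)) + (-1)^M * t"
proof -
  have "(\<Sum>n=1..M + N. (-1)^(n-1) / of_nat n powr s) =
      (\<Sum>n=1..M. (-1)^(n-1) * of_nat n powr (-s))
        + (-1)^M * (\<Sum>n<N. (-1)^n * of_nat (Suc M + n) powr (-s))" for N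
    by (induction N) (auto simp: powr_minus field_simps power_add intro!: sum.cong)
  moreover have "(\<lambda>N. (\<Sum>n=1..M. (-1)^(n-1) * of_nat n powr (-s)) +
      (-1)^M * (\<Sum>n<N. (-1)^n * of_nat (Suc M + n) powr (-s))) \<longlonglongrightarrow>
      (\<Sum>n=1..M. (-1)^(n-1) * of_nat n powr (-s)) + (-1)^M * t"
    using assms unfolding sums_def by (intro tendsto_intros)
  ultimately have "(\<lambda>N. \<Sum>n=1..M + N. (-1)^(n-1) / of_nat n powr s) \<longlonglongrightarrow>
      (\<Sum>n=1..M. (-1)^(n-1) * of_nat n powr (-s)) + (-1)^M * t" by simp
  hence "(\<lambda>N. \<Sum>n=1..N. (-1)^(n-1) / of_nat n powr s) \<longlonglongrightarrow>
      (\<Sum>n=1..M. (-1)^(n-1) * of_nat n powr (-s)) + (-1)^M * t"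
    by (subst (asm) add.commute) (rule LIMSEQ_offset)
  thus ?thesis unfolding dirichlet_eta_def by (rule limI)
qed

definition zeta_sum :: "nat \<Rightarrow> complex \<Rightarrow> complex" where
  "zeta_sum Y s = (\<Sum>n=1..Y. of_nat n powr (-s))"

lemma zeta_sum_double:
  "zeta_sum (2 * Y) s - 2 powr (1 - s) * zeta_sum Y s =
      (\<Sum>n=1..2*Y. (-1)^(n-1) * of_nat n powr (-s))"
proof (induction Y)
  case 0
  thus ?case by (simp add: zeta_sum_def)
next
  case (Suc Y)
  have two: "2 * Suc Y = Suc (Suc (2 * Y))" by simp
  have "(of_nat (2 * Suc Y) :: complex) powr (-s) = 2 powr (-s) * of_nat (Suc Y) powr (-s)"
    using powr_times_real[of "2::complex" "of_nat (Suc Y)" "-s"] by simp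
  moreover have "(2::complex) powr (1 - s) = 2 * 2 powr (-s)"
    by (simp add: powr_diff powr_minus field_simps)
  ultimately have "2 powr (1 - s) * of_nat (Suc Y) powr (-s) = 2 * of_nat (2 * Suc Y) powr (-s)"
    by simp
  moreover have "zeta_sum (2 * Suc Y) s = zeta_sum (2 * Y) s + of_nat (Suc (2 * Y)) powr (-s)
      + of_nat (2 * Suc Y) powr (-s)"
    unfolding two zeta_sum_def by simp
  moreover have "zeta_sum (Suc Y) s = zeta_sum Y s + of_nat (Suc Y) powr (-s)"
    unfolding zeta_sum_def by simp
  moreover have "(\<Sum>n=1..2*Suc Y. (-1)^(n-1) * of_nat n powr (-s)) =
     (\<Sum>n=1..2*Y. (-1)^(n-1) * of_nat n powr (-s)) + of_nat (Suc (2 * Y)) powr (-s)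
       - of_nat (2 * Suc Y) powr (-s)"
    unfolding two by simp
  ultimately show ?case using Suc by (simp only: ring_distribs) (simp add: algebra_simps)
qed

lemma norm_of_real_powr_diff_le:
  fixes w :: complex and x y :: real
  assumes "0 < x" "x \<le> y" "y \<le> x + 1" "Re w \<ge> -1"
  shows "norm (of_real y powr (-w) - of_real x powr (-w)) \<le> norm w * x powr (-Re w - 1)"
proof -
  have "norm (of_real y powr (-w) - of_real x powr (-w)) \<le> norm w * x powr (-Re w - 1) * (y - x)"
  proof (rule norm_diff_of_real_le[where f' = "\<lambda>z. -w * z powr (-w - 1)"])
    fix r assume r: "x \<le> r" "r \<le> y"
    show "((\<lambda>z. z powr (-w)) has_field_derivative -w * of_real r powr (-w - 1)) (at (of_real r))"
      using r assms by (intro has_field_derivative_powr) (auto simp: complex_nonpos_Reals_iff)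
    have "norm (complex_of_real r powr (-w - 1)) = r powr (-Re w - 1)"
      using r assms by (simp add: norm_powr_real_powr)
    also have "\<dots> \<le> x powr (-Re w - 1)"
      using r assms by (intro powr_mono2') auto
    finally show "norm (-w * complex_of_real r powr (-w - 1)) \<le> norm w * x powr (-Re w - 1)"
      by (simp add: norm_mult mult_left_mono)
  qed (use assms in auto)
  also have "\<dots> \<le> norm w * x powr (-Re w - 1) * 1"
    using assms by (intro mult_left_mono) auto
  finally show ?thesis by simp
qed

lemma norm_powr_antiderivative_step_le:
  fixes w :: complex and x :: real
  assumes "x > 0" "w \<noteq> 1" "Re w \<ge> -1"
  shows "norm ((of_real (x + 1) powr (1 - w) - of_real x powr (1 - w)) / (1 - w)
      - of_real x powr (-w))
    \<le> norm w * x powr (-Re w - 1)"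
proof -
  define f where "f = (\<lambda>z :: complex. z powr (1 - w) / (1 - w) - z * of_real x powr (-w))"
  have "norm (f (of_real (x + 1)) - f (of_real x)) \<le> norm w * x powr (-Re w - 1) * (x + 1 - x)"
  proof (rule norm_diff_of_real_le[where f' = "\<lambda>z. z powr (-w) - of_real x powr (-w)"])
    fix y assume y: "x \<le> y" "y \<le> x + 1"
    have nz: "complex_of_real y \<notin> \<real>\<^sub>\<le>\<^sub>0" using y assms(1) by (auto simp: complex_nonpos_Reals_iff)
    have "((\<lambda>z. z powr (1 - w) / (1 - w) - z * of_real x powr (-w)) has_field_derivative
        ((1 - w) * of_real y powr (1 - w - 1)) / (1 - w)
          - 1 * of_real x powr (-w)) (at (of_real y))"
      by (intro DERIV_diff DERIV_cdivide DERIV_cmult_right DERIV_ident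
        has_field_derivative_powr[OF nz])
    thus "(f has_field_derivative of_real y powr (-w) - of_real x powr (-w)) (at (of_real y))"
      unfolding f_def using assms(2) by simp
    show "norm (complex_of_real y powr (-w) - of_real x powr (-w)) \<le> norm w * x powr (-Re w - 1)"
      using assms y by (intro norm_of_real_powr_diff_le) auto
  qed simp
  moreover have "f (of_real (x + 1)) - f (of_real x) =
      (of_real (x + 1) powr (1 - w) - of_real x powr (1 - w)) / (1 - w) - of_real x powr (-w)"
    unfolding f_def by (simp add: field_simps diff_divide_distrib)
  ultimately show ?thesis by simp
qed

lemma norm_sum_powr_minus_antiderivative_le:
  fixes w :: complex and m n :: nat
  assumes "m > 0" "w \<noteq> 1" "Re w \<ge> -1" "m \<le> n"
  shows "norm ((\<Sum>k=m..<n. of_nat k powr (-w))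
      - (of_nat n powr (1 - w) - of_nat m powr (1 - w)) / (1 - w))
     \<le> norm w * (\<Sum>k=m..<n. real k powr (-Re w - 1))"
proof -
  have "(of_nat n powr (1 - w) - of_nat m powr (1 - w)) / (1 - w) =
     (\<Sum>k=m..<n. (of_nat (Suc k) powr (1 - w) - of_nat k powr (1 - w)) / (1 - w))"
    using assms(4) sum_Suc_diff'[of m n "\<lambda>k. of_nat k powr (1 - w)"]
    by (simp only: sum_divide_distrib[symmetric])
  hence "norm ((\<Sum>k=m..<n. of_nat k powr (-w))
      - (of_nat n powr (1 - w) - of_nat m powr (1 - w)) / (1 - w)) =
     norm (\<Sum>k=m..<n. (of_nat (Suc k) powr (1 - w) - of_nat k powr (1 - w)) / (1 - w)
       - of_nat k powr (-w))"
    by (simp add: sum_subtractf norm_minus_commute)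
  also have "\<dots> \<le> (\<Sum>k=m..<n. norm w * real k powr (-Re w - 1))"
  proof (rule sum_norm_le)
    fix k assume "k \<in> {m..<n}"
    thus "norm ((of_nat (Suc k) powr (1 - w) - of_nat k powr (1 - w)) / (1 - w)
        - of_nat k powr (-w))
        \<le> norm w * real k powr (-Re w - 1)"
      using norm_powr_antiderivative_step_le[of "real k" w] assms by (simp add: add.commute)
  qed
  finally show ?thesis by (simp add: sum_distrib_left)
qed

lemma norm_zeta_sum_minus_antiderivative_bounded:
  assumes s: "Re s \<ge> 1/2" "s \<noteq> 1"
  obtains B where "\<And>n. n > 0 \<Longrightarrow> norm (zeta_sum n s - of_nat n powr (1 - s) / (1 - s)) \<le> B"
proof -
  have "norm (zeta_sum n s - of_nat n powr (1 - s) / (1 - s)) \<le> norm s * zeta_three_halves + 1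
      + norm (1 / (1 - s))"
    if n: "n > 0" for n
  proof -
    have "(\<Sum>k=1..<n. real k powr (-Re s - 1)) \<le> (\<Sum>k=1..<n. real k powr (-3/2))"
      using s by (intro sum_mono powr_mono) auto
    also have "\<dots> \<le> (\<Sum>k=1..n. real k powr (-3/2))" by (intro sum_mono2) auto
    also note sum_powr_three_halves_le
    finally have integral: "norm ((\<Sum>k=1..<n. of_nat k powr (-s))
        - (of_nat n powr (1 - s) - 1) / (1 - s))
        \<le> norm s * zeta_three_halves"
      using norm_sum_powr_minus_antiderivative_le[of 1 s n] s n
      by (auto intro: order_trans[OF _ mult_left_mono])
    have last: "norm (of_nat n powr (-s)) \<le> 1"
      using n s powr_mono2'[of "- Re s" 1 "real n"] norm_powr_real_powr[of "of_nat n" "-s"] by simp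
    have "{1..n} = insert n {1..<n}" using n by auto
    hence "zeta_sum n s = of_nat n powr (-s) + (\<Sum>k=1..<n. of_nat k powr (-s))"
      unfolding zeta_sum_def by simp
    hence "zeta_sum n s - of_nat n powr (1 - s) / (1 - s) =
       ((\<Sum>k=1..<n. of_nat k powr (-s)) - (of_nat n powr (1 - s) - 1) / (1 - s)) + of_nat n powr (-s)
         - 1 / (1 - s)"
      by (simp add: diff_divide_distrib)
    also have "norm \<dots> \<le> norm s * zeta_three_halves + 1 + norm (1 / (1 - s))"
      by (intro norm_triangle_le norm_triangle_le_diff add_mono integral last order_refl)
    finally show ?thesis .
  qed
  thus ?thesis using that by blast
qed

definition zeta_remainder :: "nat \<Rightarrow> complex \<Rightarrow> complex" where
  "zeta_remainder Y s = zeta_sum Y s - riemann_zeta s - of_nat Y powr (1 - s) / (1 - s)"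

lemma norm_of_nat_powr_critical:
  assumes "Re s = 1/2"
  shows "norm (of_nat n powr (1 - s)) = sqrt n"
  using norm_powr_real_powr[of "of_nat n" "1 - s"] assms
  by (cases "n = 0") (auto simp: powr_half_sqrt)

lemma norm_zeta_remainder_double_le:
  assumes s: "Re s = 1/2" and adm: "admissible_length K s Y"
  shows "norm (zeta_remainder (2 * Y) s - 2 powr (1 - s) * zeta_remainder Y s) \<le>
      1 + zeta_three_halves"
proof -
  define q where "q = (2::complex) powr (1 - s)"
  have "q \<noteq> 1" using norm_of_nat_powr_critical[OF s, of 2] unfolding q_def by auto
  hence "dirichlet_eta s = (1 - q) * riemann_zeta s"
    unfolding riemann_zeta_def q_def[symmetric] by simp
  hence eta: "dirichlet_eta s = riemann_zeta s - q * riemann_zeta s" by (simp add: algebra_simps)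
  have "admissible_length K s (Suc (2 * Y))" by (rule admissible_length_mono[OF adm]) simp
  then obtain t where t: "(\<lambda>n. (-1)^n * of_nat (Suc (2 * Y) + n) powr (-s)) sums t"
      "norm t \<le> 1 + zeta_three_halves"
    using alternating_powr_sums[of s K "Suc (2 * Y)"] s by auto
  have "dirichlet_eta s = zeta_sum (2 * Y) s - q * zeta_sum Y s + t"
    unfolding q_def zeta_sum_double dirichlet_eta_partial_sum[OF t(1)] by simp
  moreover have "of_nat (2 * Y) powr (1 - s) = q * of_nat Y powr (1 - s)"
    using powr_times_real[of 2 "of_nat Y" "1 - s"] unfolding q_def by simp
  ultimately have "zeta_remainder (2 * Y) s - q * zeta_remainder Y s = -t"
    using eta unfolding zeta_remainder_def by (simp add: algebra_simps)
  thus ?thesis using t(2) unfolding q_def by simp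
qed

lemma bounded_expanding_le:
  fixes a :: "nat \<Rightarrow> real"
  assumes "bdd_above (range a)" "q > 1" and step: "\<And>j. q * a j \<le> a (Suc j) + C"
  shows "a j \<le> C / (q - 1)"
proof -
  let ?S = "SUP j. a j"
  have le: "a j \<le> ?S" for j using assms(1) by (intro cSUP_upper) auto
  have "?S \<le> (?S + C) / q"
  proof (rule cSUP_least)
    fix j
    have "q * a j \<le> ?S + C" using step[of j] le[of "Suc j"] by linarith
    thus "a j \<le> (?S + C) / q" using assms(2) by (simp add: field_simps)
  qed simp
  hence "?S \<le> C / (q - 1)" using assms(2) by (simp add: field_simps)
  thus ?thesis using le[of j] by linarith
qed

definition zeta_error :: real where
  "zeta_error = 3 * (1 + zeta_three_halves)"

lemma zeta_error_pos: "zeta_error > 0"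
  using zeta_three_halves_nonneg unfolding zeta_error_def by simp

text \<open>Doubling the length multiplies the remainder by \<open>2 powr (1 - s)\<close>, of modulus \<open>sqrt 2\<close>, up to
  a bounded error. As the remainder stays bounded for fixed \<open>s\<close>, it must be small from the start.\<close>

lemma norm_zeta_remainder_le:
  assumes s: "Re s = 1/2" and adm: "admissible_length K s Y"
  shows "norm (zeta_remainder Y s) \<le> zeta_error"
proof -
  define a where "a = (\<lambda>j. norm (zeta_remainder (2 ^ j * Y) s))"
  have "Re s \<ge> 1/2" "s \<noteq> 1" using s by auto
  then obtain B where B: "\<And>n. n > 0 \<Longrightarrow> norm (zeta_sum n s - of_nat n powr (1 - s) / (1 - s)) \<le> B"
    using norm_zeta_sum_minus_antiderivative_bounded by blast
  have "a j \<le> B + norm (riemann_zeta s)" for j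
  proof -
    have "2 ^ j * Y > 0" using admissible_length_imp_pos[OF adm] by simp
    hence "norm (zeta_sum (2 ^ j * Y) s - of_nat (2 ^ j * Y) powr (1 - s) / (1 - s)
        - riemann_zeta s)
        \<le> B + norm (riemann_zeta s)"
      by (intro norm_triangle_le_diff add_mono B) auto
    thus ?thesis unfolding a_def zeta_remainder_def by (simp only: diff_diff_eq add.commute)
  qed
  hence bdd: "bdd_above (range a)" by (intro bdd_aboveI2)
  have "sqrt 2 * a j \<le> a (Suc j) + (1 + zeta_three_halves)" for j
  proof -
    let ?R = "zeta_remainder (2 ^ j * Y) s" and ?R' = "zeta_remainder (2 * (2 ^ j * Y)) s"
    have "admissible_length K s (2 ^ j * Y)" by (rule admissible_length_mono[OF adm]) simp
    note norm_zeta_remainder_double_le[OF s this]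
    moreover have "norm (2 powr (1 - s) * ?R) = sqrt 2 * norm ?R"
      using norm_of_nat_powr_critical[OF s, of 2] by (simp add: norm_mult)
    ultimately show ?thesis
      using norm_triangle_sub[of "2 powr (1 - s) * ?R" ?R'] unfolding a_def
      by (simp add: norm_minus_commute mult.assoc)
  qed
  from bounded_expanding_le[OF bdd _ this, of 0]
  have "norm (zeta_remainder Y s) \<le> (1 + zeta_three_halves) / (sqrt 2 - 1)"
    unfolding a_def by simp
  also have "sqrt 2 \<ge> 4/3" by (rule real_le_rsqrt) (simp add: power2_eq_square)
  hence "(1 + zeta_three_halves) / (sqrt 2 - 1) \<le> (1 + zeta_three_halves) / (1 / 3)"
    using zeta_three_halves_nonneg by (intro divide_left_mono) auto
  finally show ?thesis unfolding zeta_error_def by simp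
qed

definition zeta_smooth_sum :: "nat \<Rightarrow> complex \<Rightarrow> complex" where
  "zeta_smooth_sum X s = (\<Sum>Y=X..<2*X. zeta_sum Y s) / of_nat X"

lemma norm_dyadic_sum_powr_le:
  assumes s: "Re s = 1/2" and X: "X > 0"
  shows "norm (\<Sum>Y=X..<2*X. of_nat Y powr (1 - s)) \<le>
      real X * norm (1 - s) + 8 * X * sqrt X / norm (2 - s)"
proof -
  let ?p = "\<Sum>Y=X..<2*X. of_nat Y powr (1 - s)"
    and ?q = "of_nat (2 * X) powr (2 - s) - of_nat X powr (2 - s)"
  have "norm (?p - ?q / (2 - s)) \<le> norm (s - 1) * (\<Sum>k=X..<2*X. real k powr (-1/2))"
    using norm_sum_powr_minus_antiderivative_le[of X "s - 1" "2 * X"] X s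
      by (simp add: complex_eq_iff)
  also have "(\<Sum>k=X..<2*X. real k powr (-1/2)) \<le> (\<Sum>k=X..<2*X. 1)"
    using X powr_mono2'[of "-1/2" 1] by (intro sum_mono) auto
  finally have "norm (?p - ?q / (2 - s)) \<le> norm (s - 1) * X"
    by (simp add: mult_left_mono)
  hence "norm (?p - ?q / (2 - s)) \<le> X * norm (1 - s)"
    by (simp only: norm_minus_commute mult.commute)
  moreover have "norm ?q \<le> 8 * X * sqrt X"
  proof -
    have norm_powr: "norm (of_nat n powr (2 - s)) = real n * sqrt (real n)" for n
      using norm_powr_real_powr[of "of_nat n" "2 - s"] s
      by (cases "n = 0") (auto simp: powr_half_sqrt[symmetric]
        powr_add[of "real n" 1 "1/2", simplified])
    have "norm ?q \<le> 2 * X * sqrt (2 * X) + X * sqrt X"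
      by (rule norm_triangle_le_diff) (simp only: norm_powr order_refl)
    also have "\<dots> \<le> 2 * X * (2 * sqrt X) + X * sqrt X"
      by (intro add_mono mult_left_mono)
        (auto simp: real_sqrt_mult sqrt2_less_2[THEN less_imp_le] intro!: mult_right_mono)
    also have "\<dots> \<le> 8 * X * sqrt X" by simp
    finally show ?thesis .
  qed
  hence "norm (?q / (2 - s)) \<le> 8 * X * sqrt X / norm (2 - s)"
    by (simp add: norm_divide divide_right_mono)
  ultimately show ?thesis using norm_triangle_sub[of ?p "?q / (2 - s)"] by linarith
qed

text \<open>Averaging over the length gains a second factor \<open>1 / Im s\<close> in the polar term.\<close>

lemma norm_zeta_smooth_sum_diff_le:
  assumes s: "Re s = 1/2" "Im s \<noteq> 0" and adm: "admissible_length K s X"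
  shows "norm (zeta_smooth_sum X s - riemann_zeta s) \<le> zeta_error + 1 + 8 * sqrt X / (Im s)\<^sup>2"
proof -
  define p where "p = (\<Sum>Y=X..<2*X. of_nat Y powr (1 - s))"
  have X: "X > 0" by (rule admissible_length_imp_pos[OF adm])
  have im: "norm (1 - s) \<ge> \<bar>Im s\<bar>" "norm (2 - s) \<ge> \<bar>Im s\<bar>"
    using abs_Im_le_cmod[of "1 - s"] abs_Im_le_cmod[of "2 - s"] by auto
  have pos: "norm (1 - s) > 0" "norm (2 - s) > 0" using im s by auto
  have "norm (\<Sum>Y=X..<2*X. zeta_remainder Y s) \<le> (\<Sum>Y=X..<2*X. zeta_error)"
    by (rule sum_norm_le) (auto intro: norm_zeta_remainder_le[OF s(1)]
      admissible_length_mono[OF adm])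
  moreover have "(\<Sum>Y=X..<2*X. zeta_remainder Y s) =
      of_nat X * (zeta_smooth_sum X s - riemann_zeta s) - p / (1 - s)"
    using X unfolding zeta_remainder_def zeta_smooth_sum_def p_def sum_subtractf
    by (simp add: right_diff_distrib sum_divide_distrib[symmetric])
  ultimately have "norm (of_nat X * (zeta_smooth_sum X s - riemann_zeta s)) \<le>
      X * zeta_error + norm (p / (1 - s))"
    using norm_triangle_sub[of "of_nat X * (zeta_smooth_sum X s - riemann_zeta s)" "p / (1 - s)"]
      by simp
  moreover have "norm (p / (1 - s)) \<le> X + 8 * X * sqrt X / (Im s)\<^sup>2"
  proof -
    have "norm (p / (1 - s)) \<le>
        (real X * norm (1 - s) + 8 * X * sqrt X / norm (2 - s)) / norm (1 - s)"
      unfolding p_def norm_divide using norm_dyadic_sum_powr_le[OF s(1) X]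
        by (intro divide_right_mono) auto
    also have "\<dots> = X + 8 * X * sqrt X / (norm (2 - s) * norm (1 - s))"
      using pos by (simp add: add_divide_distrib)
    also have "\<dots> \<le> X + 8 * X * sqrt X / (\<bar>Im s\<bar> * \<bar>Im s\<bar>)"
      using s im by (intro add_left_mono frac_le mult_mono)
        (auto simp: zero_less_mult_iff linorder_neq_iff)
    finally show ?thesis by (simp add: power2_eq_square)
  qed
  moreover have "norm (of_nat X * (zeta_smooth_sum X s - riemann_zeta s)) =
      X * norm (zeta_smooth_sum X s - riemann_zeta s)"
    by (simp add: norm_mult)
  ultimately have "X * norm (zeta_smooth_sum X s - riemann_zeta s) \<le>
      X * zeta_error + (X + 8 * X * sqrt X / (Im s)\<^sup>2)"
    by linarith
  also have "X * zeta_error + (X + 8 * X * sqrt X / (Im s)\<^sup>2) =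
      X * (zeta_error + 1 + 8 * sqrt X / (Im s)\<^sup>2)"
    by (simp add: algebra_simps)
  finally show ?thesis using X by (subst (asm) mult_le_cancel_left_pos) auto
qed

lemma norm_zeta_sum_diff_le:
  assumes s: "Re s = 1/2" "Im s \<noteq> 0" and adm: "admissible_length K s Y"
  shows "norm (zeta_sum Y s - riemann_zeta s) \<le> zeta_error + sqrt Y / \<bar>Im s\<bar>"
proof -
  have "norm (of_nat Y powr (1 - s) / (1 - s)) \<le> sqrt Y / \<bar>Im s\<bar>"
    unfolding norm_divide norm_of_nat_powr_critical[OF s(1)]
    using s abs_Im_le_cmod[of "1 - s"] by (intro frac_le) auto
  thus ?thesis
    using norm_zeta_remainder_le[OF s(1) adm]
      norm_triangle_sub[of "zeta_sum Y s - riemann_zeta s" "of_nat Y powr (1 - s) / (1 - s)"]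
    unfolding zeta_remainder_def by linarith
qed

section \<open>Dirichlet kernels and mean squares\<close>

definition dirichlet_kernel :: "nat \<Rightarrow> real \<Rightarrow> complex" where
  "dirichlet_kernel L x = (\<Sum>l<L. cis (real l * x))"

lemma dirichlet_kernel_mult: "(cis x - 1) * dirichlet_kernel L x = cis (real L * x) - 1"
  unfolding dirichlet_kernel_def
  by (induction L) (auto simp: algebra_simps cis_mult)

lemma norm_dirichlet_kernel_le: "norm (dirichlet_kernel L x) \<le> L"
  unfolding dirichlet_kernel_def by (rule order_trans[OF norm_sum]) simp

lemma dirichlet_kernel_minus: "dirichlet_kernel L (-x) = cnj (dirichlet_kernel L x)"
  unfolding dirichlet_kernel_def by (simp add: cis_cnj)

lemma half_le_sin:
  assumes "0 \<le> x" "x \<le> 1"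
  shows "x / 2 \<le> sin (x::real)"
proof (cases "x = 0")
  case False
  with assms have "0 < x" by simp
  then obtain z where z: "0 < z" "z < x" "sin x - sin 0 = (x - 0) * cos z"
    using MVT2[of 0 x sin cos] by (auto intro!: derivative_eq_intros)
  have "1 / 2 = cos (pi / 3)" by (simp add: cos_60)
  also have "\<dots> \<le> cos z" using z assms pi_gt3 by (intro cos_monotone_0_pi_le) auto
  finally show ?thesis using z assms by (simp add: mult_left_mono)
qed simp

lemma norm_dirichlet_kernel_le_inverse:
  assumes "x \<noteq> 0" "\<bar>x\<bar> \<le> 1"
  shows "norm (dirichlet_kernel L x) \<le> 4 / \<bar>x\<bar>"
proof -
  have "\<bar>x\<bar> / 2 \<le> \<bar>sin x\<bar>"
    using half_le_sin[of "\<bar>x\<bar>"] assms by (cases "x \<ge> 0") (auto simp: abs_if split: if_splits)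
  also have "\<dots> \<le> norm (cis x - 1)" using abs_Im_le_cmod[of "cis x - 1"] by simp
  finally have "\<bar>x\<bar> / 2 * norm (dirichlet_kernel L x) \<le>
      norm (cis x - 1) * norm (dirichlet_kernel L x)"
    by (intro mult_right_mono) auto
  also have "\<dots> = norm (cis (real L * x) - 1)"
    by (simp only: norm_mult[symmetric] dirichlet_kernel_mult)
  also have "\<dots> \<le> 2"
    using norm_triangle_ineq4[of "cis (real L * x)" 1] by simp
  finally show ?thesis using assms by (simp add: field_simps)
qed

lemma dirichlet_kernel_eq_0:
  assumes "i < Q" "j < Q" "i \<noteq> j"
  shows "dirichlet_kernel Q (2 * pi * (real i - real j) / real Q) = 0"
proof -
  let ?z = "2 * pi * (real i - real j) / real Q"
  have "cis ?z \<noteq> 1"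
  proof
    assume "cis ?z = 1"
    hence "cos ?z = 1" by (simp add: complex_eq_iff)
    then obtain n :: int where "?z = real_of_int n * 2 * pi" using cos_one_2pi_int by blast
    hence "2 * pi * (real i - real j) = 2 * pi * (real_of_int n * real Q)"
      using assms by (simp add: field_simps)
    hence "real i - real j = real_of_int n * real Q" by (subst (asm) mult_cancel_left) simp
    hence "real_of_int (int i - int j) = real_of_int (n * int Q)" by simp
    hence multiple: "int i - int j = n * int Q" by (simp only: of_int_eq_iff)
    hence "n \<noteq> 0" using assms by auto
    hence "\<bar>n\<bar> * int Q \<ge> 1 * int Q" by (intro mult_right_mono) auto
    hence "\<bar>int i - int j\<bar> \<ge> int Q" unfolding multiple by (simp add: abs_mult)
    thus False using assms by linarith
  qed
  moreover have "cis (real Q * ?z) = 1"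
    using assms cis_multiple_2pi[of "real i - real j"] by simp
  ultimately show ?thesis using dirichlet_kernel_mult[of ?z Q] by simp
qed

lemma norm_dirichlet_kernel_ge_half:
  assumes "\<bar>z + 2 * pi * of_int n\<bar> * real L \<le> pi / 3"
  shows "norm (dirichlet_kernel L z) \<ge> L / 2"
proof -
  let ?y = "z + 2 * pi * of_int n"
  have periodic: "cis (real l * z) = cis (real l * ?y)" for l
  proof -
    have "cis (real l * ?y) = cis (real l * z) * cis (2 * pi * (real l * of_int n))"
      by (simp add: cis_mult algebra_simps)
    also have "cis (2 * pi * (real l * of_int n)) = 1" by (rule cis_multiple_2pi) auto
    finally show ?thesis by simp
  qed
  have "real L / 2 = (\<Sum>l<L. 1 / 2)" by simp
  also have "\<dots> \<le> (\<Sum>l<L. cos (real l * ?y))"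
  proof (rule sum_mono)
    fix l assume "l \<in> {..<L}"
    hence "\<bar>real l * ?y\<bar> \<le> real L * \<bar>?y\<bar>" unfolding abs_mult by (intro mult_right_mono) auto
    hence "\<bar>real l * ?y\<bar> \<le> pi / 3" using assms by (simp add: mult.commute)
    hence "cos (pi / 3) \<le> cos \<bar>real l * ?y\<bar>" by (intro cos_monotone_0_pi_le) auto
    thus "1 / 2 \<le> cos (real l * ?y)" by (simp add: cos_60)
  qed
  also have "\<dots> = Re (dirichlet_kernel L z)"
    unfolding dirichlet_kernel_def periodic by simp
  also have "\<dots> \<le> norm (dirichlet_kernel L z)" by (rule complex_Re_le_cmod)
  finally show ?thesis .
qed

lemma sum_norm_exp_sum_squared:
  fixes c :: "'a \<Rightarrow> complex" and x :: "'a \<Rightarrow> real"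
  shows "of_real (\<Sum>l<L. (norm (\<Sum>n\<in>S. c n * cis (real l * x n)))\<^sup>2) =
    (\<Sum>n\<in>S. \<Sum>m\<in>S. c n * cnj (c m) * dirichlet_kernel L (x n - x m))"
proof -
  have "of_real (\<Sum>l<L. (norm (\<Sum>n\<in>S. c n * cis (real l * x n)))\<^sup>2) =
    (\<Sum>l<L. (\<Sum>n\<in>S. c n * cis (real l * x n)) * (\<Sum>m\<in>S. cnj (c m) * cis (-(real l * x m))))"
    by (simp only: of_real_sum complex_norm_square cnj_sum complex_cnj_mult cis_cnj)
  also have "\<dots> = (\<Sum>l<L. \<Sum>n\<in>S. \<Sum>m\<in>S. c n * cnj (c m) * cis (real l * (x n - x m)))"
    by (simp add: sum_product cis_mult[symmetric] algebra_simps diff_conv_add_uminus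
      del: add_uminus_conv_diff)
  also have "\<dots> = (\<Sum>n\<in>S. \<Sum>m\<in>S. c n * cnj (c m) * dirichlet_kernel L (x n - x m))"
    unfolding dirichlet_kernel_def sum_distrib_left
    by (subst sum.swap, intro sum.cong refl, subst sum.swap) simp
  finally show ?thesis .
qed

lemma schur_test:
  fixes a :: "'a \<Rightarrow> real" and D :: "'a \<Rightarrow> 'a \<Rightarrow> real"
  assumes sym: "\<And>n m. D n m = D m n" and nonneg: "\<And>n m. D n m \<ge> 0"
    and row: "\<And>n. n \<in> S \<Longrightarrow> (\<Sum>m\<in>S. D n m) \<le> W"
  shows "(\<Sum>n\<in>S. \<Sum>m\<in>S. a n * a m * D n m) \<le> W * (\<Sum>n\<in>S. (a n)\<^sup>2)"
proof -
  have "(\<Sum>n\<in>S. \<Sum>m\<in>S. a n * a m * D n m) \<le> (\<Sum>n\<in>S. \<Sum>m\<in>S. ((a n)\<^sup>2 * D n m + (a m)\<^sup>2 * D n m) / 2)"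
  proof (intro sum_mono)
    fix n m
    have "a n * a m * D n m \<le> ((a n)\<^sup>2 + (a m)\<^sup>2) / 2 * D n m"
      using sum_squares_bound[of "a n" "a m"] by (intro mult_right_mono nonneg) auto
    thus "a n * a m * D n m \<le> ((a n)\<^sup>2 * D n m + (a m)\<^sup>2 * D n m) / 2" by (simp add: algebra_simps)
  qed
  also have "\<dots> = ((\<Sum>n\<in>S. \<Sum>m\<in>S. (a n)\<^sup>2 * D n m) + (\<Sum>n\<in>S. \<Sum>m\<in>S. (a m)\<^sup>2 * D n m)) / 2"
    by (simp add: sum.distrib sum_divide_distrib add_divide_distrib)
  also have "(\<Sum>n\<in>S. \<Sum>m\<in>S. (a m)\<^sup>2 * D n m) = (\<Sum>n\<in>S. \<Sum>m\<in>S. (a n)\<^sup>2 * D n m)"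
    by (subst sum.swap) (intro sum.cong refl arg_cong2[where f = "(*)"] sym)
  also have "(\<Sum>n\<in>S. \<Sum>m\<in>S. (a n)\<^sup>2 * D n m) \<le> (\<Sum>n\<in>S. (a n)\<^sup>2 * W)"
    by (simp only: sum_distrib_left[symmetric]) (intro sum_mono mult_left_mono row, auto)
  also have "\<dots> = W * (\<Sum>n\<in>S. (a n)\<^sup>2)" by (simp only: sum_distrib_left mult.commute)
  finally show ?thesis by simp
qed

lemma large_sieve_row_sum:
  fixes c :: "'a \<Rightarrow> complex" and x :: "'a \<Rightarrow> real"
  assumes row: "\<And>n. n \<in> S \<Longrightarrow> (\<Sum>m\<in>S. norm (dirichlet_kernel L (x n - x m))) \<le> W"
  shows "(\<Sum>l<L. (norm (\<Sum>n\<in>S. c n * cis (real l * x n)))\<^sup>2) \<le> W * (\<Sum>n\<in>S. (norm (c n))\<^sup>2)"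
proof -
  have sym: "norm (dirichlet_kernel L (x n - x m)) = norm (dirichlet_kernel L (x m - x n))" for n m
    using dirichlet_kernel_minus[of L "x n - x m"] by simp
  have "\<bar>\<Sum>l<L. (norm (\<Sum>n\<in>S. c n * cis (real l * x n)))\<^sup>2\<bar> =
      norm (\<Sum>n\<in>S. \<Sum>m\<in>S. c n * cnj (c m) * dirichlet_kernel L (x n - x m))"
    by (simp only: sum_norm_exp_sum_squared[symmetric] norm_of_real)
  also have "\<dots> \<le> (\<Sum>n\<in>S. \<Sum>m\<in>S. norm (c n) * norm (c m) * norm (dirichlet_kernel L (x n - x m)))"
    by (intro sum_norm_le) (simp add: norm_mult)
  also have "\<dots> \<le> W * (\<Sum>n\<in>S. (norm (c n))\<^sup>2)"
    by (rule schur_test[OF sym norm_ge_zero row])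
  finally show ?thesis by linarith
qed

text \<open>The classes serve to keep the frequencies within a class away from the other periods of the
  kernel; splitting into them costs only their number.\<close>

lemma large_sieve_classes:
  fixes c :: "'a \<Rightarrow> complex" and x :: "'a \<Rightarrow> real" and g :: "'a \<Rightarrow> nat"
  assumes fin: "finite A" and g: "g ` A \<subseteq> {..<J}"
    and row: "\<And>n. n \<in> A \<Longrightarrow> (\<Sum>m | m \<in> A \<and> g m = g n. norm (dirichlet_kernel L (x n - x m))) \<le> W"
  shows "(\<Sum>l<L. (norm (\<Sum>n\<in>A. c n * cis (real l * x n)))\<^sup>2) \<le> J * (W * (\<Sum>n\<in>A. (norm (c n))\<^sup>2))"
proof -
  define S where "S = (\<lambda>j. {n\<in>A. g n = j})"
  define F where "F = (\<lambda>j l. \<Sum>n\<in>S j. c n * cis (real l * x n))"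
  have group: "(\<Sum>j<J. \<Sum>n\<in>S j. h n) = (\<Sum>n\<in>A. h n)" for h :: "'a \<Rightarrow> 'b :: comm_monoid_add"
    unfolding S_def by (rule sum.group) (use fin g in auto)
  have "(\<Sum>l<L. (norm (\<Sum>n\<in>A. c n * cis (real l * x n)))\<^sup>2) \<le> (\<Sum>l<L. J * (\<Sum>j<J. (norm (F j l))\<^sup>2))"
  proof (rule sum_mono)
    fix l
    have "(norm (\<Sum>n\<in>A. c n * cis (real l * x n)))\<^sup>2 \<le> (\<Sum>j<J. norm (F j l))\<^sup>2"
      unfolding F_def group[symmetric] by (intro power_mono norm_sum norm_ge_zero)
    also have "\<dots> \<le> (\<Sum>j<J. (norm (F j l))\<^sup>2) * card {..<J}"
      by (rule sum_squared_le_sum_of_squares)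
    finally show "(norm (\<Sum>n\<in>A. c n * cis (real l * x n)))\<^sup>2 \<le> J * (\<Sum>j<J. (norm (F j l))\<^sup>2)"
      by (simp add: mult.commute)
  qed
  also have "\<dots> = J * (\<Sum>j<J. \<Sum>l<L. (norm (F j l))\<^sup>2)"
    by (subst sum.swap) (simp add: sum_distrib_left)
  also have "\<dots> \<le> J * (\<Sum>j<J. W * (\<Sum>n\<in>S j. (norm (c n))\<^sup>2))"
    unfolding F_def
  proof (intro mult_left_mono sum_mono large_sieve_row_sum)
    fix j n assume "n \<in> S j"
    thus "(\<Sum>m\<in>S j. norm (dirichlet_kernel L (x n - x m))) \<le> W" using row[of n] unfolding S_def
      by simp
  qed simp
  also have "(\<Sum>j<J. W * (\<Sum>n\<in>S j. (norm (c n))\<^sup>2)) = W * (\<Sum>n\<in>A. (norm (c n))\<^sup>2)"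
    unfolding sum_distrib_left[symmetric] group ..
  finally show ?thesis .
qed

lemma harm_le_Suc_ln:
  assumes "n > 0"
  shows "harm n \<le> 1 + ln (real n)"
  using decseqD[OF decseq_harm_diff_ln, of 0 "n - 1"] assms by (simp add: harm_expand)

lemma sum_inverse_dist_le:
  assumes "n \<in> {1..Y}"
  shows "(\<Sum>m\<in>{1..Y}-{n}. 1 / \<bar>real n - real m\<bar>) \<le> 2 * harm Y"
proof -
  have "(\<Sum>m\<in>{1..Y}-{n}. 1 / \<bar>real n - real m\<bar>) =
      (\<Sum>m\<in>{1..<n}. 1 / \<bar>real n - real m\<bar>) + (\<Sum>m\<in>{n<..Y}. 1 / \<bar>real n - real m\<bar>)"
    using assms by (subst sum.union_disjoint[symmetric]) (auto intro!: sum.cong)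
  also have "(\<Sum>m\<in>{1..<n}. 1 / \<bar>real n - real m\<bar>) = (\<Sum>j\<in>{1..<n}. inverse (real j))"
    by (rule sum.reindex_bij_witness[of _ "\<lambda>j. n - j" "\<lambda>m. n - m"])
      (auto simp: of_nat_diff field_simps)
  also have "(\<Sum>m\<in>{n<..Y}. 1 / \<bar>real n - real m\<bar>) = (\<Sum>j\<in>{1..Y-n}. inverse (real j))"
    by (rule sum.reindex_bij_witness[of _ "\<lambda>j. n + j" "\<lambda>m. m - n"])
      (auto simp: of_nat_diff field_simps)
  also have "(\<Sum>j\<in>{1..<n}. inverse (real j)) \<le> harm Y"
    unfolding harm_def using assms by (intro sum_mono2) auto
  also have "(\<Sum>j\<in>{1..Y-n}. inverse (real j)) \<le> harm Y"
    unfolding harm_def by (intro sum_mono2) auto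
  finally show ?thesis by simp
qed

lemma abs_ln_diff_ge:
  assumes "n \<in> {1..Y}" "m \<in> {1..Y}"
  shows "\<bar>ln (real n) - ln (real m)\<bar> \<ge> \<bar>real n - real m\<bar> / Y"
proof -
  have ordered: "ln (real b) - ln (real a) \<ge> (real b - real a) / Y" if "1 \<le> a" "a \<le> b" "b \<le> Y"
    for a b
  proof -
    have "ln (real a / real b) \<le> real a / real b - 1" using that by (intro ln_le_minus_one) auto
    hence "ln (real b) - ln (real a) \<ge> (real b - real a) / real b"
      using that by (simp add: ln_div field_simps)
    moreover have "(real b - real a) / real b \<ge> (real b - real a) / real Y"
      using that by (intro divide_left_mono) auto
    ultimately show ?thesis by linarith
  qed
  show ?thesis using ordered[of n m] ordered[of m n] assms
    by (cases "n \<le> m") (auto simp: abs_if field_simps)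
qed

lemma of_nat_powr_critical_line:
  assumes "n > 0"
  shows "of_nat n powr (- Complex (1/2) t) = of_real (1 / sqrt n) * cis (- (t * ln n))"
proof -
  have "complex_of_nat n powr (- Complex (1/2) t) = exp (- Complex (1/2) t * of_real (ln n))"
    using assms by (simp add: powr_def Ln_of_nat)
  also have "- Complex (1/2) t * of_real (ln n) = of_real (- ln n / 2) + \<i> * of_real (- (t * ln n))"
    by (simp add: complex_eq_iff)
  also have "exp \<dots> = of_real (exp (- ln n / 2)) * cis (- (t * ln n))"
    by (simp only: exp_add cis_conv_exp exp_of_real)
  also have "exp (- ln n / 2) = 1 / sqrt n"
    using assms by (simp add: exp_minus field_simps ln_sqrt[symmetric])
  finally show ?thesis .
qed

lemma norm_dirichlet_kernel_ln_le:
  fixes \<alpha> :: real and n m Y :: nat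
  assumes \<alpha>: "\<alpha> > 0" and nm: "n \<in> {1..Y}" "m \<in> {1..Y}" "m \<noteq> n"
    and same_class: "nat \<lfloor>\<alpha> * ln n\<rfloor> = nat \<lfloor>\<alpha> * ln m\<rfloor>"
  shows "norm (dirichlet_kernel L (- (\<alpha> * ln n) - - (\<alpha> * ln m))) \<le>
      4 * Y / \<alpha> * (1 / \<bar>real n - real m\<bar>)"
proof -
  let ?z = "- (\<alpha> * ln n) - - (\<alpha> * ln m)"
  have "\<alpha> * ln n \<ge> 0" "\<alpha> * ln m \<ge> 0" using nm \<alpha> by auto
  hence "\<lfloor>\<alpha> * ln n\<rfloor> = \<lfloor>\<alpha> * ln m\<rfloor>" using same_class by (simp add: eq_nat_nat_iff)
  hence close: "\<bar>?z\<bar> \<le> 1" by linarith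
  have pos: "\<alpha> * (\<bar>real n - real m\<bar> / Y) > 0" using \<alpha> nm by auto
  have "?z = -(\<alpha> * (ln n - ln m))" by (simp add: algebra_simps)
  hence "\<bar>?z\<bar> = \<alpha> * \<bar>ln n - ln m\<bar>" using \<alpha> by (simp only: abs_minus_cancel abs_mult abs_of_pos)
  also have "\<dots> \<ge> \<alpha> * (\<bar>real n - real m\<bar> / Y)"
    using nm \<alpha> by (intro mult_left_mono abs_ln_diff_ge) auto
  finally have apart: "\<bar>?z\<bar> \<ge> \<alpha> * (\<bar>real n - real m\<bar> / Y)" .
  have "norm (dirichlet_kernel L ?z) \<le> 4 / \<bar>?z\<bar>"
    using close apart pos by (intro norm_dirichlet_kernel_le_inverse) auto
  also have "\<dots> \<le> 4 / (\<alpha> * (\<bar>real n - real m\<bar> / Y))"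
    using apart pos by (intro divide_left_mono mult_pos_pos[OF _ pos]) linarith+
  also have "\<dots> = 4 * Y / \<alpha> * (1 / \<bar>real n - real m\<bar>)" by simp
  finally show ?thesis .
qed

lemma sum_norm_dirichlet_kernel_ln_le:
  fixes \<alpha> :: real and n Y :: nat
  defines "g \<equiv> \<lambda>n::nat. nat \<lfloor>\<alpha> * ln n\<rfloor>"
  assumes \<alpha>: "\<alpha> > 0" and n: "n \<in> {1..Y}"
  shows "(\<Sum>m | m \<in> {1..Y} \<and> g m = g n. norm (dirichlet_kernel L (- (\<alpha> * ln n) - - (\<alpha> * ln m))))
    \<le> L + 8 * Y / \<alpha> * (1 + ln Y)"
proof -
  let ?D = "\<lambda>m. norm (dirichlet_kernel L (- (\<alpha> * ln n) - - (\<alpha> * ln m)))"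
    and ?S = "{m. m \<in> {1..Y} \<and> g m = g n}"
  have "(\<Sum>m\<in>?S. ?D m) = ?D n + (\<Sum>m\<in>?S - {n}. ?D m)"
    using n by (intro sum.remove) auto
  also have "\<dots> \<le> L + (\<Sum>m\<in>?S - {n}. 4 * Y / \<alpha> * (1 / \<bar>real n - real m\<bar>))"
  proof (intro add_mono norm_dirichlet_kernel_le sum_mono)
    fix m assume "m \<in> ?S - {n}"
    thus "?D m \<le> 4 * Y / \<alpha> * (1 / \<bar>real n - real m\<bar>)"
      using n \<alpha> by (intro norm_dirichlet_kernel_ln_le) (auto simp: g_def)
  qed
  also have "(\<Sum>m\<in>?S - {n}. 4 * Y / \<alpha> * (1 / \<bar>real n - real m\<bar>)) \<le>
      (\<Sum>m\<in>{1..Y} - {n}. 4 * Y / \<alpha> * (1 / \<bar>real n - real m\<bar>))"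
    using \<alpha> by (intro sum_mono2) auto
  also have "\<dots> \<le> 4 * Y / \<alpha> * (2 * harm Y)"
    unfolding sum_distrib_left[symmetric] using \<alpha> n
      by (intro mult_left_mono sum_inverse_dist_le) auto
  also have "\<dots> \<le> 4 * Y / \<alpha> * (2 * (1 + ln Y))"
    using \<alpha> n by (intro mult_left_mono harm_le_Suc_ln) auto
  also have "\<dots> = 8 * Y / \<alpha> * (1 + ln Y)" by simp
  finally show ?thesis by simp
qed

lemma zeta_sum_mean_square:
  fixes \<alpha> :: real
  assumes \<alpha>: "\<alpha> > 0" and Y: "Y > 0"
  shows "(\<Sum>l<L. (norm (zeta_sum Y (Complex (1/2) (\<alpha> * real l))))\<^sup>2) \<le>
    (\<alpha> * ln Y + 1) * ((L + 8 * Y / \<alpha> * (1 + ln Y)) * (1 + ln Y))"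
proof -
  define g where "g = (\<lambda>n::nat. nat \<lfloor>\<alpha> * ln n\<rfloor>)"
  define W where "W = L + 8 * Y / \<alpha> * (1 + ln Y)"
  let ?c = "\<lambda>n. complex_of_real (1 / sqrt (real n))"
  have lnY: "\<alpha> * ln Y \<ge> 0" "ln Y \<ge> 0" using \<alpha> Y by auto
  have g: "g ` {1..Y} \<subseteq> {..<Suc (g Y)}"
    unfolding g_def lessThan_Suc_atMost using \<alpha> by (auto intro!: nat_mono floor_mono mult_left_mono)
  have "zeta_sum Y (Complex (1/2) (\<alpha> * real l)) =
      (\<Sum>n\<in>{1..Y}. ?c n * cis (real l * - (\<alpha> * ln n)))" for l
    unfolding zeta_sum_def
    by (intro sum.cong refl, subst of_nat_powr_critical_line) (auto simp: algebra_simps)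
  hence "(\<Sum>l<L. (norm (zeta_sum Y (Complex (1/2) (\<alpha> * real l))))\<^sup>2) =
      (\<Sum>l<L. (norm (\<Sum>n\<in>{1..Y}. ?c n * cis (real l * - (\<alpha> * ln n))))\<^sup>2)" by simp
  also have "\<dots> \<le> Suc (g Y) * (W * (\<Sum>n\<in>{1..Y}. (norm (?c n))\<^sup>2))"
    unfolding W_def using sum_norm_dirichlet_kernel_ln_le[OF \<alpha>, of _ Y L]
    by (intro large_sieve_classes[OF _ g]) (auto simp: g_def)
  also have "(\<Sum>n\<in>{1..Y}. (norm (?c n))\<^sup>2) = harm Y"
    unfolding harm_def by (intro sum.cong refl) (auto simp: norm_divide power_divide field_simps)
  also have "Suc (g Y) * (W * harm Y) \<le> (\<alpha> * ln Y + 1) * (W * (1 + ln Y))"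
  proof (intro mult_mono)
    show "real (Suc (g Y)) \<le> \<alpha> * ln Y + 1" using lnY unfolding g_def by linarith
    show "harm Y \<le> 1 + ln Y" using harm_le_Suc_ln[of Y] Y by simp
  qed (use lnY \<alpha> in \<open>auto simp: W_def intro!: mult_nonneg_nonneg harm_nonneg\<close>)
  finally show ?thesis unfolding W_def by simp
qed

section \<open>The resonance inequality\<close>

lemma sum_abs_diff_le:
  fixes g :: "nat \<Rightarrow> real"
  assumes "\<And>l. g l \<ge> 0"
  shows "(\<Sum>a<L. if nat \<bar>int a - int c\<bar> < h then g (nat \<bar>int a - int c\<bar>) else 0) \<le> 2 * (\<Sum>l<h. g l)"
proof -
  define after where "after = {a\<in>{..<L}. c \<le> a \<and> a - c < h}"
  define before where "before = {a\<in>{..<L}. a < c \<and> c - a < h}"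
  have "(\<Sum>a<L. if nat \<bar>int a - int c\<bar> < h then g (nat \<bar>int a - int c\<bar>) else 0) =
      (\<Sum>a\<in>after \<union> before. g (nat \<bar>int a - int c\<bar>))"
    unfolding after_def before_def by (intro sum.mono_neutral_cong_right) auto
  also have "\<dots> = (\<Sum>a\<in>after. g (nat \<bar>int a - int c\<bar>)) + (\<Sum>a\<in>before. g (nat \<bar>int a - int c\<bar>))"
    unfolding after_def before_def by (intro sum.union_disjoint) auto
  also have "(\<Sum>a\<in>after. g (nat \<bar>int a - int c\<bar>)) = (\<Sum>l\<in>(\<lambda>a. a - c) ` after. g l)"
    by (subst sum.reindex) (auto simp: after_def inj_on_def nat_diff_distrib
      intro!: sum.cong arg_cong[where f = g])
  also have "\<dots> \<le> (\<Sum>l<h. g l)"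
    using assms by (intro sum_mono2) (auto simp: after_def)
  also have "(\<Sum>a\<in>before. g (nat \<bar>int a - int c\<bar>)) = (\<Sum>l\<in>(\<lambda>a. c - a) ` before. g l)"
    by (subst sum.reindex) (auto simp: before_def inj_on_def nat_diff_distrib
      intro!: sum.cong arg_cong[where f = g])
  also have "\<dots> \<le> (\<Sum>l<h. g l)"
    using assms by (intro sum_mono2) (auto simp: before_def)
  finally show ?thesis by simp
qed

lemma sum_cis_diff_eq_kernel:
  "(\<Sum>a<L. \<Sum>c<L. cis (real_of_int (int a - int c) * z)) = of_real ((norm (dirichlet_kernel L z))\<^sup>2)"
  unfolding complex_norm_square dirichlet_kernel_def cnj_sum cis_cnj sum_product cis_mult
  by (intro sum.cong refl arg_cong[where f = cis]) (simp add: algebra_simps)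

lemma trig_poly_mult_norm_square:
  fixes w r x y :: "nat \<Rightarrow> real" and l :: int
  shows "(\<Sum>k\<in>A. of_real (w k) * cis (- (of_int l * x k))) *
      of_real ((norm (\<Sum>j<Q. of_real (r j) * cis (of_int l * y j)))\<^sup>2) =
    (\<Sum>k\<in>A. \<Sum>i<Q. \<Sum>j<Q. of_real (w k * r i * r j) * cis (of_int l * (y i - y j - x k)))"
proof -
  let ?e = "\<lambda>z. cis (of_int l * z)"
  have "cis (- (of_int l * x k)) * (?e (y i) * cis (- (of_int l * y j))) = ?e (y i - y j - x k)"
    for i j k
    unfolding cis_mult by (rule arg_cong[where f = cis]) (simp add: algebra_simps)
  hence combine: "of_real (w k) * cis (- (of_int l * x k)) *
      ((of_real (r i) * ?e (y i)) * (of_real (r j) * cis (- (of_int l * y j)))) =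
      of_real (w k * r i * r j) * ?e (y i - y j - x k)" for i j k
    by (simp add: mult_ac)
  have square: "of_real ((norm (\<Sum>j<Q. of_real (r j) * ?e (y j)))\<^sup>2) =
      (\<Sum>i<Q. \<Sum>j<Q. (of_real (r i) * ?e (y i)) * (of_real (r j) * cis (- (of_int l * y j))))"
    by (simp only: complex_norm_square cnj_sum complex_cnj_mult complex_cnj_complex_of_real cis_cnj
      sum_product)
  show ?thesis by (subst square, subst sum_distrib_right) (simp only: sum_distrib_left combine)
qed

lemma fejer_mean_expansion:
  fixes w r x y :: "nat \<Rightarrow> real" and A :: "nat set" and Q L :: nat
  defines "P \<equiv> \<lambda>l::int. \<Sum>k\<in>A. of_real (w k) * cis (- (of_int l * x k))"
    and "R \<equiv> \<lambda>l::int. \<Sum>j<Q. of_real (r j) * cis (of_int l * y j)"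
  shows "(\<Sum>a<L. \<Sum>c<L. P (int a - int c) * of_real ((norm (R (int a - int c)))\<^sup>2)) =
    of_real (\<Sum>k\<in>A. \<Sum>i<Q. \<Sum>j<Q. w k * r i * r j * (norm (dirichlet_kernel L (y i - y j - x k)))\<^sup>2)"
proof -
  have "(\<Sum>a<L. \<Sum>c<L. P (int a - int c) * of_real ((norm (R (int a - int c)))\<^sup>2)) =
    (\<Sum>a<L. \<Sum>c<L. \<Sum>k\<in>A. \<Sum>i<Q. \<Sum>j<Q. of_real (w k * r i * r j) *
      cis (of_int (int a - int c) * (y i - y j - x k)))"
    unfolding P_def R_def trig_poly_mult_norm_square ..
  also have "\<dots> = (\<Sum>k\<in>A. \<Sum>i<Q. \<Sum>j<Q. \<Sum>a<L. \<Sum>c<L. of_real (w k * r i * r j) *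
      cis (of_int (int a - int c) * (y i - y j - x k)))"
    by (simp only: sum.swap[of _ "{..<Q}" "{..<L}"] sum.swap[of _ A "{..<L}"])
  also have "\<dots> = (\<Sum>k\<in>A. \<Sum>i<Q. \<Sum>j<Q. of_real (w k * r i * r j) *
      of_real ((norm (dirichlet_kernel L (y i - y j - x k)))\<^sup>2))"
    by (simp only: sum_distrib_left[symmetric] sum_cis_diff_eq_kernel)
  finally show ?thesis by (simp only: of_real_sum of_real_mult)
qed

lemma sum_norm_grid_poly_squared_le:
  fixes c :: "nat \<Rightarrow> complex"
  shows "(\<Sum>a<Q. (norm (\<Sum>j<Q. c j * cis (real a * (2 * pi * real j / real Q))))\<^sup>2) \<le>
      Q * (\<Sum>j<Q. (norm (c j))\<^sup>2)"
proof (rule large_sieve_row_sum)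
  fix n assume n: "n \<in> {..<Q}"
  let ?D = "\<lambda>m. norm (dirichlet_kernel Q (2 * pi * real n / real Q - 2 * pi * real m / real Q))"
  have "(\<Sum>m<Q. ?D m) = (\<Sum>m<Q. if m = n then ?D m else 0)"
  proof (intro sum.cong refl)
    fix m assume "m \<in> {..<Q}"
    thus "?D m = (if m = n then ?D m else 0)"
      using dirichlet_kernel_eq_0[of n Q m] n by (auto simp: diff_divide_distrib right_diff_distrib)
  qed
  also have "\<dots> = ?D n" using n by simp
  also have "\<dots> \<le> Q" by (rule norm_dirichlet_kernel_le)
  finally show "(\<Sum>m<Q. ?D m) \<le> real Q" .
qed

text \<open>The frequencies of the resonator are rounded to the grid \<open>2\<pi>j/Q\<close> with \<open>Q = 8L\<close>, so that its
  mean square is controlled by Parseval's identity; the coefficient at a grid point is the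
  \<open>\<ell>\<^sup>2\<close>-norm of the weights rounded to it, which by Cauchy--Schwarz loses nothing in the lower bound.
  The double sum over \<open>a - c\<close> is a Fejer kernel in disguise: all terms are nonnegative, so
  unwanted coincidences between frequencies may be dropped.\<close>

locale resonance =
  fixes w f x :: "nat \<Rightarrow> real" and A I :: "nat set" and E :: "(nat \<times> nat) set" and L :: nat
  assumes L_pos: "L > 0" and finite_A: "finite A" and finite_I: "finite I"
    and w_nonneg: "\<And>k. w k \<ge> 0" and f_nonneg: "\<And>m. f m \<ge> 0"
    and E_subset: "E \<subseteq> A \<times> I"
    and E_mult: "\<And>k m. (k, m) \<in> E \<Longrightarrow> k > 0 \<and> k * m \<in> I \<and> x (k * m) = x k + x m"
begin

definition trig_poly :: "int \<Rightarrow> complex" where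
  "trig_poly l = (\<Sum>k\<in>A. of_real (w k) * cis (- (of_int l * x k)))"

definition grid_size :: nat where
  "grid_size = 8 * L"

definition grid_index :: "nat \<Rightarrow> nat" where
  "grid_index m = nat \<lfloor>grid_size * frac (x m / (2 * pi))\<rfloor>"

definition grid_freq :: "nat \<Rightarrow> real" where
  "grid_freq j = 2 * pi * real j / real grid_size"

definition grid_coeff :: "nat \<Rightarrow> real" where
  "grid_coeff j = L2_set f {m\<in>I. grid_index m = j}"

definition resonator_poly :: "int \<Rightarrow> complex" where
  "resonator_poly l = (\<Sum>j<grid_size. of_real (grid_coeff j) * cis (of_int l * grid_freq j))"

lemma grid_size_pos: "grid_size > 0"
  using L_pos unfolding grid_size_def by simp

lemma grid_index_less: "grid_index m < grid_size"
proof -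
  have "grid_size * frac (x m / (2 * pi)) < grid_size"
    using grid_size_pos frac_lt_1[of "x m / (2 * pi)"] by simp
  moreover have "grid_size * frac (x m / (2 * pi)) \<ge> 0" by (simp add: frac_ge_0)
  ultimately show ?thesis unfolding grid_index_def by linarith
qed

lemma grid_freq_grid_index:
  obtains n :: int and \<delta> where "0 \<le> \<delta>" "\<delta> < 2 * pi / grid_size"
    "grid_freq (grid_index m) = x m - 2 * pi * n - \<delta>"
proof -
  define d where "d = grid_size * frac (x m / (2 * pi)) - grid_index m"
  have "grid_size * frac (x m / (2 * pi)) \<ge> 0" by (simp add: frac_ge_0)
  hence d: "0 \<le> d" "d < 1" unfolding d_def grid_index_def by linarith+
  have "real (grid_index m) = grid_size * (x m / (2 * pi) - \<lfloor>x m / (2 * pi)\<rfloor>) - d"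
    unfolding d_def frac_def by simp
  hence "grid_freq (grid_index m) = x m - 2 * pi * \<lfloor>x m / (2 * pi)\<rfloor> - 2 * pi * d / grid_size"
    unfolding grid_freq_def using grid_size_pos by (simp add: field_simps)
  moreover have "0 \<le> 2 * pi * d / grid_size" "2 * pi * d / grid_size < 2 * pi / grid_size"
    using d grid_size_pos by (auto simp: divide_strict_right_mono)
  ultimately show ?thesis using that by blast
qed

lemma grid_coeff_nonneg: "grid_coeff j \<ge> 0"
  unfolding grid_coeff_def by (rule L2_set_nonneg)

lemma sum_grid_coeff_squared: "(\<Sum>j<grid_size. (grid_coeff j)\<^sup>2) = (\<Sum>m\<in>I. (f m)\<^sup>2)"
proof -
  have "(grid_coeff j)\<^sup>2 = (\<Sum>m\<in>{m\<in>I. grid_index m = j}. (f m)\<^sup>2)" for j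
    unfolding grid_coeff_def L2_set_def by (simp add: sum_nonneg)
  moreover have "(\<Sum>j<grid_size. \<Sum>m\<in>{m\<in>I. grid_index m = j}. (f m)\<^sup>2) = (\<Sum>m\<in>I. (f m)\<^sup>2)"
    by (rule sum.group) (use finite_I grid_index_less in auto)
  ultimately show ?thesis by simp
qed

lemma sum_norm_resonator_poly_squared_le:
  "(\<Sum>a<L. (norm (resonator_poly (int a - int c)))\<^sup>2) \<le> grid_size * (\<Sum>m\<in>I. (f m)\<^sup>2)"
proof -
  let ?c = "\<lambda>j. of_real (grid_coeff j) * cis (- (real c * grid_freq j))"
  have shift: "resonator_poly (int a - int c) =
      (\<Sum>j<grid_size. ?c j * cis (real a * (2 * pi * real j / real grid_size)))" for a
    unfolding resonator_poly_def grid_freq_def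
    by (intro sum.cong refl) (simp add: mult.assoc cis_mult algebra_simps diff_divide_distrib)
  have "(\<Sum>a<L. (norm (resonator_poly (int a - int c)))\<^sup>2) \<le>
      (\<Sum>a<grid_size. (norm (resonator_poly (int a - int c)))\<^sup>2)"
    unfolding grid_size_def by (intro sum_mono2) auto
  also have "\<dots> \<le> grid_size * (\<Sum>j<grid_size. (norm (?c j))\<^sup>2)"
    unfolding shift by (rule sum_norm_grid_poly_squared_le)
  also have "(\<Sum>j<grid_size. (norm (?c j))\<^sup>2) = (\<Sum>m\<in>I. (f m)\<^sup>2)"
    unfolding sum_grid_coeff_squared[symmetric] by (intro sum.cong refl) (simp add: norm_mult)
  finally show ?thesis .
qed

lemma norm_resonator_poly_squared_le:
  "(norm (resonator_poly l))\<^sup>2 \<le> card I * (\<Sum>m\<in>I. (f m)\<^sup>2)"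
proof -
  have "norm (resonator_poly l) \<le> (\<Sum>j<grid_size. grid_coeff j)"
    unfolding resonator_poly_def by (rule sum_norm_le) (simp add: norm_mult grid_coeff_nonneg)
  also have "\<dots> = (\<Sum>j\<in>grid_index ` I. grid_coeff j)"
  proof (rule sum.mono_neutral_right)
    show "\<forall>j\<in>{..<grid_size} - grid_index ` I. grid_coeff j = 0"
    proof
      fix j assume "j \<in> {..<grid_size} - grid_index ` I"
      hence empty: "{m\<in>I. grid_index m = j} = {}" by auto
      show "grid_coeff j = 0" unfolding grid_coeff_def empty by simp
    qed
  qed (use grid_index_less in auto)
  finally have "(norm (resonator_poly l))\<^sup>2 \<le> (\<Sum>j\<in>grid_index ` I. grid_coeff j)\<^sup>2"
    by (intro power_mono) auto
  also have "\<dots> \<le> (\<Sum>j\<in>grid_index ` I. (grid_coeff j)\<^sup>2) * card (grid_index ` I)"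
    by (rule sum_squared_le_sum_of_squares)
  also have "\<dots> \<le> (\<Sum>m\<in>I. (f m)\<^sup>2) * card I"
    unfolding sum_grid_coeff_squared[symmetric] using finite_I grid_index_less
    by (intro mult_mono sum_mono2) (auto intro!: card_image_le sum_nonneg)
  finally show ?thesis by (simp add: mult.commute)
qed

lemma norm_trig_poly_abs: "norm (trig_poly \<bar>l\<bar>) = norm (trig_poly l)"
proof (cases "l \<ge> 0")
  case False
  have "trig_poly (-l) = cnj (trig_poly l)" unfolding trig_poly_def by (simp add: cis_cnj)
  thus ?thesis using False by simp
qed simp

lemma sum_norm_trig_poly_resonator_le:
  fixes M B :: real and h c :: nat
  assumes M: "M \<ge> 0" "\<And>l. h \<le> l \<Longrightarrow> l < L \<Longrightarrow> norm (trig_poly (int l)) \<le> M"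
    and B: "(\<Sum>l<h. norm (trig_poly (int l))) \<le> B" and c: "c < L"
  shows "(\<Sum>a<L. norm (trig_poly (int a - int c)) * (norm (resonator_poly (int a - int c)))\<^sup>2) \<le>
    (grid_size * M + 2 * B * card I) * (\<Sum>m\<in>I. (f m)\<^sup>2)"
proof -
  define D where "D = (\<Sum>m\<in>I. (f m)\<^sup>2)"
  have D0: "D \<ge> 0" unfolding D_def by (intro sum_nonneg) auto
  let ?g = "\<lambda>l. norm (trig_poly (int l))"
    and ?R = "\<lambda>a. (norm (resonator_poly (int a - int c)))\<^sup>2"
    and ?d = "\<lambda>a. nat \<bar>int a - int c\<bar>"
  have "(\<Sum>a<L. norm (trig_poly (int a - int c)) * ?R a) \<le>
      (\<Sum>a<L. M * ?R a + card I * D * (if ?d a < h then ?g (?d a) else 0))"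
  proof (rule sum_mono)
    fix a assume a: "a \<in> {..<L}"
    show "norm (trig_poly (int a - int c)) * ?R a \<le>
        M * ?R a + card I * D * (if ?d a < h then ?g (?d a) else 0)"
    proof (cases "?d a < h")
      case True
      have "?g (?d a) * ?R a \<le> ?g (?d a) * (card I * D)"
        unfolding D_def by (intro mult_left_mono norm_resonator_poly_squared_le) auto
      moreover have "M * ?R a \<ge> 0" using M by auto
      ultimately show ?thesis using True by (simp add: mult.commute norm_trig_poly_abs)
    next
      case False
      hence "?g (?d a) \<le> M" using a c by (intro M) auto
      thus ?thesis using False by (simp add: mult_right_mono norm_trig_poly_abs)
    qed
  qed
  also have "\<dots> = M * (\<Sum>a<L. ?R a) + card I * D * (\<Sum>a<L. if ?d a < h then ?g (?d a) else 0)"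
    by (simp only: sum.distrib sum_distrib_left)
  also have "\<dots> \<le> M * (grid_size * D) + card I * D * (2 * B)"
  proof (intro add_mono mult_left_mono)
    show "(\<Sum>a<L. ?R a) \<le> grid_size * D"
      unfolding D_def by (rule sum_norm_resonator_poly_squared_le)
    show "(\<Sum>a<L. if ?d a < h then ?g (?d a) else 0) \<le> 2 * B"
      using sum_abs_diff_le[of ?g c h L] B by simp
  qed (use M D0 in auto)
  finally show ?thesis unfolding D_def by (simp add: algebra_simps)
qed

lemma grid_coincidences_le:
  fixes M B :: real and h :: nat
  assumes M: "M \<ge> 0" "\<And>l. h \<le> l \<Longrightarrow> l < L \<Longrightarrow> norm (trig_poly (int l)) \<le> M"
    and B: "(\<Sum>l<h. norm (trig_poly (int l))) \<le> B"
  shows "(\<Sum>k\<in>A. \<Sum>i<grid_size. \<Sum>j<grid_size.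
      w k * grid_coeff i * grid_coeff j *
        (norm (dirichlet_kernel L (grid_freq i - grid_freq j - x k)))\<^sup>2)
    \<le> real L * ((grid_size * M + 2 * B * card I) * (\<Sum>m\<in>I. (f m)\<^sup>2))" (is "?T \<le> real L * ?bound")
proof -
  have "\<bar>?T\<bar> = norm (\<Sum>a<L. \<Sum>c<L. trig_poly (int a - int c) *
      of_real ((norm (resonator_poly (int a - int c)))\<^sup>2))"
    unfolding trig_poly_def resonator_poly_def fejer_mean_expansion by (simp only: norm_of_real)
  also have "\<dots> = norm (\<Sum>c<L. \<Sum>a<L. trig_poly (int a - int c) *
      of_real ((norm (resonator_poly (int a - int c)))\<^sup>2))"
    by (subst sum.swap) (rule refl)
  also have "\<dots> \<le> (\<Sum>c<L. \<Sum>a<L. norm (trig_poly (int a - int c)) *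
      (norm (resonator_poly (int a - int c)))\<^sup>2)"
    by (intro sum_norm_le) (simp add: norm_mult norm_power)
  also have "\<dots> \<le> (\<Sum>c<L. ?bound)"
    using M B by (intro sum_mono sum_norm_trig_poly_resonator_le[of M h]) auto
  finally show ?thesis by simp
qed

lemma norm_dirichlet_kernel_coincidence_ge:
  assumes "(k, m) \<in> E"
  shows "(real L / 2)\<^sup>2 \<le>
    (norm (dirichlet_kernel L (grid_freq (grid_index (k * m)) - grid_freq (grid_index m) - x k)))\<^sup>2"
proof (rule power_mono)
  let ?z = "grid_freq (grid_index (k * m)) - grid_freq (grid_index m) - x k"
  obtain n\<^sub>1 :: int and \<delta>\<^sub>1 where round_m: "0 \<le> \<delta>\<^sub>1" "\<delta>\<^sub>1 < 2 * pi / grid_size"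
      "grid_freq (grid_index m) = x m - 2 * pi * n\<^sub>1 - \<delta>\<^sub>1"
    using grid_freq_grid_index[of m] by blast
  obtain n\<^sub>2 :: int and \<delta>\<^sub>2 where round_km: "0 \<le> \<delta>\<^sub>2" "\<delta>\<^sub>2 < 2 * pi / grid_size"
      "grid_freq (grid_index (k * m)) = x (k * m) - 2 * pi * n\<^sub>2 - \<delta>\<^sub>2"
    using grid_freq_grid_index[of "k * m"] by blast
  have "?z + 2 * pi * of_int (n\<^sub>2 - n\<^sub>1) = \<delta>\<^sub>1 - \<delta>\<^sub>2"
    using round_m round_km E_mult[OF assms] by (simp add: algebra_simps)
  moreover have "\<bar>\<delta>\<^sub>1 - \<delta>\<^sub>2\<bar> \<le> 2 * pi / grid_size" using round_m round_km by (simp add: abs_le_iff)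
  ultimately have "\<bar>?z + 2 * pi * of_int (n\<^sub>2 - n\<^sub>1)\<bar> * real L \<le> 2 * pi / grid_size * real L"
    by (intro mult_right_mono) auto
  also have "\<dots> \<le> pi / 3" using L_pos unfolding grid_size_def by (simp add: field_simps)
  finally show "real L / 2 \<le> norm (dirichlet_kernel L ?z)" by (rule norm_dirichlet_kernel_ge_half)
qed simp

lemma L2_set_inj_le_grid_coeff:
  assumes inj: "inj_on g S" and g: "\<And>e. e \<in> S \<Longrightarrow> g e \<in> I \<and> grid_index (g e) = j"
  shows "L2_set (\<lambda>e. f (g e)) S \<le> grid_coeff j"
proof -
  have "(\<Sum>e\<in>S. (f (g e))\<^sup>2) = (\<Sum>m\<in>g ` S. (f m)\<^sup>2)"
    by (subst sum.reindex[OF inj]) simp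
  also have "\<dots> \<le> (\<Sum>m\<in>{m\<in>I. grid_index m = j}. (f m)\<^sup>2)"
    using g finite_I by (intro sum_mono2) auto
  finally show ?thesis unfolding grid_coeff_def L2_set_def by simp
qed

definition grid_triple :: "nat \<times> nat \<Rightarrow> nat \<times> nat \<times> nat" where
  "grid_triple = (\<lambda>(k, m). (k, grid_index (k * m), grid_index m))"

lemma sum_fibre_le_grid_coeff:
  "(\<Sum>(k', m)\<in>{e\<in>E. grid_triple e = (k, i, j)}. f m * f (k' * m)) \<le> grid_coeff i * grid_coeff j"
proof -
  define S where "S = {m. (k, m) \<in> E \<and> grid_index (k * m) = i \<and> grid_index m = j}"
  have S: "m \<in> I" "k * m \<in> I" "k > 0" "grid_index (k * m) = i" "grid_index m = j" if "m \<in> S" for m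
    using that E_subset E_mult unfolding S_def by auto
  have "{e\<in>E. grid_triple e = (k, i, j)} = Pair k ` S" unfolding S_def grid_triple_def by auto
  hence "(\<Sum>(k', m)\<in>{e\<in>E. grid_triple e = (k, i, j)}. f m * f (k' * m)) = (\<Sum>m\<in>S. f m * f (k * m))"
    by (simp add: sum.reindex inj_on_def)
  also have "\<dots> \<le> L2_set f S * L2_set (\<lambda>m. f (k * m)) S"
    using L2_set_mult_ineq[of f "\<lambda>m. f (k * m)" S] f_nonneg by simp
  also have "\<dots> \<le> grid_coeff j * grid_coeff i"
    using S by (intro mult_mono L2_set_inj_le_grid_coeff)
      (auto simp: inj_on_def grid_coeff_nonneg L2_set_nonneg)
  finally show ?thesis by (simp add: mult.commute)
qed

lemma sum_E_le_grid_coincidences: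
  "(real L / 2)\<^sup>2 * (\<Sum>(k, m)\<in>E. w k * (f m * f (k * m))) \<le>
    (\<Sum>k\<in>A. \<Sum>i<grid_size. \<Sum>j<grid_size.
      w k * grid_coeff i * grid_coeff j *
        (norm (dirichlet_kernel L (grid_freq i - grid_freq j - x k)))\<^sup>2)"
proof -
  let ?D = "\<lambda>k i j. (norm (dirichlet_kernel L (grid_freq i - grid_freq j - x k)))\<^sup>2"
  let ?term = "\<lambda>(k, i, j). w k * grid_coeff i * grid_coeff j * ?D k i j"
  have finite_E: "finite E" using E_subset finite_A finite_I by (meson finite_SigmaI finite_subset)
  have "(real L / 2)\<^sup>2 * (\<Sum>(k, m)\<in>E. w k * (f m * f (k * m))) =
      (\<Sum>t\<in>grid_triple ` E. (real L / 2)\<^sup>2 *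
        (\<Sum>(k, m)\<in>{e\<in>E. grid_triple e = t}. w k * (f m * f (k * m))))"
    by (subst sum.image_gen[OF finite_E, of _ grid_triple]) (simp only: sum_distrib_left)
  also have "\<dots> \<le> (\<Sum>t\<in>grid_triple ` E. ?term t)"
  proof (rule sum_mono)
    fix t assume "t \<in> grid_triple ` E"
    then obtain k m where km: "(k, m) \<in> E" "t = (k, grid_index (k * m), grid_index m)"
      unfolding grid_triple_def by auto
    let ?i = "grid_index (k * m)" and ?j = "grid_index m"
    have "(\<Sum>(k, m)\<in>{e\<in>E. grid_triple e = t}. w k * (f m * f (k * m))) =
        (\<Sum>(k', m)\<in>{e\<in>E. grid_triple e = t}. w k * (f m * f (k' * m)))"
      by (intro sum.cong refl) (auto simp: grid_triple_def km)
    also have "\<dots> = w k * (\<Sum>(k', m)\<in>{e\<in>E. grid_triple e = (k, ?i, ?j)}. f m * f (k' * m))"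
      unfolding km(2) by (simp only: sum_distrib_left case_prod_unfold)
    also have "\<dots> \<le> w k * (grid_coeff ?i * grid_coeff ?j)"
      by (intro mult_left_mono sum_fibre_le_grid_coeff w_nonneg)
    finally have "(real L / 2)\<^sup>2 * (\<Sum>(k, m)\<in>{e\<in>E. grid_triple e = t}. w k * (f m * f (k * m))) \<le>
        ?D k ?i ?j * (w k * (grid_coeff ?i * grid_coeff ?j))"
      using norm_dirichlet_kernel_coincidence_ge[OF km(1)] f_nonneg w_nonneg
      by (intro mult_mono) (auto intro!: sum_nonneg)
    thus "(real L / 2)\<^sup>2 * (\<Sum>(k, m)\<in>{e\<in>E. grid_triple e = t}. w k * (f m * f (k * m))) \<le> ?term t"
      unfolding km(2) by (simp add: mult_ac)
  qed
  also have "\<dots> \<le> (\<Sum>t\<in>A \<times> {..<grid_size} \<times> {..<grid_size}. ?term t)"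
    using E_subset finite_A grid_index_less w_nonneg grid_coeff_nonneg
    by (intro sum_mono2) (auto simp: grid_triple_def intro!: mult_nonneg_nonneg)
  finally show ?thesis by (simp add: sum.cartesian_product)
qed

theorem resonance_inequality:
  fixes M B :: real and h :: nat
  assumes M: "M \<ge> 0" "\<And>l. h \<le> l \<Longrightarrow> l < L \<Longrightarrow> norm (trig_poly (int l)) \<le> M"
    and B: "(\<Sum>l<h. norm (trig_poly (int l))) \<le> B"
  shows "real L * (\<Sum>(k, m)\<in>E. w k * (f m * f (k * m))) \<le>
      4 * (8 * L * M + 2 * B * card I) * (\<Sum>m\<in>I. (f m)\<^sup>2)"
proof -
  have "(real L / 2)\<^sup>2 * (\<Sum>(k, m)\<in>E. w k * (f m * f (k * m))) \<le>
      L * ((grid_size * M + 2 * B * card I) * (\<Sum>m\<in>I. (f m)\<^sup>2))"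
    using sum_E_le_grid_coincidences grid_coincidences_le[OF assms] by (rule order_trans)
  hence "real L * (real L * (\<Sum>(k, m)\<in>E. w k * (f m * f (k * m)))) \<le>
      real L * (4 * (8 * L * M + 2 * B * card I) * (\<Sum>m\<in>I. (f m)\<^sup>2))"
    unfolding grid_size_def by (simp add: power2_eq_square algebra_simps)
  thus ?thesis using L_pos by (subst (asm) mult_le_cancel_left_pos) auto
qed

end

section \<open>Mertens' first theorem\<close>

lemma card_multiples:
  fixes d n :: nat
  assumes d: "d > 0"
  shows "card {m\<in>{1..n}. d dvd m} = n div d"
proof -
  have "{m\<in>{1..n}. d dvd m} = (\<lambda>q. d * q) ` {1..n div d}"
  proof (intro equalityI subsetI)
    fix m assume "m \<in> {m\<in>{1..n}. d dvd m}"
    then obtain q where q: "m = d * q" "1 \<le> m" "m \<le> n" by auto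
    hence "1 \<le> q" "q \<le> n div d"
      using d by (auto simp: less_eq_div_iff_mult_less_eq mult.commute intro: Suc_leI)
    thus "m \<in> (\<lambda>q. d * q) ` {1..n div d}" using q(1) by auto
  qed (use d in \<open>auto simp: less_eq_div_iff_mult_less_eq mult.commute\<close>)
  thus ?thesis using d by (simp add: card_image inj_on_def)
qed

lemma ln_fact_mangoldt:
  "ln (fact n :: real) = (\<Sum>d=1..n. mangoldt d * real (n div d))"
proof -
  have "ln (fact n :: real) = (\<Sum>m=1..n. ln (real m))"
    by (induction n) (auto simp: ln_mult)
  also have "\<dots> = (\<Sum>m=1..n. \<Sum>d | d \<in> {1..n} \<and> d dvd m. mangoldt d)"
  proof (rule sum.cong[OF refl])
    fix m assume m: "m \<in> {1..n}"
    hence "{d. d dvd m} = {d. d \<in> {1..n} \<and> d dvd m}"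
      by (auto dest: dvd_imp_le intro: Nat.gr0I simp: Suc_le_eq)
    thus "ln (real m) = (\<Sum>d | d \<in> {1..n} \<and> d dvd m. mangoldt d)"
      using m mangoldt_sum[of m, where ?'a = real] by simp
  qed
  also have "\<dots> = (\<Sum>d=1..n. \<Sum>m | m \<in> {1..n} \<and> d dvd m. mangoldt d)"
    by (rule sum.swap_restrict) auto
  also have "\<dots> = (\<Sum>d=1..n. mangoldt d * real (n div d))"
    by (intro sum.cong refl) (simp add: card_multiples[simplified] mult.commute)
  finally show ?thesis .
qed

definition chebyshev_psi :: "nat \<Rightarrow> real" where
  "chebyshev_psi n = (\<Sum>d=1..n. mangoldt d)"

lemma ln_fact_double_le: "ln (fact (2 * n) :: real) - 2 * ln (fact n) \<le> 2 * n * ln 2"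
proof -
  have "real (2 * n choose n) = fact (2 * n) / (fact n * fact n)"
    using binomial_fact[of n "2 * n", where 'a = real] by simp
  hence "ln (fact (2 * n) :: real) - 2 * ln (fact n) = ln (real (2 * n choose n))"
    by (simp add: ln_mult ln_div)
  also have "\<dots> \<le> ln (2 ^ (2 * n))"
  proof (subst ln_le_cancel_iff)
    have "(2 * n choose n) \<le> (\<Sum>k\<le>2*n. 2 * n choose k)" by (rule member_le_sum) auto
    also have "\<dots> = 2 ^ (2 * n)" by (rule choose_row_sum)
    finally show "real (2 * n choose n) \<le> 2 ^ (2 * n)"
      by (metis of_nat_le_iff of_nat_numeral of_nat_power)
  qed auto
  finally show ?thesis by (simp add: ln_realpow)
qed

lemma chebyshev_psi_double: "chebyshev_psi (2 * n) \<le> chebyshev_psi n + 2 * n * ln 2"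
proof -
  have "chebyshev_psi (2 * n) - chebyshev_psi n = (\<Sum>d\<in>{1..2*n} - {1..n}. mangoldt d)"
    unfolding chebyshev_psi_def by (subst sum_diff) auto
  also have "\<dots> = (\<Sum>d=1..2*n. mangoldt d * (if n < d then 1 else 0))"
    by (intro sum.mono_neutral_cong_left) auto
  also have "\<dots> \<le> (\<Sum>d=1..2*n. mangoldt d * (real (2 * n div d) - 2 * real (n div d)))"
  proof (intro sum_mono mult_left_mono mangoldt_nonneg)
    fix d assume d: "d \<in> {1..2*n}"
    have "2 * (n div d) \<le> 2 * n div d"
      using d by (auto simp: less_eq_div_iff_mult_less_eq intro!: div_times_less_eq_dividend)
    moreover have "2 * n div d = 1" "n div d = 0" if "n < d"
      using that d by (auto simp: div_nat_eqI)
    ultimately show "(if n < d then 1 else 0) \<le> real (2 * n div d) - 2 * real (n div d)"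
      by (simp flip: of_nat_mult of_nat_le_iff)
  qed
  also have "\<dots> = ln (fact (2 * n)) - 2 * ln (fact n)"
  proof -
    have "ln (fact n :: real) = (\<Sum>d=1..2*n. mangoldt d * real (n div d))"
      unfolding ln_fact_mangoldt by (intro sum.mono_neutral_left) auto
    thus ?thesis
      unfolding ln_fact_mangoldt[of "2 * n"]
        by (simp add: sum_subtractf sum_distrib_left algebra_simps)
  qed
  also note ln_fact_double_le
  finally show ?thesis by simp
qed

lemma chebyshev_psi_le: "chebyshev_psi n \<le> 4 * n * ln 2"
proof (induction n rule: less_induct)
  case (less n)
  show ?case
  proof (cases "n \<le> 1")
    case True
    thus ?thesis by (cases n) (auto simp: chebyshev_psi_def)
  next
    case False
    define m where "m = n div 2"
    have m: "m < n" "m \<ge> 1" using False unfolding m_def by auto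
    have IH: "chebyshev_psi (2 * m) \<le> 6 * m * ln 2"
      using chebyshev_psi_double[of m] less.IH[OF m(1)] by simp
    show ?thesis
    proof (cases "even n")
      case True
      hence n: "n = 2 * m" unfolding m_def by simp
      show ?thesis using IH unfolding n by (rule order_trans) simp
    next
      case False
      hence n: "n = Suc (2 * m)" unfolding m_def by presburger
      have "chebyshev_psi n = chebyshev_psi (2 * m) + mangoldt (Suc (2 * m))"
        unfolding n chebyshev_psi_def by simp
      also have "mangoldt (Suc (2 * m)) \<le> ln (real (Suc (2 * m)))" by (rule mangoldt_le) simp
      also have "\<dots> \<le> ln (2 ^ (2 * m))"
      proof (subst ln_le_cancel_iff)
        have "Suc (2 * m) \<le> 2 ^ (2 * m)" using less_exp[of "2 * m"] by (rule Suc_leI)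
        thus "real (Suc (2 * m)) \<le> 2 ^ (2 * m)" by (metis of_nat_le_iff of_nat_numeral of_nat_power)
      qed auto
      also have "\<dots> = 2 * m * ln 2" by (simp add: ln_realpow)
      also note IH
      finally have "chebyshev_psi n \<le> 8 * m * ln 2" by simp
      thus ?thesis unfolding n by (rule order_trans) simp
    qed
  qed
qed

lemma ln_fact_ge: "n * ln n - n \<le> ln (fact n :: real)"
proof (cases "n = 0")
  case False
  have "real n ^ n /\<^sub>R fact n \<le> exp (real n)"
    using sum_le_suminf[OF summable_exp_generic[of "real n"], of "{n}"] by (simp add: exp_def)
  hence "ln (real n ^ n / fact n) \<le> ln (exp (real n))"
    using False by (subst ln_le_cancel_iff) (auto simp: field_simps)
  thus ?thesis using False by (simp add: ln_div ln_realpow)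
qed simp

lemma sum_mangoldt_over_le:
  assumes "n > 0"
  shows "(\<Sum>d=1..n. mangoldt d / d) \<le> ln n + 4 * ln 2"
proof -
  have div_ge: "real n / real d - 1 \<le> real (n div d)" for d
    using floor_divide_of_nat_eq[of n d, where ?'a = real] by linarith
  have "n * (\<Sum>d=1..n. mangoldt d / d) - chebyshev_psi n =
      (\<Sum>d=1..n. mangoldt d * (real n / real d - 1))"
    unfolding chebyshev_psi_def sum_distrib_left sum_subtractf[symmetric]
    by (intro sum.cong) (auto simp: algebra_simps)
  also have "\<dots> \<le> ln (fact n)"
    unfolding ln_fact_mangoldt by (intro sum_mono mult_left_mono div_ge mangoldt_nonneg)
  also have "\<dots> \<le> ln (real n ^ n)"
    using assms fact_le_power[of n, where ?'a = real] by (subst ln_le_cancel_iff) auto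
  finally have "n * (\<Sum>d=1..n. mangoldt d / d) \<le> n * (ln n + 4 * ln 2)"
    using chebyshev_psi_le[of n] assms by (simp add: ln_realpow algebra_simps)
  thus ?thesis using assms by (subst (asm) mult_le_cancel_left_pos) auto
qed

lemma sum_mangoldt_over_ge:
  assumes "n > 0"
  shows "(\<Sum>d=1..n. mangoldt d / d) \<ge> ln n - 1"
proof -
  have "n * ln n - n \<le> ln (fact n :: real)" by (rule ln_fact_ge)
  also have "\<dots> \<le> (\<Sum>d=1..n. mangoldt d * (real n / real d))"
    unfolding ln_fact_mangoldt
      by (intro sum_mono mult_left_mono of_nat_div_le_of_nat mangoldt_nonneg)
  also have "\<dots> = n * (\<Sum>d=1..n. mangoldt d / d)" by (simp add: sum_distrib_left mult.commute)
  finally have "n * (ln n - 1) \<le> n * (\<Sum>d=1..n. mangoldt d / d)" by (simp add: algebra_simps)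
  thus ?thesis using assms by (subst (asm) mult_le_cancel_left_pos) auto
qed

lemma sum_mangoldt_over_nonprime_le:
  "(\<Sum>d | d \<in> {1..n} \<and> \<not> prime d. mangoldt d / d) \<le>
      (\<Sum>p=2..n. ln (real p) * (\<Sum>k=2..n. (1 / real p) ^ k))"
proof -
  define S where "S = {d\<in>{1..n}. \<not> prime d \<and> primepow d}"
  define h where "h = (\<lambda>(p::nat, k::nat). p ^ k)"
  define T where "T = {(p, k). prime p \<and> p \<in> {2..n} \<and> k \<in> {2..n}}"
  have "T \<subseteq> {2..n} \<times> {2..n}" unfolding T_def by auto
  hence finT: "finite T" by (rule finite_subset) auto
  have "(\<Sum>d | d \<in> {1..n} \<and> \<not> prime d. mangoldt d / d) = (\<Sum>d\<in>S. mangoldt d / (real d))"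
    unfolding S_def by (intro sum.mono_neutral_right) (auto simp: mangoldt_def)
  also have "\<dots> \<le> (\<Sum>d\<in>h ` T. mangoldt d / real d)"
  proof (intro sum_mono2)
    show "S \<subseteq> h ` T"
    proof
      fix d assume d: "d \<in> S"
      then obtain p k where pk: "prime p" "k > 0" "d = p ^ k" unfolding S_def primepow_def by auto
      have "k \<noteq> 1" using pk d unfolding S_def by auto
      hence k: "k \<ge> 2" using pk by simp
      have "p ^ 1 \<le> p ^ k" using pk prime_gt_0_nat[of p] by (intro power_increasing) auto
      moreover have "k < p ^ k" using pk prime_gt_1_nat[of p] by (intro power_gt_expt) auto
      ultimately have "(p, k) \<in> T" using d pk k prime_ge_2_nat[of p] unfolding T_def S_def by auto
      thus "d \<in> h ` T" using pk unfolding h_def by force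
    qed
  qed (use finT in \<open>auto intro!: divide_nonneg_nonneg mangoldt_nonneg\<close>)
  also have "\<dots> \<le> (\<Sum>t\<in>T. mangoldt (h t) / real (h t))"
    using finT by (intro sum_image_le[of T _ h, unfolded o_def])
      (auto intro!: divide_nonneg_nonneg mangoldt_nonneg)
  also have "\<dots> = (\<Sum>t\<in>T. ln (real (fst t)) * (1 / real (fst t)) ^ snd t)"
    by (intro sum.cong refl) (auto simp: T_def h_def power_divide)
  also have "\<dots> \<le> (\<Sum>t\<in>{2..n} \<times> {2..n}. ln (real (fst t)) * (1 / real (fst t)) ^ snd t)"
    by (intro sum_mono2) (auto simp: T_def)
  finally show ?thesis by (simp add: sum.cartesian_product' sum_distrib_left)
qed

lemma sum_power_from_2_le:
  fixes q :: real
  assumes "0 \<le> q" "q \<le> 1/2"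
  shows "(\<Sum>k=2..n. q ^ k) \<le> 2 * q\<^sup>2"
proof -
  have "(q\<^sup>2 - q ^ Suc n) / (1 - q) \<le> q\<^sup>2 / (1/2)"
    using assms by (intro frac_le) auto
  thus ?thesis using assms by (auto simp: sum_gp)
qed

lemma ln_over_square_le:
  fixes p :: real
  assumes "p > 0"
  shows "ln p * (2 * (1 / p)\<^sup>2) \<le> 4 * p powr (-3/2)"
proof -
  have "ln p = 2 * ln (sqrt p)" using assms by (simp add: ln_sqrt)
  also have "\<dots> \<le> 2 * sqrt p" using assms ln_le_minus_one[of "sqrt p"] by simp
  finally have "ln p * (2 * (1 / p)\<^sup>2) \<le> 2 * sqrt p * (2 * (1 / p)\<^sup>2)" by (intro mult_right_mono) auto
  also have "\<dots> = 4 * (p powr (1/2) * p powr (-2))"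
    using assms by (simp add: powr_half_sqrt powr_minus_divide power_divide)
  also have "p powr (1/2) * p powr (-2) = p powr (-3/2)" by (simp flip: powr_add)
  finally show ?thesis .
qed

lemma sum_mangoldt_over_nonprime_bounded:
  "(\<Sum>d | d \<in> {1..n} \<and> \<not> prime d. mangoldt d / d) \<le> 4 * zeta_three_halves"
proof -
  note sum_mangoldt_over_nonprime_le
  also have "(\<Sum>p=2..n. ln (real p) * (\<Sum>k=2..n. (1 / real p) ^ k)) \<le>
      (\<Sum>p=2..n. 4 * real p powr (-3/2))"
  proof (rule sum_mono)
    fix p assume "p \<in> {2..n}"
    hence p: "real p \<ge> 2" by auto
    hence "ln (real p) * (\<Sum>k=2..n. (1 / real p) ^ k) \<le> ln (real p) * (2 * (1 / real p)\<^sup>2)"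
      by (intro mult_left_mono sum_power_from_2_le) (auto simp: field_simps)
    also have "\<dots> \<le> 4 * real p powr (-3/2)" using p by (intro ln_over_square_le) auto
    finally show "ln (real p) * (\<Sum>k=2..n. (1 / real p) ^ k) \<le> 4 * real p powr (-3/2)" .
  qed
  also have "\<dots> \<le> 4 * (\<Sum>p=1..n. real p powr (-3/2))"
    unfolding sum_distrib_left by (intro sum_mono2) auto
  also have "\<dots> \<le> 4 * zeta_three_halves" using sum_powr_three_halves_le[of n] by simp
  finally show ?thesis .
qed

definition mertens_sum :: "real \<Rightarrow> real" where
  "mertens_sum x = (\<Sum>p | prime p \<and> real p \<le> x. ln (real p) / real p)"

lemma finite_primes_le_real: "finite {p. prime p \<and> real p \<le> x}"
  by (rule finite_subset[of _ "{..nat \<lfloor>x\<rfloor>}"]) (auto simp: le_nat_floor)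

lemma mertens_sum_mangoldt:
  assumes "x \<ge> 1"
  shows "mertens_sum x = (\<Sum>d=1..nat \<lfloor>x\<rfloor>. mangoldt d / d)
      - (\<Sum>d | d \<in> {1..nat \<lfloor>x\<rfloor>} \<and> \<not> prime d. mangoldt d / d)"
proof -
  let ?n = "nat \<lfloor>x\<rfloor>"
  have "{p. prime p \<and> real p \<le> x} = {d\<in>{1..?n}. prime d}"
    using assms by (auto simp: le_nat_floor Suc_le_eq prime_gt_0_nat le_nat_iff le_floor_iff)
  hence "mertens_sum x = (\<Sum>d | d \<in> {1..?n} \<and> prime d. mangoldt d / d)"
    unfolding mertens_sum_def by (intro sum.cong) auto
  moreover have "(\<Sum>d=1..?n. mangoldt d / d) =
      (\<Sum>d | d \<in> {1..?n} \<and> prime d. mangoldt d / real d)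
        + (\<Sum>d | d \<in> {1..?n} \<and> \<not> prime d. mangoldt d / real d)"
    by (subst sum.union_disjoint[symmetric]) (auto intro!: sum.cong)
  ultimately show ?thesis by simp
qed

theorem mertens_first:
  assumes x: "x \<ge> 1"
  shows "\<bar>mertens_sum x - ln x\<bar> \<le> 4 * ln 2 + 1 + 4 * zeta_three_halves"
proof -
  define n where "n = nat \<lfloor>x\<rfloor>"
  have "n > 0" using x unfolding n_def by linarith
  hence n: "n > 0" "real n \<le> x" "x \<le> 2 * real n" using x unfolding n_def by linarith+
  have "ln (real n) \<le> ln x" using n by simp
  moreover have "ln x \<le> ln (2 * real n)" using n x by (subst ln_le_cancel_iff) auto
  hence "ln x \<le> ln 2 + ln (real n)" using n by (simp add: ln_mult)
  moreover have "(\<Sum>d | d \<in> {1..n} \<and> \<not> prime d. mangoldt d / real d) \<ge> 0"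
    by (intro sum_nonneg divide_nonneg_nonneg mangoldt_nonneg) auto
  moreover have "ln (2::real) \<ge> 0" by simp
  ultimately show ?thesis
    using mertens_sum_mangoldt[OF x] sum_mangoldt_over_le[OF n(1)] sum_mangoldt_over_ge[OF n(1)]
      sum_mangoldt_over_nonprime_bounded[of n] unfolding n_def[symmetric] by linarith
qed

definition mertens_error :: real where
  "mertens_error = 2 * (4 * ln 2 + 1 + 4 * zeta_three_halves)"

lemma mertens_error_ge_1: "mertens_error \<ge> 1"
  using zeta_three_halves_nonneg unfolding mertens_error_def by simp

corollary mertens_first_interval:
  assumes "1 \<le> x" "x \<le> y"
  shows "\<bar>(\<Sum>p | prime p \<and> x < real p \<and> real p \<le> y. ln (real p) / real p) - ln (y / x)\<bar> \<le>
      mertens_error"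
proof -
  have "mertens_sum y = (\<Sum>p | prime p \<and> x < real p \<and> real p \<le> y. ln (real p) / real p)
      + mertens_sum x"
    unfolding mertens_sum_def using assms
    by (subst sum.union_disjoint[symmetric])
      (auto intro!: sum.cong finite_subset[OF _ finite_primes_le_real[of y]] finite_primes_le_real)
  thus ?thesis using mertens_first[of x] mertens_first[of y] assms
    unfolding mertens_error_def by (simp add: ln_div abs_le_iff)
qed

section \<open>Subsets with few elements in each block\<close>

definition small_subsets :: "'a set \<Rightarrow> nat \<Rightarrow> 'a set set" where
  "small_subsets Q s = {S. S \<subseteq> Q \<and> card S \<le> s}"

lemma finite_small_subsets: "finite Q \<Longrightarrow> finite (small_subsets Q s)"
  by (rule finite_subset[of _ "Pow Q"]) (auto simp: small_subsets_def)

lemma sum_Pow_prod: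
  fixes u :: "'a \<Rightarrow> 'b :: comm_semiring_1"
  shows "finite Q \<Longrightarrow> (\<Sum>S\<in>Pow Q. \<Prod>p\<in>S. u p) = (\<Prod>p\<in>Q. 1 + u p)"
  using prod_add[of Q u "\<lambda>_. 1"] by (simp add: add.commute)

text \<open>Rankin's method: a subset is charged by a factor \<open>a\<close>, or \<open>1 / y\<close>, for each of its elements.\<close>

lemma sum_small_subsets_ge:
  fixes u :: "'a \<Rightarrow> real"
  assumes fin: "finite Q" and u: "\<And>p. p \<in> Q \<Longrightarrow> u p \<ge> 0" and a: "a \<ge> 1"
  shows "(\<Sum>S\<in>small_subsets Q s. \<Prod>p\<in>S. u p) \<ge> (\<Prod>p\<in>Q. 1 + u p) - (\<Prod>p\<in>Q. 1 + a * u p) / a ^ s"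
proof -
  have nonneg: "(\<Prod>p\<in>S. u p) \<ge> 0" if "S \<subseteq> Q" for S using that u by (intro prod_nonneg) auto
  have "(\<Prod>p\<in>Q. 1 + u p) = (\<Sum>S\<in>Pow Q. \<Prod>p\<in>S. u p)" by (rule sum_Pow_prod[OF fin, symmetric])
  also have "\<dots> = (\<Sum>S\<in>small_subsets Q s. \<Prod>p\<in>S. u p) + (\<Sum>S\<in>Pow Q - small_subsets Q s. \<Prod>p\<in>S. u p)"
    using fin by (subst sum.subset_diff[of "small_subsets Q s"]) (auto simp: small_subsets_def)
  also have "(\<Sum>S\<in>Pow Q - small_subsets Q s. \<Prod>p\<in>S. u p) \<le>
      (\<Sum>S\<in>Pow Q - small_subsets Q s. (\<Prod>p\<in>S. a * u p) / a ^ s)"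
  proof (rule sum_mono)
    fix S assume "S \<in> Pow Q - small_subsets Q s"
    hence S: "S \<subseteq> Q" "s \<le> card S" by (auto simp: small_subsets_def)
    have "(\<Prod>p\<in>S. u p) * a ^ s \<le> (\<Prod>p\<in>S. u p) * a ^ card S"
      using S a by (intro mult_left_mono power_increasing nonneg) auto
    also have "\<dots> = (\<Prod>p\<in>S. a * u p)" by (simp add: prod.distrib mult.commute)
    finally show "(\<Prod>p\<in>S. u p) \<le> (\<Prod>p\<in>S. a * u p) / a ^ s" using a by (simp add: field_simps)
  qed
  also have "\<dots> \<le> (\<Sum>S\<in>Pow Q. (\<Prod>p\<in>S. a * u p) / a ^ s)"
    using fin u a by (intro sum_mono2) (auto intro!: divide_nonneg_nonneg prod_nonneg)
  also have "\<dots> = (\<Prod>p\<in>Q. 1 + a * u p) / a ^ s"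
    unfolding sum_divide_distrib[symmetric] by (simp add: sum_Pow_prod[OF fin])
  finally show ?thesis by simp
qed

lemma card_small_subsets_le:
  fixes y :: real
  assumes fin: "finite Q" and y: "0 < y" "y \<le> 1"
  shows "card (small_subsets Q s) \<le> (1 + y) ^ card Q / y ^ s"
proof -
  have "real (card (small_subsets Q s)) = (\<Sum>S\<in>small_subsets Q s. 1)" by simp
  also have "\<dots> \<le> (\<Sum>S\<in>small_subsets Q s. (\<Prod>p\<in>S. y) / y ^ s)"
    using y by (intro sum_mono) (auto simp: small_subsets_def intro: power_decreasing)
  also have "\<dots> \<le> (\<Sum>S\<in>Pow Q. (\<Prod>p\<in>S. y) / y ^ s)"
    using fin y by (intro sum_mono2) (auto simp: small_subsets_def)
  also have "\<dots> = (1 + y) ^ card Q / y ^ s"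
    unfolding sum_divide_distrib[symmetric] sum_Pow_prod[OF fin] by simp
  finally show ?thesis .
qed

lemma prod_one_plus_mult_le:
  fixes u :: "'a \<Rightarrow> real"
  assumes u: "\<And>p. p \<in> Q \<Longrightarrow> u p \<ge> 0" and a: "a \<ge> 1"
  shows "(\<Prod>p\<in>Q. 1 + a * u p) \<le> (\<Prod>p\<in>Q. 1 + u p) * exp ((a - 1) * (\<Sum>p\<in>Q. u p))"
proof -
  have "(\<Prod>p\<in>Q. 1 + a * u p) \<le> (\<Prod>p\<in>Q. (1 + u p) * (1 + (a - 1) * u p))"
  proof (intro prod_mono conjI)
    fix p assume "p \<in> Q"
    hence "u p \<ge> 0" by (rule u)
    thus "0 \<le> 1 + a * u p" using a by (intro add_nonneg_nonneg mult_nonneg_nonneg) auto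
    have "(a - 1) * (u p * u p) \<ge> 0" using a by simp
    thus "1 + a * u p \<le> (1 + u p) * (1 + (a - 1) * u p)" by (simp add: algebra_simps)
  qed
  also have "\<dots> = (\<Prod>p\<in>Q. 1 + u p) * (\<Prod>p\<in>Q. 1 + (a - 1) * u p)" by (rule prod.distrib)
  also have "\<dots> \<le> (\<Prod>p\<in>Q. 1 + u p) * exp (\<Sum>p\<in>Q. (a - 1) * u p)"
    using u a by (intro mult_left_mono prod_le_exp_sum prod_nonneg) (auto intro: add_nonneg_nonneg)
  finally show ?thesis by (simp add: sum_distrib_left)
qed

lemma sum_small_subsets_ge_half:
  fixes u :: "'a \<Rightarrow> real"
  assumes fin: "finite Q" and u: "\<And>p. p \<in> Q \<Longrightarrow> u p \<ge> 0" and a: "a > 1"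
    and U: "(\<Sum>p\<in>Q. u p) \<le> U" and s: "a * U \<le> real s" and entropy: "(a * ln a - a + 1) * U \<ge> 1"
  shows "(\<Sum>S\<in>small_subsets Q s. \<Prod>p\<in>S. u p) \<ge> (\<Prod>p\<in>Q. 1 + u p) / 2"
proof -
  let ?Z = "\<Prod>p\<in>Q. 1 + u p"
  have Z: "?Z \<ge> 0" using u by (intro prod_nonneg) (auto intro: add_nonneg_nonneg)
  have "exp ((a - 1) * (\<Sum>p\<in>Q. u p)) * 2 \<le> exp ((a - 1) * U) * exp 1"
    using exp_ge_add_one_self[of 1] U a by (intro mult_mono) auto
  also have "\<dots> \<le> exp ((a - 1) * U) * exp ((a * ln a - a + 1) * U)"
    using entropy by (intro mult_left_mono) auto
  also have "\<dots> = exp (ln a * (a * U))" by (simp add: exp_add[symmetric] algebra_simps)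
  also have "\<dots> \<le> exp (ln a * real s)" using a s
    by (intro exp_le_cancel_iff[THEN iffD2] mult_left_mono) auto
  also have "\<dots> = a ^ s" using a by (simp add: exp_of_nat2_mult)
  finally have tilt: "exp ((a - 1) * (\<Sum>p\<in>Q. u p)) \<le> a ^ s / 2" by simp
  have "(\<Prod>p\<in>Q. 1 + a * u p) \<le> ?Z * exp ((a - 1) * (\<Sum>p\<in>Q. u p))"
    using u a by (intro prod_one_plus_mult_le) auto
  also have "\<dots> \<le> ?Z * (a ^ s / 2)" using tilt Z by (intro mult_left_mono)
  finally have "(\<Prod>p\<in>Q. 1 + a * u p) / a ^ s \<le> ?Z / 2" using a by (simp add: field_simps)
  thus ?thesis using sum_small_subsets_ge[where u = u and Q = Q and a = a and s = s] fin u a by auto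
qed

lemma exp_le_prod_one_plus:
  fixes v :: "'a \<Rightarrow> real"
  assumes fin: "finite Q" and v: "\<And>p. p \<in> Q \<Longrightarrow> 0 \<le> v p \<and> v p \<le> \<delta>" and \<delta>: "\<delta> \<le> 1"
  shows "exp ((1 - \<delta>) * (\<Sum>p\<in>Q. v p)) \<le> (\<Prod>p\<in>Q. 1 + v p)"
proof -
  have "exp ((1 - \<delta>) * (\<Sum>p\<in>Q. v p)) = (\<Prod>p\<in>Q. exp ((1 - \<delta>) * v p))"
    using fin by (simp add: sum_distrib_left exp_sum)
  also have "\<dots> \<le> (\<Prod>p\<in>Q. 1 + v p)"
  proof (intro prod_mono conjI)
    fix p assume "p \<in> Q"
    hence p: "0 \<le> v p" "v p \<le> \<delta>" using v by auto
    have "(1 - \<delta>) * v p \<le> v p - (v p)\<^sup>2"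
      using p mult_right_mono[OF p(2,1)] by (simp add: power2_eq_square algebra_simps)
    also have "\<dots> \<le> ln (1 + v p)" using p \<delta> by (intro ln_one_plus_pos_lower_bound) auto
    finally have "exp ((1 - \<delta>) * v p) \<le> exp (ln (1 + v p))" by simp
    thus "exp ((1 - \<delta>) * v p) \<le> 1 + v p" using p by simp
  qed auto
  finally show ?thesis .
qed

lemma two_mult_exp_minus_1_le: "2 * exp (- 1 :: real) \<le> 1"
  using exp_ge_add_one_self[of "1::real"] by (simp add: exp_minus field_simps)

lemma sum_small_subsets_ge_exp:
  fixes v :: "'a \<Rightarrow> real"
  assumes fin: "finite Q" and v: "\<And>p. p \<in> Q \<Longrightarrow> 0 \<le> v p \<and> v p \<le> \<delta>" and \<delta>: "0 < \<delta>" "\<delta> \<le> 1/4"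
    and ge_1: "(\<Sum>p\<in>Q. v p) \<ge> 1" and t: "4 * (\<Sum>p\<in>Q. v p) \<le> real t"
  shows "(\<Sum>T\<in>small_subsets Q t. \<Prod>p\<in>T. v p) \<ge> exp ((1 - \<delta>) * (\<Sum>p\<in>Q. v p)) / 2"
proof -
  define X where "X = (\<Sum>p\<in>Q. v p)"
  have "exp 1 * X - t \<le> (1 - \<delta>) * X - 1"
  proof -
    have "exp 1 * X \<le> 3 * X" using exp_le ge_1 unfolding X_def by (intro mult_right_mono) auto
    moreover have "\<delta> * X \<le> 1/4 * X" using \<delta> ge_1 unfolding X_def by (intro mult_right_mono) auto
    ultimately show ?thesis using t ge_1 unfolding X_def[symmetric] left_diff_distrib by linarith
  qed
  hence "exp (exp 1 * X - t) \<le> exp ((1 - \<delta>) * X) * exp (- 1)" by (simp flip: exp_add)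
  also have "\<dots> \<le> exp ((1 - \<delta>) * X) * (1 / 2)"
    using two_mult_exp_minus_1_le by (intro mult_left_mono) auto
  finally have "exp (exp 1 * X) / exp 1 ^ t \<le> exp ((1 - \<delta>) * X) / 2"
    by (simp add: exp_diff exp_of_nat_mult[symmetric])
  moreover have "(\<Prod>p\<in>Q. 1 + exp 1 * v p) / exp 1 ^ t \<le> exp (exp 1 * X) / exp 1 ^ t"
    using v prod_le_exp_sum[of Q "\<lambda>p. exp 1 * v p"] unfolding X_def sum_distrib_left
    by (intro divide_right_mono) auto
  moreover have "exp ((1 - \<delta>) * X) \<le> (\<Prod>p\<in>Q. 1 + v p)"
    unfolding X_def using v \<delta> by (intro exp_le_prod_one_plus fin) auto
  moreover have "(\<Sum>T\<in>small_subsets Q t. \<Prod>p\<in>T. v p) \<ge>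
      (\<Prod>p\<in>Q. 1 + v p) - (\<Prod>p\<in>Q. 1 + exp 1 * v p) / exp 1 ^ t"
    using v by (intro sum_small_subsets_ge fin) auto
  ultimately show ?thesis unfolding X_def by linarith
qed

lemma prod_one_plus_diff_ge:
  fixes u :: "'a \<Rightarrow> real"
  assumes fin: "finite Q" and T: "T \<subseteq> Q" and u: "\<And>p. p \<in> Q \<Longrightarrow> 0 \<le> u p \<and> u p \<le> \<delta>"
  shows "(\<Prod>p\<in>Q - T. 1 + u p) \<ge> exp (- \<delta> * card T) * (\<Prod>p\<in>Q. 1 + u p)"
proof -
  have "(\<Prod>p\<in>T. 1 + u p) \<le> (\<Prod>p\<in>T. exp \<delta>)"
  proof (intro prod_mono conjI)
    fix p assume "p \<in> T"
    hence "0 \<le> u p" "u p \<le> \<delta>" using T u by auto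
    thus "0 \<le> 1 + u p" "1 + u p \<le> exp \<delta>" using exp_ge_add_one_self[of \<delta>] by linarith+
  qed
  also have "\<dots> = exp (\<delta> * card T)" by (simp add: exp_of_nat2_mult)
  finally have "(\<Prod>p\<in>Q - T. 1 + u p) * (\<Prod>p\<in>T. 1 + u p) \<le> (\<Prod>p\<in>Q - T. 1 + u p) * exp (\<delta> * card T)"
    using u by (intro mult_left_mono prod_nonneg) (auto intro: add_nonneg_nonneg)
  hence "(\<Prod>p\<in>Q. 1 + u p) \<le> (\<Prod>p\<in>Q - T. 1 + u p) * exp (\<delta> * card T)"
    by (simp add: prod.subset_diff[OF T fin])
  thus ?thesis by (simp add: exp_minus field_simps)
qed

definition block_pairs :: "'a set \<Rightarrow> nat \<Rightarrow> nat \<Rightarrow> ('a set \<times> 'a set) set" where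
  "block_pairs Q t s = (SIGMA T:small_subsets Q t. small_subsets (Q - T) s)"

definition pair_weight :: "('a \<Rightarrow> real) \<Rightarrow> ('a \<Rightarrow> real) \<Rightarrow> 'a set \<times> 'a set \<Rightarrow> real" where
  "pair_weight v u = (\<lambda>(T, S). (\<Prod>p\<in>T. v p) * (\<Prod>p\<in>S. u p))"

lemma finite_block_pairs: "finite Q \<Longrightarrow> finite (block_pairs Q t s)"
  unfolding block_pairs_def by (intro finite_SigmaI finite_small_subsets finite_Diff)

lemma block_sum_ge:
  fixes u v :: "'a \<Rightarrow> real"
  assumes fin: "finite Q" and u: "\<And>p. p \<in> Q \<Longrightarrow> 0 \<le> u p \<and> u p \<le> \<delta>"
    and v: "\<And>p. p \<in> Q \<Longrightarrow> 0 \<le> v p \<and> v p \<le> \<delta>" and \<delta>: "0 < \<delta>" "\<delta> \<le> 1/4"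
    and U: "(\<Sum>p\<in>Q. u p) \<le> U" "(1 + \<delta>) * U \<le> real s" "((1 + \<delta>) * ln (1 + \<delta>) - (1 + \<delta>) + 1) * U \<ge> 1"
    and V: "(\<Sum>p\<in>Q. v p) \<ge> 1" "4 * (\<Sum>p\<in>Q. v p) \<le> real t"
  shows "(\<Sum>z\<in>block_pairs Q t s. pair_weight v u z) \<ge>
    exp ((1 - \<delta>) * (\<Sum>p\<in>Q. v p) - \<delta> * t - 2) * (\<Prod>p\<in>Q. 1 + u p)"
proof -
  define X where "X = (\<Sum>p\<in>Q. v p)"
  define Z where "Z = (\<Prod>p\<in>Q. 1 + u p)"
  have Z: "Z \<ge> 0" unfolding Z_def using u by (intro prod_nonneg) (auto intro: add_nonneg_nonneg)
  have disjoint: "(\<Sum>S\<in>small_subsets (Q - T) s. \<Prod>p\<in>S. u p) \<ge> exp (- \<delta> * t) * Z / 2"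
    if T: "T \<in> small_subsets Q t" for T
  proof -
    have "exp (- \<delta> * t) * Z \<le> exp (- \<delta> * card T) * Z"
      using T \<delta> Z by (intro mult_right_mono) (auto simp: small_subsets_def)
    also have "\<dots> \<le> (\<Prod>p\<in>Q - T. 1 + u p)"
      unfolding Z_def using T u by (intro prod_one_plus_diff_ge fin) (auto simp: small_subsets_def)
    moreover have "(\<Sum>p\<in>Q - T. u p) \<le> (\<Sum>p\<in>Q. u p)" using fin u by (intro sum_mono2) auto
    hence "(\<Sum>S\<in>small_subsets (Q - T) s. \<Prod>p\<in>S. u p) \<ge> (\<Prod>p\<in>Q - T. 1 + u p) / 2"
      using fin u \<delta> U by (intro sum_small_subsets_ge_half[where a = "1 + \<delta>" and U = U]) auto
    ultimately show ?thesis by linarith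
  qed
  have "exp (- 2 :: real) = exp (- 1) * exp (- 1)" by (simp flip: exp_add)
  also have "\<dots> \<le> 1 / 2 * (1 / 2)" using two_mult_exp_minus_1_le by (intro mult_mono) auto
  finally have "exp ((1 - \<delta>) * X) * exp (- \<delta> * t) * Z * exp (- 2) \<le>
      exp ((1 - \<delta>) * X) * exp (- \<delta> * t) * Z * (1 / 4)"
    using Z by (intro mult_left_mono) auto
  moreover have "exp ((1 - \<delta>) * X - \<delta> * t - 2) = exp ((1 - \<delta>) * X) * exp (- \<delta> * t) * exp (- 2)"
    by (simp flip: exp_add)
  ultimately have "exp ((1 - \<delta>) * X - \<delta> * t - 2) * Z \<le>
      exp ((1 - \<delta>) * X) / 2 * (exp (- \<delta> * t) * Z / 2)"
    by (simp add: mult_ac)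
  also have "\<dots> \<le> (\<Sum>T\<in>small_subsets Q t. \<Prod>p\<in>T. v p) * (exp (- \<delta> * t) * Z / 2)"
    unfolding X_def using Z V by (intro mult_right_mono sum_small_subsets_ge_exp fin v \<delta>) auto
  also have "\<dots> \<le> (\<Sum>T\<in>small_subsets Q t. (\<Prod>p\<in>T. v p) * (\<Sum>S\<in>small_subsets (Q - T) s. \<Prod>p\<in>S. u p))"
    unfolding sum_distrib_right using v
    by (intro sum_mono mult_left_mono disjoint prod_nonneg) (auto simp: small_subsets_def)
  also have "\<dots> = (\<Sum>z\<in>block_pairs Q t s. pair_weight v u z)"
    unfolding block_pairs_def pair_weight_def sum_distrib_left
    by (rule sum.Sigma) (auto intro!: finite_small_subsets fin)
  finally show ?thesis unfolding X_def Z_def .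
qed

locale disjoint_blocks =
  fixes Q :: "'i \<Rightarrow> 'a set" and J :: "'i set"
  assumes finite_J: "finite J" and finite_block: "k \<in> J \<Longrightarrow> finite (Q k)"
    and disjoint_blocks: "disjoint_family_on Q J"
begin

definition union_blocks :: "'a set" where
  "union_blocks = (\<Union>k\<in>J. Q k)"

definition capped :: "('i \<Rightarrow> nat) \<Rightarrow> 'a set set" where
  "capped n = {S. S \<subseteq> union_blocks \<and> (\<forall>k\<in>J. card (S \<inter> Q k) \<le> n k)}"

definition capped_pairs :: "('i \<Rightarrow> nat) \<Rightarrow> ('i \<Rightarrow> nat) \<Rightarrow> ('a set \<times> 'a set) set" where
  "capped_pairs t s = {(T, S). T \<in> capped t \<and> S \<in> capped s \<and> T \<inter> S = {}}"

lemma finite_union_blocks: "finite union_blocks"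
  unfolding union_blocks_def using finite_J finite_block by blast

lemma capped_subset_Pow: "capped n \<subseteq> Pow union_blocks"
  unfolding capped_def by blast

lemma finite_capped: "finite (capped n)"
  using finite_subset[OF capped_subset_Pow] finite_union_blocks by simp

lemma Un_capped_pairs:
  assumes "(T, S) \<in> capped_pairs t s"
  shows "T \<union> S \<in> capped (\<lambda>k. t k + s k)"
proof -
  have "card ((T \<union> S) \<inter> Q k) \<le> t k + s k" if "k \<in> J" for k
  proof -
    have "card ((T \<union> S) \<inter> Q k) \<le> card (T \<inter> Q k) + card (S \<inter> Q k)"
      by (metis Int_Un_distrib2 card_Un_le)
    also have "\<dots> \<le> t k + s k"
      using assms that unfolding capped_pairs_def capped_def by (intro add_mono) auto
    finally show ?thesis .
  qed
  thus ?thesis using assms unfolding capped_pairs_def capped_def by auto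
qed

lemma capped_mono: "(\<And>k. m k \<le> n k) \<Longrightarrow> capped m \<subseteq> capped n"
  unfolding capped_def by (auto intro: order_trans)

lemma UN_Int_block:
  assumes "k \<in> J" "\<And>j. j \<in> J \<Longrightarrow> g j \<subseteq> Q j"
  shows "(\<Union>j\<in>J. g j) \<inter> Q k = g k"
proof -
  have "g j \<inter> Q k = {}" if "j \<in> J" "j \<noteq> k" for j
    using disjoint_family_onD[OF disjoint_blocks that(1) assms(1) that(2)] assms(2)[OF that(1)]
      by auto
  thus ?thesis using assms by auto
qed

lemma UN_Int_blocks: "S \<subseteq> union_blocks \<Longrightarrow> (\<Union>k\<in>J. S \<inter> Q k) = S"
  unfolding union_blocks_def by blast

lemma prod_blocks:
  assumes "S \<subseteq> union_blocks"
  shows "(\<Prod>p\<in>S. h p) = (\<Prod>k\<in>J. \<Prod>p\<in>S \<inter> Q k. h p)"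
proof -
  have "(\<Prod>p\<in>S. h p) = (\<Prod>p\<in>(\<Union>k\<in>J. S \<inter> Q k). h p)" using UN_Int_blocks[OF assms] by simp
  also have "\<dots> = (\<Prod>k\<in>J. \<Prod>p\<in>S \<inter> Q k. h p)"
  proof (rule prod.UNION_disjoint)
    show "\<forall>j\<in>J. \<forall>k\<in>J. j \<noteq> k \<longrightarrow> (S \<inter> Q j) \<inter> (S \<inter> Q k) = {}"
      using disjoint_family_onD[OF disjoint_blocks] by blast
  qed (use finite_J finite_block in auto)
  finally show ?thesis .
qed

lemma prod_union_blocks: "(\<Prod>p\<in>union_blocks. h p) = (\<Prod>k\<in>J. \<Prod>p\<in>Q k. h p)"
proof -
  have "union_blocks \<inter> Q k = Q k" if "k \<in> J" for k using that unfolding union_blocks_def by auto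
  thus ?thesis using prod_blocks[of union_blocks h] by simp
qed

lemma capped_pairs_iff_block_pairs:
  "(T, S) \<in> capped_pairs t s \<longleftrightarrow>
    T \<subseteq> union_blocks \<and> S \<subseteq> union_blocks \<and>
      (\<forall>k\<in>J. (T \<inter> Q k, S \<inter> Q k) \<in> block_pairs (Q k) (t k) (s k))"
proof -
  have block: "(T \<inter> Q k, S \<inter> Q k) \<in> block_pairs (Q k) (t k) (s k) \<longleftrightarrow>
      card (T \<inter> Q k) \<le> t k \<and> card (S \<inter> Q k) \<le> s k \<and> T \<inter> S \<inter> Q k = {}" for k
    unfolding block_pairs_def small_subsets_def by auto
  have "T \<inter> S = {} \<longleftrightarrow> (\<forall>k\<in>J. T \<inter> S \<inter> Q k = {})" if "T \<subseteq> union_blocks"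
    using that unfolding union_blocks_def by blast
  thus ?thesis unfolding capped_pairs_def capped_def by (simp add: block) blast
qed

lemma sum_capped_pairs:
  "(\<Sum>z\<in>capped_pairs t s. pair_weight v u z) =
      (\<Prod>k\<in>J. \<Sum>z\<in>block_pairs (Q k) (t k) (s k). pair_weight v u z)"
proof -
  let ?PiE = "PiE J (\<lambda>k. block_pairs (Q k) (t k) (s k))"
  let ?restr = "\<lambda>z. \<lambda>k\<in>J. (fst z \<inter> Q k, snd z \<inter> Q k)"
  let ?glue = "\<lambda>g. (\<Union>k\<in>J. fst (g k), \<Union>k\<in>J. snd (g k))"
  have glue: "fst (?glue g) \<inter> Q k = fst (g k)" "snd (?glue g) \<inter> Q k = snd (g k)"
    if "g \<in> ?PiE" "k \<in> J" for g k
  proof -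
    have "fst (g j) \<subseteq> Q j \<and> snd (g j) \<subseteq> Q j" if "j \<in> J" for j
      using PiE_mem[OF \<open>g \<in> ?PiE\<close> that] unfolding block_pairs_def small_subsets_def by auto
    thus "fst (?glue g) \<inter> Q k = fst (g k)" "snd (?glue g) \<inter> Q k = snd (g k)"
      using UN_Int_block[of k "\<lambda>j. fst (g j)"] UN_Int_block[of k "\<lambda>j. snd (g j)"] that(2) by auto
  qed
  have "(\<Sum>z\<in>capped_pairs t s. pair_weight v u z) = (\<Sum>g\<in>?PiE. \<Prod>k\<in>J. pair_weight v u (g k))"
  proof (rule sum.reindex_bij_witness[of _ ?glue ?restr])
    fix z assume z: "z \<in> capped_pairs t s"
    hence sub: "fst z \<subseteq> union_blocks" "snd z \<subseteq> union_blocks"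
      and mem: "\<And>k. k \<in> J \<Longrightarrow> (fst z \<inter> Q k, snd z \<inter> Q k) \<in> block_pairs (Q k) (t k) (s k)"
      using capped_pairs_iff_block_pairs[of "fst z" "snd z"] by auto
    show "?glue (?restr z) = z" using UN_Int_blocks[OF sub(1)] UN_Int_blocks[OF sub(2)]
      by (simp add: prod_eq_iff)
    show "?restr z \<in> ?PiE" using mem by auto
    show "(\<Prod>k\<in>J. pair_weight v u (?restr z k)) = pair_weight v u z"
      using prod_blocks[OF sub(1), of v] prod_blocks[OF sub(2), of u]
      by (simp add: pair_weight_def case_prod_unfold prod.distrib)
  next
    fix g assume g: "g \<in> ?PiE"
    show "?restr (?glue g) = g"
      using glue[OF g] PiE_arb[OF g] by (auto simp: fun_eq_iff prod_eq_iff restrict_def)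
    have "fst (?glue g) \<subseteq> union_blocks" "snd (?glue g) \<subseteq> union_blocks"
      using PiE_mem[OF g] unfolding union_blocks_def block_pairs_def small_subsets_def by fastforce+
    thus "?glue g \<in> capped_pairs t s"
      using glue[OF g] PiE_mem[OF g] by (subst capped_pairs_iff_block_pairs) auto
  qed
  thus ?thesis using finite_J finite_block by (simp add: prod_sum_PiE finite_block_pairs)
qed

lemma card_capped_le:
  fixes y :: "'i \<Rightarrow> real"
  assumes y: "\<And>k. k \<in> J \<Longrightarrow> 0 < y k \<and> y k \<le> 1"
  shows "card (capped n) \<le> (\<Prod>k\<in>J. (1 + y k) ^ card (Q k) / y k ^ n k)"
proof -
  let ?PiE = "PiE J (\<lambda>k. small_subsets (Q k) (n k))"
  have "card (capped n) \<le> card ?PiE"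
  proof (rule card_inj_on_le[where f = "\<lambda>S. \<lambda>k\<in>J. S \<inter> Q k"])
    show "inj_on (\<lambda>S. \<lambda>k\<in>J. S \<inter> Q k) (capped n)"
    proof (rule inj_onI)
      fix S S' assume S: "S \<in> capped n" "S' \<in> capped n" and eq: "(\<lambda>k\<in>J. S \<inter> Q k) = (\<lambda>k\<in>J. S' \<inter> Q k)"
      have "S \<inter> Q k = S' \<inter> Q k" if "k \<in> J" for k using fun_cong[OF eq, of k] that by simp
      hence "(\<Union>k\<in>J. S \<inter> Q k) = (\<Union>k\<in>J. S' \<inter> Q k)" by simp
      thus "S = S'" using S UN_Int_blocks[of S] UN_Int_blocks[of S'] unfolding capped_def by simp
    qed
    show "(\<lambda>S. \<lambda>k\<in>J. S \<inter> Q k) ` capped n \<subseteq> ?PiE"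
      unfolding capped_def small_subsets_def by auto
    show "finite ?PiE"
      using finite_J finite_block by (intro finite_PiE finite_small_subsets)
  qed
  also have "card ?PiE = (\<Prod>k\<in>J. card (small_subsets (Q k) (n k)))" by (rule card_PiE[OF finite_J])
  finally have "real (card (capped n)) \<le> (\<Prod>k\<in>J. real (card (small_subsets (Q k) (n k))))"
    by (simp flip: of_nat_prod)
  also have "\<dots> \<le> (\<Prod>k\<in>J. (1 + y k) ^ card (Q k) / y k ^ n k)"
    using y finite_block by (intro prod_mono conjI card_small_subsets_le) auto
  finally show ?thesis .
qed

end

section \<open>The resonator\<close>

locale resonator =
  fixes f :: "nat \<Rightarrow> real" and I :: "nat set" and E :: "(nat \<times> nat) set" and y G :: real
  assumes finite_support: "finite I" and zero_notin_support: "0 \<notin> I"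
    and nonneg: "f m \<ge> 0" and mass_pos: "(\<Sum>m\<in>I. (f m)\<^sup>2) > 0"
    and pairs: "(k, m) \<in> E \<Longrightarrow> 0 < k \<and> m \<in> I \<and> k * m \<in> I \<and> real k \<le> y"
    and gain: "G * (\<Sum>m\<in>I. (f m)\<^sup>2) \<le> (\<Sum>(k, m)\<in>E. 1 / sqrt (real k) * (f m * f (k * m)))"

lemma resonator_mono:
  assumes "resonator f I E y G" "y \<le> y'" "G' \<le> G"
  shows "resonator f I E y' G'"
proof -
  interpret resonator f I E y G by fact
  have "G' * (\<Sum>m\<in>I. (f m)\<^sup>2) \<le> G * (\<Sum>m\<in>I. (f m)\<^sup>2)"
    using assms(3) mass_pos by (intro mult_right_mono) auto
  with gain have "G' * (\<Sum>m\<in>I. (f m)\<^sup>2) \<le> (\<Sum>(k, m)\<in>E. 1 / sqrt (real k) * (f m * f (k * m)))"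
    by (rule order_trans[rotated])
  moreover have "0 < k \<and> m \<in> I \<and> k * m \<in> I \<and> real k \<le> y'" if "(k, m) \<in> E" for k m
    using pairs[OF that] assms(2) by simp
  ultimately show ?thesis
    using finite_support zero_notin_support nonneg mass_pos by unfold_locales auto
qed

definition prime_weight :: "(nat \<Rightarrow> real) \<Rightarrow> nat \<Rightarrow> real" where
  "prime_weight w m = (\<Prod>p\<in>prime_factors m. w p)"

locale prime_blocks = disjoint_blocks Q J for Q :: "'i \<Rightarrow> nat set" and J +
  assumes prime_block: "k \<in> J \<Longrightarrow> p \<in> Q k \<Longrightarrow> prime p"
begin

definition support :: "('i \<Rightarrow> nat) \<Rightarrow> nat set" where
  "support n = (\<lambda>S. \<Prod>S) ` capped n"

definition prod_pairs :: "('i \<Rightarrow> nat) \<Rightarrow> ('i \<Rightarrow> nat) \<Rightarrow> (nat \<times> nat) set" where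
  "prod_pairs t s = (\<lambda>(T, S). (\<Prod>T, \<Prod>S)) ` capped_pairs t s"

lemma prime_union_blocks: "p \<in> union_blocks \<Longrightarrow> prime p"
  using prime_block unfolding union_blocks_def by auto

lemma prime_factors_Prod:
  assumes "S \<subseteq> union_blocks"
  shows "prime_factors (\<Prod>S) = S"
proof -
  have prime_S: "prime p" if "p \<in> S" for p using prime_union_blocks assms that by blast
  have "0 \<notin> S" using prime_S[of 0] by auto
  moreover have "prime_factors p = {p}" if "p \<in> S" for p using prime_S[OF that]
    by (rule prime_prime_factors)
  ultimately show ?thesis using prime_factors_prod[of S id]
    finite_subset[OF assms finite_union_blocks] by simp
qed

lemma Prod_pos:
  assumes "S \<subseteq> union_blocks"
  shows "\<Prod>S > 0"
proof (rule prod_pos)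
  fix p assume "p \<in> S"
  thus "p > 0" using assms by (intro prime_gt_0_nat prime_union_blocks) auto
qed

lemma inj_on_Prod: "inj_on (\<lambda>S. \<Prod>S) (Pow union_blocks)"
  by (rule inj_on_inverseI[where g = prime_factors]) (simp add: prime_factors_Prod)

lemma prime_weight_Prod: "S \<subseteq> union_blocks \<Longrightarrow> prime_weight w (\<Prod>S) = (\<Prod>p\<in>S. w p)"
  unfolding prime_weight_def by (simp add: prime_factors_Prod)

lemma capped_pairs_subset: "(T, S) \<in> capped_pairs t s \<Longrightarrow> T \<subseteq> union_blocks \<and> S \<subseteq> union_blocks"
  unfolding capped_pairs_def capped_def by blast

lemma Prod_capped_pairs:
  assumes "(T, S) \<in> capped_pairs t s"
  shows "\<Prod>T * \<Prod>S = \<Prod>(T \<union> S)"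
proof -
  have "finite T" "finite S" using capped_pairs_subset[OF assms] finite_union_blocks finite_subset
    by blast+
  moreover have "T \<inter> S = {}" using assms unfolding capped_pairs_def by auto
  ultimately show ?thesis by (simp add: prod.union_disjoint)
qed

lemma finite_support: "finite (support n)"
  unfolding support_def by (intro finite_imageI finite_capped)

lemma zero_notin_support: "0 \<notin> support n"
proof
  assume "0 \<in> support n"
  then obtain S where "S \<in> capped n" "0 = \<Prod>S" unfolding support_def by blast
  thus False using Prod_pos[of S] unfolding capped_def by simp
qed

lemma one_in_support: "1 \<in> support n"
  unfolding support_def by (intro image_eqI[of _ _ "{}"]) (auto simp: capped_def)

lemma card_support_le:
  fixes y :: "'i \<Rightarrow> real"
  assumes "\<And>k. k \<in> J \<Longrightarrow> 0 < y k \<and> y k \<le> 1"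
  shows "card (support n) \<le> (\<Prod>k\<in>J. (1 + y k) ^ card (Q k) / y k ^ n k)"
  using card_image_le[OF finite_capped[of n], of "\<lambda>S. \<Prod>S"] card_capped_le[of y n, OF assms]
  unfolding support_def by simp

lemma prod_pairs_in_support:
  assumes "(k, m) \<in> prod_pairs t s"
  shows "0 < k \<and> m \<in> support (\<lambda>j. t j + s j) \<and> k * m \<in> support (\<lambda>j. t j + s j)"
proof -
  obtain T S where TS: "(T, S) \<in> capped_pairs t s" "k = \<Prod>T" "m = \<Prod>S"
    using assms unfolding prod_pairs_def by auto
  have "S \<in> capped (\<lambda>j. t j + s j)"
    using TS(1) capped_mono[of s "\<lambda>j. t j + s j"] unfolding capped_pairs_def by auto
  thus ?thesis
    using Prod_pos[of T] capped_pairs_subset[OF TS(1)] Un_capped_pairs[OF TS(1)]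
      Prod_capped_pairs[OF TS(1)]
    unfolding TS support_def by simp
qed

lemma prod_pairs_le:
  fixes b :: "'i \<Rightarrow> real"
  assumes km: "(k, m) \<in> prod_pairs t s"
    and b: "\<And>j. j \<in> J \<Longrightarrow> b j \<ge> 1" "\<And>j p. j \<in> J \<Longrightarrow> p \<in> Q j \<Longrightarrow> real p \<le> b j"
  shows "real k \<le> (\<Prod>j\<in>J. b j ^ t j)"
proof -
  obtain T S where TS: "(T, S) \<in> capped_pairs t s" "k = \<Prod>T"
    using km unfolding prod_pairs_def by auto
  have "real k = (\<Prod>j\<in>J. \<Prod>p\<in>T \<inter> Q j. real p)"
    unfolding TS(2) of_nat_prod using capped_pairs_subset[OF TS(1)] by (intro prod_blocks) auto
  also have "\<dots> \<le> (\<Prod>j\<in>J. b j ^ t j)"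
  proof (intro prod_mono conjI prod_nonneg)
    fix j assume j: "j \<in> J"
    have "(\<Prod>p\<in>T \<inter> Q j. real p) \<le> (\<Prod>p\<in>T \<inter> Q j. b j)"
      using b(2)[OF j] by (intro prod_mono) auto
    also have "\<dots> = b j ^ card (T \<inter> Q j)" by simp
    also have "\<dots> \<le> b j ^ t j"
      using TS(1) b(1)[OF j] j unfolding capped_pairs_def capped_def
        by (intro power_increasing) auto
    finally show "(\<Prod>p\<in>T \<inter> Q j. real p) \<le> b j ^ t j" .
  qed simp
  finally show ?thesis .
qed

lemma sum_support_squared_le:
  "(\<Sum>m\<in>support n. (prime_weight w m)\<^sup>2) \<le> (\<Prod>k\<in>J. \<Prod>p\<in>Q k. 1 + (w p)\<^sup>2)"
proof -
  have "(\<Sum>m\<in>support n. (prime_weight w m)\<^sup>2) = (\<Sum>S\<in>capped n. (prime_weight w (\<Prod>S))\<^sup>2)"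
    unfolding support_def using inj_on_subset[OF inj_on_Prod capped_subset_Pow]
      by (simp add: sum.reindex)
  also have "\<dots> = (\<Sum>S\<in>capped n. \<Prod>p\<in>S. (w p)\<^sup>2)"
    by (intro sum.cong refl) (simp add: capped_def prime_weight_Prod prod_power_distrib)
  also have "\<dots> \<le> (\<Sum>S\<in>Pow union_blocks. \<Prod>p\<in>S. (w p)\<^sup>2)"
    using finite_union_blocks capped_subset_Pow by (intro sum_mono2) (auto intro: prod_nonneg)
  also have "\<dots> = (\<Prod>k\<in>J. \<Prod>p\<in>Q k. 1 + (w p)\<^sup>2)"
    unfolding sum_Pow_prod[OF finite_union_blocks] by (rule prod_union_blocks)
  finally show ?thesis .
qed

lemma prime_weight_mult_eq_pair_weight:
  assumes TS: "(T, S) \<in> capped_pairs t s"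
  shows "1 / sqrt (real (\<Prod>T)) * (prime_weight w (\<Prod>S) * prime_weight w (\<Prod>T * \<Prod>S)) =
    pair_weight (\<lambda>p. w p / sqrt (real p)) (\<lambda>p. (w p)\<^sup>2) (T, S)"
proof -
  have sub: "T \<subseteq> union_blocks" "S \<subseteq> union_blocks" using capped_pairs_subset[OF TS] by auto
  have "T \<inter> S = {}" using TS unfolding capped_pairs_def by auto
  moreover have "finite T" "finite S" using sub finite_union_blocks finite_subset by blast+
  ultimately have "(\<Prod>p\<in>T \<union> S. w p) = (\<Prod>p\<in>T. w p) * (\<Prod>p\<in>S. w p)"
    by (simp add: prod.union_disjoint)
  hence "prime_weight w (\<Prod>T * \<Prod>S) = (\<Prod>p\<in>T. w p) * (\<Prod>p\<in>S. w p)"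
    unfolding Prod_capped_pairs[OF TS] using sub by (subst prime_weight_Prod) auto
  moreover have "sqrt (\<Prod>p\<in>T. real p) = (\<Prod>p\<in>T. sqrt (real p))"
    by (induction T rule: infinite_finite_induct) (auto simp: real_sqrt_mult)
  ultimately show ?thesis
    using sub unfolding pair_weight_def
    by (simp add: prime_weight_Prod prod_dividef power2_eq_square prod.distrib)
qed

lemma sum_prod_pairs:
  "(\<Sum>(k, m)\<in>prod_pairs t s. 1 / sqrt (real k) * (prime_weight w m * prime_weight w (k * m))) =
    (\<Sum>z\<in>capped_pairs t s. pair_weight (\<lambda>p. w p / sqrt (real p)) (\<lambda>p. (w p)\<^sup>2) z)"
proof -
  have inj: "inj_on (\<lambda>(T, S). (\<Prod>T, \<Prod>S)) (capped_pairs t s)"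
  proof (rule inj_on_inverseI[where g = "\<lambda>(k, m). (prime_factors k, prime_factors m)"])
    fix z assume z: "z \<in> capped_pairs t s"
    obtain T S where "z = (T, S)" by (cases z)
    thus "(\<lambda>(k, m). (prime_factors k, prime_factors m)) ((\<lambda>(T, S). (\<Prod>T, \<Prod>S)) z) = z"
      using z capped_pairs_subset[of T S] by (simp add: prime_factors_Prod)
  qed
  show ?thesis
    unfolding prod_pairs_def sum.reindex[OF inj] o_def
  proof (rule sum.cong[OF refl])
    fix z assume z: "z \<in> capped_pairs t s"
    obtain T S where TS: "z = (T, S)" by (cases z)
    show "(case case z of (T, S) \<Rightarrow> (\<Prod>T, \<Prod>S) of (k, m) \<Rightarrow>
        1 / sqrt (real k) * (prime_weight w m * prime_weight w (k * m))) =
        pair_weight (\<lambda>p. w p / sqrt (real p)) (\<lambda>p. (w p)\<^sup>2) z"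
      using z unfolding TS prod.case by (rule prime_weight_mult_eq_pair_weight)
  qed
qed

lemma resonator_prime_weight:
  fixes g b :: "'i \<Rightarrow> real"
  assumes w: "\<And>p. w p \<ge> 0"
    and b: "\<And>j. j \<in> J \<Longrightarrow> b j \<ge> 1" "\<And>j p. j \<in> J \<Longrightarrow> p \<in> Q j \<Longrightarrow> real p \<le> b j"
    and block: "\<And>k. k \<in> J \<Longrightarrow> exp (g k) * (\<Prod>p\<in>Q k. 1 + (w p)\<^sup>2) \<le>
      (\<Sum>z\<in>block_pairs (Q k) (t k) (s k). pair_weight (\<lambda>p. w p / sqrt (real p)) (\<lambda>p. (w p)\<^sup>2) z)"
  shows "resonator (prime_weight w) (support (\<lambda>k. t k + s k)) (prod_pairs t s)
    (\<Prod>j\<in>J. b j ^ t j) (exp (\<Sum>k\<in>J. g k))"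
proof
  let ?I = "support (\<lambda>k. t k + s k)"
  show "finite ?I" "0 \<notin> ?I" by (rule finite_support zero_notin_support)+
  show "prime_weight w m \<ge> 0" for m unfolding prime_weight_def using w by (intro prod_nonneg) auto
  have "(prime_weight w 1)\<^sup>2 \<le> (\<Sum>m\<in>?I. (prime_weight w m)\<^sup>2)"
    by (rule member_le_sum[OF one_in_support]) (auto simp: finite_support)
  thus "(\<Sum>m\<in>?I. (prime_weight w m)\<^sup>2) > 0" by (simp add: prime_weight_def)
  show "0 < k \<and> m \<in> ?I \<and> k * m \<in> ?I \<and> real k \<le> (\<Prod>j\<in>J. b j ^ t j)" if "(k, m) \<in> prod_pairs t s"
    for k m
    using prod_pairs_in_support[OF that] prod_pairs_le[OF that, of b] b by blast
  have "exp (\<Sum>k\<in>J. g k) * (\<Sum>m\<in>?I. (prime_weight w m)\<^sup>2) \<le>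
      exp (\<Sum>k\<in>J. g k) * (\<Prod>k\<in>J. \<Prod>p\<in>Q k. 1 + (w p)\<^sup>2)"
    by (intro mult_left_mono sum_support_squared_le) auto
  also have "\<dots> = (\<Prod>k\<in>J. exp (g k) * (\<Prod>p\<in>Q k. 1 + (w p)\<^sup>2))"
    using finite_J by (simp add: exp_sum prod.distrib)
  also have "\<dots> \<le> (\<Prod>k\<in>J. \<Sum>z\<in>block_pairs (Q k) (t k) (s k).
      pair_weight (\<lambda>p. w p / sqrt (real p)) (\<lambda>p. (w p)\<^sup>2) z)"
    by (intro prod_mono conjI block mult_nonneg_nonneg prod_nonneg add_nonneg_nonneg) simp_all
  finally show "exp (\<Sum>k\<in>J. g k) * (\<Sum>m\<in>?I. (prime_weight w m)\<^sup>2) \<le>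
      (\<Sum>(k, m)\<in>prod_pairs t s. 1 / sqrt (real k) * (prime_weight w m * prime_weight w (k * m)))"
    unfolding sum_prod_pairs sum_capped_pairs .
qed

end

lemma sum_inverse_squares_le: "(\<Sum>k=1..n. 1 / (real k)\<^sup>2) \<le> 2"
proof -
  have "(\<Sum>k=1..n. 1 / (real k)\<^sup>2) \<le> 2 - 1 / real n"
  proof (induction n)
    case (Suc n)
    show ?case
    proof (cases "n = 0")
      case False
      have "1 / (real (Suc n))\<^sup>2 \<le> 1 / (real n * real (Suc n))"
        using False unfolding power2_eq_square by (intro divide_left_mono mult_right_mono) auto
      also have "\<dots> = 1 / real n - 1 / real (Suc n)" using False by (simp add: field_simps)
      finally show ?thesis using Suc.IH by simp
    qed simp
  qed simp
  also have "\<dots> \<le> 2" by simp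
  finally show ?thesis .
qed

lemma entropy_pos:
  fixes \<delta> :: real
  assumes "\<delta> > 0"
  shows "(1 + \<delta>) * ln (1 + \<delta>) - (1 + \<delta>) + 1 > 0"
proof -
  have "ln (1 / (1 + \<delta>)) \<le> 1 / (1 + \<delta>) - 1" using assms by (intro ln_le_minus_one) auto
  moreover have "ln (1 / (1 + \<delta>)) \<noteq> 1 / (1 + \<delta>) - 1"
    using assms ln_eq_minus_one[of "1 / (1 + \<delta>)"] by auto
  ultimately have "ln (1 / (1 + \<delta>)) < 1 / (1 + \<delta>) - 1" by linarith
  hence "ln (1 + \<delta>) > 1 - 1 / (1 + \<delta>)" using assms by (simp add: ln_div)
  hence "(1 + \<delta>) * ln (1 + \<delta>) > (1 + \<delta>) * (1 - 1 / (1 + \<delta>))" using assms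
    by (intro mult_strict_left_mono) auto
  also have "(1 + \<delta>) * (1 - 1 / (1 + \<delta>)) = \<delta>" using assms by (simp add: field_simps)
  finally show ?thesis by simp
qed

text \<open>Here \<open>L1\<close> plays the role of \<open>log N\<close>, and \<open>block k\<close> consists of the primes whose logarithm
  exceeds \<open>L2 + L3\<close> by \<open>B k\<close> to \<open>B (k + 1)\<close>. A block is so long that the error in Mertens' theorem
  is only \<open>\<delta> B\<close>. The weight is proportional to \<open>1 / (k sqrt p)\<close> on \<open>block k\<close>, so that the gain is
  proportional to the sum of \<open>1 / k\<close>; up to factors \<open>1 + O(\<delta>)\<close>, the cap \<open>s_cap\<close> is the sum of
  \<open>(weight p)\<^sup>2\<close> over a block, and \<open>t_cap\<close> is five times the sum of \<open>weight p / sqrt p\<close>.\<close>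

locale log_blocks =
  fixes \<kappa> \<delta> B L1 L2 L3 :: real
  assumes \<kappa>_pos: "\<kappa> > 0" and \<delta>_pos: "\<delta> > 0" and \<delta>_le: "\<delta> \<le> 1/8"
    and B_eq: "B = mertens_error / \<delta>"
    and L2_eq: "L2 = ln L1" and L3_eq: "L3 = ln L2"
    and L1_ge_1: "L1 \<ge> 1" and L2_ge_1: "L2 \<ge> 1" and L3_ge_1: "L3 \<ge> 1"
    and B_small: "L3 + B \<le> \<delta> * L2 / 2"
begin

definition num_blocks :: nat where
  "num_blocks = nat \<lfloor>\<delta> * L2 / (2 * B)\<rfloor>"

definition endpoint :: "nat \<Rightarrow> real" where
  "endpoint k = exp (B * real k) * (L1 * L2)"

definition block :: "nat \<Rightarrow> nat set" where
  "block k = {p. prime p \<and> endpoint k < real p \<and> real p \<le> endpoint (Suc k)}"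

definition gain_scale :: real where
  "gain_scale = sqrt (\<kappa> * L1 / (L2 * L3))"

definition weight :: "nat \<Rightarrow> real" where
  "weight p = (\<Sum>k\<in>{1..num_blocks}.
    if p \<in> block k then gain_scale * L2 / (B * real k) / sqrt (real p) else 0)"

definition t_cap :: "nat \<Rightarrow> nat" where
  "t_cap k = nat \<lceil>5 * gain_scale / real k\<rceil>"

definition s_cap :: "nat \<Rightarrow> nat" where
  "s_cap k = nat \<lceil>(1 + \<delta>)\<^sup>2 * \<kappa> * L1 / (B * L3) / (real k)\<^sup>2\<rceil>"

lemma \<delta>_B: "\<delta> * B = mertens_error"
  using \<delta>_pos unfolding B_eq by simp

lemma B_ge_8: "B \<ge> 8"
proof -
  have "1 / (1/8) \<le> mertens_error / \<delta>"
    using mertens_error_ge_1 \<delta>_pos \<delta>_le by (intro frac_le) auto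
  thus ?thesis unfolding B_eq by simp
qed

lemma gain_scale_pos: "gain_scale > 0"
  using \<kappa>_pos L1_ge_1 L2_ge_1 L3_ge_1 unfolding gain_scale_def by simp

lemma gain_scale_squared: "gain_scale\<^sup>2 = \<kappa> * L1 / (L2 * L3)"
  using \<kappa>_pos L1_ge_1 L2_ge_1 L3_ge_1 unfolding gain_scale_def by simp

lemma gain_scale_mult_L3: "gain_scale * L3 = sqrt \<kappa> * sqrt (L1 * L3 / L2)"
proof -
  have "gain_scale * L3 = sqrt (\<kappa> * L1 / (L2 * L3) * L3\<^sup>2)"
    unfolding gain_scale_def real_sqrt_mult[of _ "L3\<^sup>2"] using L3_ge_1 by simp
  also have "\<kappa> * L1 / (L2 * L3) * L3\<^sup>2 = \<kappa> * (L1 * L3 / L2)"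
    using L3_ge_1 by (simp add: power2_eq_square)
  finally show ?thesis by (simp only: real_sqrt_mult)
qed

lemma B_mult_num_blocks_le: "B * num_blocks \<le> \<delta> * L2 / 2"
proof -
  have "real num_blocks \<le> \<delta> * L2 / (2 * B)"
    unfolding num_blocks_def using \<delta>_pos L2_ge_1 B_ge_8 by (intro of_nat_floor) auto
  thus ?thesis using B_ge_8 by (simp add: field_simps)
qed

lemma \<delta>_mult_L2_le: "\<delta> * L2 \<le> L2 / 8"
  using mult_right_mono[OF \<delta>_le, of L2] L2_ge_1 by simp

lemma num_blocks_le_L2: "real num_blocks \<le> L2"
proof -
  have "real num_blocks \<le> B * num_blocks" using B_ge_8 by (simp add: mult_le_cancel_right1)
  thus ?thesis using B_mult_num_blocks_le \<delta>_mult_L2_le L2_ge_1 by linarith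
qed

lemma L1_mult_L2_ge: "L1 * L2 \<ge> L1" "L1 * L2 \<ge> 1"
  using L1_ge_1 L2_ge_1 mult_mono[of 1 L1 1 L2] by (auto simp: mult_le_cancel_left1)

lemma endpoint_ge: "endpoint k \<ge> L1 * L2"
  using B_ge_8 L1_mult_L2_ge unfolding endpoint_def by (simp add: mult_le_cancel_right1)

lemma endpoint_ge_1: "endpoint k \<ge> 1"
  using endpoint_ge[of k] L1_mult_L2_ge by linarith

lemma endpoint_mono: "j \<le> k \<Longrightarrow> endpoint j \<le> endpoint k"
  using B_ge_8 L1_mult_L2_ge unfolding endpoint_def by (intro mult_right_mono) auto

lemma ln_endpoint: "ln (endpoint k) = B * k + L2 + L3"
  using L1_ge_1 L2_ge_1 unfolding endpoint_def
    by (simp add: ln_mult L2_eq[symmetric] L3_eq[symmetric])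

lemma ln_endpoint_Suc_le:
  assumes "k \<le> num_blocks"
  shows "ln (endpoint (Suc k)) \<le> (1 + \<delta>) * L2"
proof -
  have "B * real (Suc k) \<le> B * num_blocks + B" using assms B_ge_8 by (simp add: algebra_simps)
  thus ?thesis unfolding ln_endpoint using B_mult_num_blocks_le B_small by (simp add: algebra_simps)
qed

lemma block_prime_ge: "p \<in> block k \<Longrightarrow> real p \<ge> L1 * L2"
  using endpoint_ge[of k] unfolding block_def by auto

lemma block_prime_pos: "p \<in> block k \<Longrightarrow> real p > 0"
  using block_prime_ge[of p k] L1_mult_L2_ge by linarith

lemma block_disjoint: "j < k \<Longrightarrow> block j \<inter> block k = {}"
  using endpoint_mono[of "Suc j" k] unfolding block_def by auto

sublocale prime_blocks block "{1..num_blocks}"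
proof
  show "finite (block k)" for k
    by (rule finite_subset[OF _ finite_primes_le_real[of "endpoint (Suc k)"]])
      (auto simp: block_def)
  show "disjoint_family_on block {1..num_blocks}"
    unfolding disjoint_family_on_def using block_disjoint by (metis Int_commute linorder_neqE_nat)
qed (auto simp: block_def)

lemma sum_ln_over_block:
  "\<bar>(\<Sum>p\<in>block k. ln (real p) / real p) - B\<bar> \<le> \<delta> * B"
proof -
  have "ln (endpoint (Suc k) / endpoint k) = B"
    using endpoint_ge_1[of k] endpoint_ge_1[of "Suc k"]
      by (simp add: ln_div ln_endpoint algebra_simps)
  thus ?thesis
    using mertens_first_interval[OF endpoint_ge_1[of k] endpoint_mono[of k "Suc k"]]
    unfolding block_def \<delta>_B by simp
qed

lemma sum_inverse_block_le: "(\<Sum>p\<in>block k. 1 / real p) \<le> (1 + \<delta>) * B / L2"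
proof -
  have "L2 * (\<Sum>p\<in>block k. 1 / real p) \<le> (\<Sum>p\<in>block k. ln (real p) / real p)"
    unfolding sum_distrib_left
  proof (rule sum_mono)
    fix p assume p: "p \<in> block k"
    have "L1 \<le> real p" using block_prime_ge[OF p] L1_mult_L2_ge(1) by linarith
    hence "L2 \<le> ln (real p)" unfolding L2_eq using L1_ge_1 by simp
    thus "L2 * (1 / real p) \<le> ln (real p) / real p" by (simp add: divide_right_mono)
  qed
  hence "L2 * (\<Sum>p\<in>block k. 1 / real p) \<le> (1 + \<delta>) * B"
    using sum_ln_over_block[of k] by (simp add: algebra_simps)
  thus ?thesis using L2_ge_1 by (simp add: pos_le_divide_eq mult.commute)
qed

lemma sum_inverse_block_ge:
  assumes k: "k \<le> num_blocks"
  shows "(\<Sum>p\<in>block k. 1 / real p) \<ge> (1 - 2 * \<delta>) * B / L2"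
proof -
  let ?H = "\<Sum>p\<in>block k. 1 / real p"
  have "(\<Sum>p\<in>block k. ln (real p) / real p) \<le> (1 + \<delta>) * L2 * ?H"
    unfolding sum_distrib_left
  proof (rule sum_mono)
    fix p assume p: "p \<in> block k"
    have "ln (real p) \<le> ln (endpoint (Suc k))"
      using block_prime_pos[OF p] p unfolding block_def by (subst ln_le_cancel_iff) auto
    hence "ln (real p) \<le> (1 + \<delta>) * L2" using ln_endpoint_Suc_le[OF k] by linarith
    thus "ln (real p) / real p \<le> (1 + \<delta>) * L2 * (1 / real p)" by (simp add: divide_right_mono)
  qed
  moreover have "(1 - 2 * \<delta>) * (1 + \<delta>) * B \<le> (1 - \<delta>) * B"
    using B_ge_8 \<delta>_pos by (intro mult_right_mono) (auto simp: algebra_simps)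
  moreover have "(1 - \<delta>) * B \<le> (\<Sum>p\<in>block k. ln (real p) / real p)"
    using sum_ln_over_block[of k] by (simp add: algebra_simps)
  ultimately have "(1 + \<delta>) * ((1 - 2 * \<delta>) * B) \<le> (1 + \<delta>) * (L2 * ?H)" by (simp add: mult_ac)
  hence "(1 - 2 * \<delta>) * B \<le> L2 * ?H" using \<delta>_pos by (subst (asm) mult_le_cancel_left_pos) auto
  thus ?thesis using L2_ge_1 by (simp add: pos_divide_le_eq mult.commute)
qed

lemma weight_nonneg: "weight p \<ge> 0"
  unfolding weight_def using gain_scale_pos L2_ge_1 B_ge_8 by (intro sum_nonneg) auto

lemma weight_eq:
  assumes "k \<in> {1..num_blocks}" "p \<in> block k"
  shows "weight p = gain_scale * L2 / (B * real k) / sqrt (real p)"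
proof -
  have "p \<in> block j \<longleftrightarrow> j = k" for j
    using assms(2) block_disjoint[of j k] block_disjoint[of k j]
      by (cases j k rule: linorder_cases) auto
  thus ?thesis unfolding weight_def using assms(1) by simp
qed

lemma weight_squared:
  assumes "k \<in> {1..num_blocks}" "p \<in> block k"
  shows "(weight p)\<^sup>2 = \<kappa> * L1 * L2 / (B\<^sup>2 * L3) / (real k)\<^sup>2 * (1 / real p)"
proof -
  have scale: "(gain_scale * L2 / (B * real k))\<^sup>2 = \<kappa> * L1 * L2 / (B\<^sup>2 * L3) / (real k)\<^sup>2"
    unfolding power_divide power_mult_distrib gain_scale_squared using L2_ge_1
      by (simp add: power2_eq_square mult_ac)
  show ?thesis
    unfolding weight_eq[OF assms] power_divide[of "gain_scale * L2 / (B * real k)" "sqrt (real p)"]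
      scale by simp
qed

lemma weight_over_sqrt:
  assumes "k \<in> {1..num_blocks}" "p \<in> block k"
  shows "weight p / sqrt (real p) = gain_scale * L2 / (B * real k) * (1 / real p)"
  unfolding weight_eq[OF assms] by simp

lemma sum_weight_squared_le:
  assumes k: "k \<in> {1..num_blocks}"
  shows "(\<Sum>p\<in>block k. (weight p)\<^sup>2) \<le> (1 + \<delta>) * \<kappa> * L1 / (B * L3) / (real k)\<^sup>2"
proof -
  have "(\<Sum>p\<in>block k. (weight p)\<^sup>2) = \<kappa> * L1 * L2 / (B\<^sup>2 * L3) / (real k)\<^sup>2 * (\<Sum>p\<in>block k. 1 / real p)"
    unfolding sum_distrib_left by (intro sum.cong refl weight_squared[OF k])
  also have "\<dots> \<le> \<kappa> * L1 * L2 / (B\<^sup>2 * L3) / (real k)\<^sup>2 * ((1 + \<delta>) * B / L2)"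
    using \<kappa>_pos L1_ge_1 L2_ge_1 L3_ge_1 by (intro mult_left_mono sum_inverse_block_le) auto
  also have "\<dots> = (1 + \<delta>) * \<kappa> * L1 / (B * L3) / (real k)\<^sup>2"
    using L2_ge_1 B_ge_8 by (simp add: power2_eq_square mult_ac)
  finally show ?thesis .
qed

lemma sum_weight_over_sqrt_bounds:
  assumes k: "k \<in> {1..num_blocks}"
  shows "(\<Sum>p\<in>block k. weight p / sqrt (real p)) \<le> (1 + \<delta>) * gain_scale / real k"
    and "(\<Sum>p\<in>block k. weight p / sqrt (real p)) \<ge> (1 - 2 * \<delta>) * gain_scale / real k"
proof -
  let ?A = "gain_scale * L2 / (B * real k)"
  have A: "?A \<ge> 0" using gain_scale_pos L2_ge_1 B_ge_8 by simp
  have sum: "(\<Sum>p\<in>block k. weight p / sqrt (real p)) = ?A * (\<Sum>p\<in>block k. 1 / real p)"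
    unfolding sum_distrib_left by (intro sum.cong refl weight_over_sqrt[OF k])
  have "?A * (\<Sum>p\<in>block k. 1 / real p) \<le> ?A * ((1 + \<delta>) * B / L2)"
    by (intro mult_left_mono sum_inverse_block_le A)
  also have "\<dots> = (1 + \<delta>) * gain_scale / real k" using L2_ge_1 B_ge_8 by simp
  finally show "(\<Sum>p\<in>block k. weight p / sqrt (real p)) \<le> (1 + \<delta>) * gain_scale / real k"
    unfolding sum .
  have "(1 - 2 * \<delta>) * gain_scale / real k = ?A * ((1 - 2 * \<delta>) * B / L2)" using L2_ge_1 B_ge_8
    by simp
  also have "\<dots> \<le> ?A * (\<Sum>p\<in>block k. 1 / real p)"
    using k by (intro mult_left_mono sum_inverse_block_ge A) auto
  finally show "(\<Sum>p\<in>block k. weight p / sqrt (real p)) \<ge> (1 - 2 * \<delta>) * gain_scale / real k"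
    unfolding sum .
qed

lemma inverse_block_prime_le: "p \<in> block k \<Longrightarrow> 1 / real p \<le> 1 / (L1 * L2)"
  using block_prime_ge[of p k] L1_mult_L2_ge by (intro divide_left_mono) auto

lemma weight_squared_le:
  assumes k: "k \<in> {1..num_blocks}" and p: "p \<in> block k" and small: "\<kappa> / (B\<^sup>2 * L3) \<le> \<delta>"
  shows "(weight p)\<^sup>2 \<le> \<delta>"
proof -
  have "0 < k" "1 \<le> (real k)\<^sup>2" using k by auto
  hence "(weight p)\<^sup>2 \<le> \<kappa> * L1 * L2 / (B\<^sup>2 * L3) / 1 * (1 / (L1 * L2))"
    unfolding weight_squared[OF k p] using \<kappa>_pos L1_ge_1 L2_ge_1 L3_ge_1
    by (intro mult_mono[OF divide_left_mono inverse_block_prime_le[OF p]]) auto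
  also have "\<dots> = \<kappa> / (B\<^sup>2 * L3)" using L1_ge_1 L2_ge_1 by simp
  finally show ?thesis using small by linarith
qed

lemma weight_over_sqrt_le:
  assumes k: "k \<in> {1..num_blocks}" and p: "p \<in> block k" and small: "gain_scale / (B * L1) \<le> \<delta>"
  shows "weight p / sqrt (real p) \<le> \<delta>"
proof -
  have "weight p / sqrt (real p) \<le> gain_scale * L2 / (B * 1) * (1 / (L1 * L2))"
    unfolding weight_over_sqrt[OF k p] using k gain_scale_pos L2_ge_1 B_ge_8
    by (intro mult_mono[OF divide_left_mono inverse_block_prime_le[OF p]]) auto
  also have "\<dots> = gain_scale / (B * L1)" using L2_ge_1 by simp
  finally show ?thesis using small by linarith
qed

lemma t_cap_bounds: "5 * gain_scale / real k \<le> t_cap k" "t_cap k \<le> 5 * gain_scale / real k + 1"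
proof -
  have "5 * gain_scale / real k \<ge> 0" using gain_scale_pos by simp
  thus "5 * gain_scale / real k \<le> t_cap k" "t_cap k \<le> 5 * gain_scale / real k + 1"
    unfolding t_cap_def by linarith+
qed

lemma s_cap_bounds:
  "(1 + \<delta>)\<^sup>2 * \<kappa> * L1 / (B * L3) / (real k)\<^sup>2 \<le> s_cap k"
  "s_cap k \<le> (1 + \<delta>)\<^sup>2 * \<kappa> * L1 / (B * L3) / (real k)\<^sup>2 + 1"
proof -
  have "(1 + \<delta>)\<^sup>2 * \<kappa> * L1 / (B * L3) / (real k)\<^sup>2 \<ge> 0"
    using \<kappa>_pos L1_ge_1 L3_ge_1 B_ge_8 by simp
  thus "(1 + \<delta>)\<^sup>2 * \<kappa> * L1 / (B * L3) / (real k)\<^sup>2 \<le> s_cap k"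
    "s_cap k \<le> (1 + \<delta>)\<^sup>2 * \<kappa> * L1 / (B * L3) / (real k)\<^sup>2 + 1" unfolding s_cap_def by linarith+
qed

lemma block_gain_exponent_ge:
  assumes k: "k \<in> {1..num_blocks}"
  shows "(1 - 8 * \<delta>) * gain_scale / real k - 3 \<le>
    (1 - \<delta>) * (\<Sum>p\<in>block k. weight p / sqrt (real p)) - \<delta> * t_cap k - 2"
proof -
  define m where "m = gain_scale / real k"
  have m: "m \<ge> 0" unfolding m_def using gain_scale_pos by simp
  have "(1 - \<delta>) * ((1 - 2 * \<delta>) * m) \<le> (1 - \<delta>) * (\<Sum>p\<in>block k. weight p / sqrt (real p))"
    using sum_weight_over_sqrt_bounds(2)[OF k] \<delta>_le unfolding m_def by (intro mult_left_mono) auto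
  moreover have "\<delta> * t_cap k \<le> \<delta> * (5 * m) + \<delta>"
    using mult_left_mono[OF t_cap_bounds(2)[of k], of \<delta>] \<delta>_pos unfolding m_def
      by (simp add: distrib_left)
  moreover have "(1 - 8 * \<delta>) * m \<le> (1 - \<delta>) * ((1 - 2 * \<delta>) * m) - \<delta> * (5 * m)"
    using m \<delta>_pos by (simp add: algebra_simps)
  moreover have "(1 - 8 * \<delta>) * gain_scale / real k = (1 - 8 * \<delta>) * m" unfolding m_def by simp
  ultimately show ?thesis using \<delta>_le by linarith
qed

definition charge :: "nat \<Rightarrow> real" where
  "charge k = B * (1 + \<delta>) * (real k + 1) + ln L3"

lemma ln_L3_bounds: "0 \<le> ln L3" "ln L3 \<le> L3"
  using L3_ge_1 ln_le_minus_one[of L3] by auto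

lemma charge_nonneg: "charge k \<ge> 0"
  unfolding charge_def using B_ge_8 \<delta>_pos ln_L3_bounds
    by (intro add_nonneg_nonneg mult_nonneg_nonneg) auto

lemma charge_le_L2:
  assumes "k \<le> num_blocks"
  shows "charge k \<le> L2"
proof -
  have "B * real k \<le> B * num_blocks" using assms B_ge_8 by (intro mult_left_mono) auto
  hence "B * (real k + 1) + L3 \<le> \<delta> * L2" using B_mult_num_blocks_le B_small
    by (simp add: algebra_simps)
  hence "(1 + \<delta>) * (B * (real k + 1) + L3) \<le> (1 + \<delta>) * (\<delta> * L2)" using \<delta>_pos
    by (intro mult_left_mono) auto
  moreover have "charge k = (1 + \<delta>) * (B * (real k + 1)) + ln L3"
    unfolding charge_def by (simp only: mult_ac)
  moreover have "ln L3 \<le> (1 + \<delta>) * L3"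
    using ln_L3_bounds mult_right_mono[of 1 "1 + \<delta>" L3] \<delta>_pos L3_ge_1 by linarith
  moreover have "(1 + \<delta>) * (\<delta> * L2) \<le> 2 * (L2 / 8)"
    using \<delta>_le \<delta>_pos \<delta>_mult_L2_le L2_ge_1 by (intro mult_mono) auto
  ultimately show ?thesis using L2_ge_1 by (simp only: distrib_left[of "1 + \<delta>"])
qed

lemma card_block_mult_exp_charge_le:
  "card (block k) * exp (- charge k) \<le> (1 + \<delta>) * B * L1 / L3 * (1/2) ^ k"
proof -
  have "real (card (block k)) = (\<Sum>p\<in>block k. 1)" by simp
  also have "\<dots> \<le> (\<Sum>p\<in>block k. endpoint (Suc k) * (1 / real p))"
    using block_prime_pos by (intro sum_mono) (auto simp: block_def field_simps)
  also have "\<dots> = endpoint (Suc k) * (\<Sum>p\<in>block k. 1 / real p)" by (rule sum_distrib_left[symmetric])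
  also have "\<dots> \<le> endpoint (Suc k) * ((1 + \<delta>) * B / L2)"
    using endpoint_ge_1[of "Suc k"] by (intro mult_left_mono sum_inverse_block_le) auto
  also have "\<dots> = exp (B * real (Suc k)) * ((1 + \<delta>) * B * L1)" unfolding endpoint_def using L2_ge_1
    by simp
  finally have "card (block k) * exp (- charge k) \<le>
      exp (B * real (Suc k)) * ((1 + \<delta>) * B * L1) * exp (- charge k)"
    by (intro mult_right_mono) auto
  also have "\<dots> = (1 + \<delta>) * B * L1 / L3 * exp (- (\<delta> * B * real (Suc k)))"
  proof -
    have "- charge k = - (B * real (Suc k)) + - (\<delta> * B * real (Suc k)) + - ln L3"
      unfolding charge_def by (simp add: algebra_simps)
    hence "exp (- charge k) = exp (- (B * real (Suc k))) * exp (- (\<delta> * B * real (Suc k))) / L3"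
      using L3_ge_1 by (simp only: exp_add) (simp add: exp_minus divide_inverse)
    thus ?thesis by (simp add: exp_minus)
  qed
  also have "\<dots> \<le> (1 + \<delta>) * B * L1 / L3 * (1/2) ^ k"
  proof (intro mult_left_mono)
    have "exp (- (\<delta> * B * real (Suc k))) \<le> exp (- (1 * real k))"
      unfolding \<delta>_B using mult_mono[OF mertens_error_ge_1, of "real k" "real (Suc k)"]
        mertens_error_ge_1 by simp
    also have "\<dots> = exp (- 1) ^ k" by (simp add: exp_of_nat_mult[symmetric])
    also have "\<dots> \<le> (1/2) ^ k" using two_mult_exp_minus_1_le by (intro power_mono) auto
    finally show "exp (- (\<delta> * B * real (Suc k))) \<le> (1/2) ^ k" .
  qed (use \<delta>_pos B_ge_8 L1_ge_1 L3_ge_1 in auto)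
  finally show ?thesis .
qed

lemma sum_charge_over_squares_le:
  "(\<Sum>k=1..num_blocks. charge k / (real k)\<^sup>2) \<le> B * (1 + \<delta>) * (1 + L3) + 2 * (B * (1 + \<delta>) + ln L3)"
proof -
  have "(\<Sum>k=1..num_blocks. charge k / (real k)\<^sup>2) =
      (\<Sum>k=1..num_blocks. B * (1 + \<delta>) * inverse (real k) + (B * (1 + \<delta>) + ln L3) * (1 / (real k)\<^sup>2))"
    unfolding charge_def by (intro sum.cong refl) (auto simp: field_simps power2_eq_square)
  also have "\<dots> = B * (1 + \<delta>) * harm num_blocks
      + (B * (1 + \<delta>) + ln L3) * (\<Sum>k=1..num_blocks. 1 / (real k)\<^sup>2)"
    unfolding harm_def by (simp only: sum.distrib sum_distrib_left)
  also have "\<dots> \<le> B * (1 + \<delta>) * (1 + L3) + (B * (1 + \<delta>) + ln L3) * 2"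
  proof (intro add_mono mult_left_mono sum_inverse_squares_le)
    show "harm num_blocks \<le> 1 + L3"
    proof (cases "num_blocks = 0")
      case False
      have "ln (real num_blocks) \<le> L3" unfolding L3_eq using num_blocks_le_L2 False L2_ge_1
        by (subst ln_le_cancel_iff) auto
      thus ?thesis using harm_le_Suc_ln[of num_blocks] False by simp
    qed (use L3_ge_1 in \<open>simp add: harm_def\<close>)
  qed (use B_ge_8 \<delta>_pos ln_L3_bounds in auto)
  finally show ?thesis by simp
qed

lemma charge_mult_caps_le:
  assumes k: "k \<in> {1..num_blocks}"
  shows "charge k * (t_cap k + s_cap k) \<le>
    (1 + \<delta>)\<^sup>2 * \<kappa> * L1 / (B * L3) * (charge k / (real k)\<^sup>2) + L2 * (5 * gain_scale + 2)"
proof -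
  let ?s = "(1 + \<delta>)\<^sup>2 * \<kappa> * L1 / (B * L3)"
  have "5 * gain_scale / real k \<le> 5 * gain_scale / 1" using k gain_scale_pos
    by (intro divide_left_mono) auto
  hence "real (t_cap k + s_cap k) \<le> ?s / (real k)\<^sup>2 + (5 * gain_scale + 2)"
    using t_cap_bounds(2)[of k] s_cap_bounds(2)[of k] by simp
  hence "charge k * (t_cap k + s_cap k) \<le> charge k * (?s / (real k)\<^sup>2 + (5 * gain_scale + 2))"
    by (intro mult_left_mono charge_nonneg)
  also have "charge k * (a / (real k)\<^sup>2 + (5 * gain_scale + 2)) = a * (charge k / (real k)\<^sup>2)
      + charge k * (5 * gain_scale + 2)" for a
    by (simp add: distrib_left)
  also have "?s * (charge k / (real k)\<^sup>2) + charge k * (5 * gain_scale + 2) \<le>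
      ?s * (charge k / (real k)\<^sup>2) + L2 * (5 * gain_scale + 2)"
    using k gain_scale_pos by (intro add_left_mono mult_right_mono charge_le_L2) auto
  finally show ?thesis .
qed

lemma rankin_factor_le:
  "(1 + exp (- charge k)) ^ card (block k) / exp (- charge k) ^ n \<le>
    exp (card (block k) * exp (- charge k) + charge k * n)"
proof -
  have "(1 + exp (- charge k)) ^ card (block k) \<le> exp (exp (- charge k)) ^ card (block k)"
    by (intro power_mono) (auto simp: add_nonneg_nonneg)
  also have "\<dots> = exp (card (block k) * exp (- charge k))" by (simp add: exp_of_nat_mult)
  finally have "(1 + exp (- charge k)) ^ card (block k) * exp (charge k * n) \<le>
      exp (card (block k) * exp (- charge k)) * exp (charge k * n)" by (intro mult_right_mono) auto
  moreover have "exp (- charge k) ^ n = exp (- (charge k * n))"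
    by (simp add: exp_of_nat_mult[symmetric] mult.commute)
  ultimately show ?thesis by (simp add: exp_add exp_minus divide_inverse)
qed

definition lower_order :: real where
  "lower_order = (1 + \<delta>) * B * L1 / L3
    + (1 + \<delta>)\<^sup>2 * \<kappa> * L1 / (B * L3) * (B * (1 + \<delta>) + 2 * (B * (1 + \<delta>) + ln L3))
    + L2 * (L2 * (5 * gain_scale + 2))"

lemma card_support_le_exp:
  "card (support (\<lambda>k. t_cap k + s_cap k)) \<le> exp ((1 + \<delta>) ^ 3 * \<kappa> * L1 + lower_order)"
proof -
  let ?s = "(1 + \<delta>)\<^sup>2 * \<kappa> * L1 / (B * L3)"
  have "card (support (\<lambda>k. t_cap k + s_cap k)) \<le>
      (\<Prod>k=1..num_blocks.
        (1 + exp (- charge k)) ^ card (block k) / exp (- charge k) ^ (t_cap k + s_cap k))"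
    using charge_nonneg by (intro card_support_le) auto
  also have "\<dots> \<le> (\<Prod>k=1..num_blocks. exp (card (block k) * exp (- charge k)
      + charge k * (t_cap k + s_cap k)))"
    by (intro prod_mono conjI rankin_factor_le divide_nonneg_nonneg zero_le_power)
      (auto simp: add_nonneg_nonneg)
  also have "\<dots> = exp (\<Sum>k=1..num_blocks. card (block k) * exp (- charge k)
      + charge k * (t_cap k + s_cap k))"
    by (simp add: exp_sum)
  also have "(\<Sum>k=1..num_blocks. card (block k) * exp (- charge k)
      + charge k * (t_cap k + s_cap k)) \<le>
      (\<Sum>k=1..num_blocks. (1 + \<delta>) * B * L1 / L3 * (1/2) ^ k
        + (?s * (charge k / (real k)\<^sup>2) + L2 * (5 * gain_scale + 2)))"
    by (intro sum_mono add_mono card_block_mult_exp_charge_le charge_mult_caps_le)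
  also have "\<dots> = (1 + \<delta>) * B * L1 / L3 * (\<Sum>k=1..num_blocks. (1/2) ^ k)
      + (?s * (\<Sum>k=1..num_blocks. charge k / (real k)\<^sup>2)
      + real num_blocks * (L2 * (5 * gain_scale + 2)))"
    by (simp only: sum.distrib sum_distrib_left sum_constant card_atLeastAtMost) simp
  also have "\<dots> \<le> (1 + \<delta>) * B * L1 / L3 * 1
      + (?s * (B * (1 + \<delta>) * (1 + L3) + 2 * (B * (1 + \<delta>) + ln L3))
      + L2 * (L2 * (5 * gain_scale + 2)))"
  proof (intro add_mono mult_left_mono mult_right_mono sum_charge_over_squares_le num_blocks_le_L2)
    have "(\<Sum>k=1..n. (1/2) ^ k) = 1 - (1/2::real) ^ n" for n by (induction n) auto
    thus "(\<Sum>k=1..num_blocks. (1/2) ^ k) \<le> (1::real)" by simp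
  qed (use \<delta>_pos \<kappa>_pos B_ge_8 L1_ge_1 L2_ge_1 L3_ge_1 gain_scale_pos in auto)
  also have "\<dots> = (1 + \<delta>) ^ 3 * \<kappa> * L1 + lower_order"
  proof -
    have "?s * (B * (1 + \<delta>) * L3) = (1 + \<delta>) ^ 3 * \<kappa> * L1"
      using B_ge_8 L3_ge_1 by (simp add: power3_eq_cube power2_eq_square)
    thus ?thesis unfolding lower_order_def by (simp add: distrib_left distrib_right)
  qed
  finally show ?thesis by simp
qed

end

locale large_log_blocks = log_blocks +
  assumes weight_squared_small: "\<kappa> / (B\<^sup>2 * L3) \<le> \<delta>"
    and weight_over_sqrt_small: "gain_scale / (B * L1) \<le> \<delta>"
    and sum_weight_over_sqrt_large: "L2 \<le> (1 - 2 * \<delta>) * gain_scale"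
    and sum_weight_squared_large:
      "1 \<le> ((1 + \<delta>) * ln (1 + \<delta>) - (1 + \<delta>) + 1) * ((1 + \<delta>) * \<kappa> * L1 / (B * L3) / L2\<^sup>2)"
    and caps_small: "L2 * ((5 * gain_scale + 1) * (2 * L2)) \<le> L1"
    and num_blocks_large: "(1 - \<delta>) * L3 \<le> ln (\<delta> * L2 / (2 * B))"
begin

lemma block_gain:
  assumes k: "k \<in> {1..num_blocks}"
  shows "exp ((1 - 8 * \<delta>) * gain_scale / real k - 3) * (\<Prod>p\<in>block k. 1 + (weight p)\<^sup>2) \<le>
    (\<Sum>z\<in>block_pairs (block k) (t_cap k) (s_cap k).
      pair_weight (\<lambda>p. weight p / sqrt (real p)) (\<lambda>p. (weight p)\<^sup>2) z)"
proof -
  let ?v = "\<lambda>p. weight p / sqrt (real p)" and ?U = "(1 + \<delta>) * \<kappa> * L1 / (B * L3) / (real k)\<^sup>2"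
  have kr: "1 \<le> real k" "real k \<le> L2" using k num_blocks_le_L2 by auto
  have "exp ((1 - 8 * \<delta>) * gain_scale / real k - 3) * (\<Prod>p\<in>block k. 1 + (weight p)\<^sup>2) \<le>
      exp ((1 - \<delta>) * (\<Sum>p\<in>block k. ?v p) - \<delta> * t_cap k - 2) * (\<Prod>p\<in>block k. 1 + (weight p)\<^sup>2)"
    using block_gain_exponent_ge[OF k] by (intro mult_right_mono prod_nonneg) auto
  also have "\<dots> \<le> (\<Sum>z\<in>block_pairs (block k) (t_cap k) (s_cap k). pair_weight ?v (\<lambda>p. (weight p)\<^sup>2) z)"
  proof (rule block_sum_ge[where U = ?U])
    show "finite (block k)" by (rule finite_block[OF k])
    show "0 \<le> (weight p)\<^sup>2 \<and> (weight p)\<^sup>2 \<le> \<delta>" if "p \<in> block k" for p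
      using weight_squared_le[OF k that weight_squared_small] by simp
    show "0 \<le> ?v p \<and> ?v p \<le> \<delta>" if "p \<in> block k" for p
      using weight_over_sqrt_le[OF k that weight_over_sqrt_small] weight_nonneg by simp
    show "(\<Sum>p\<in>block k. (weight p)\<^sup>2) \<le> ?U" by (rule sum_weight_squared_le[OF k])
    show "(1 + \<delta>) * ?U \<le> s_cap k" using s_cap_bounds(1)[of k]
      by (simp add: power2_eq_square mult.assoc)
    have "(1 + \<delta>) * \<kappa> * L1 / (B * L3) / L2\<^sup>2 \<le> ?U"
      using kr \<kappa>_pos \<delta>_pos L1_ge_1 L3_ge_1 B_ge_8 by (intro divide_left_mono power_mono) auto
    from mult_left_mono[OF this less_imp_le[OF entropy_pos[OF \<delta>_pos]]]
      show "1 \<le> ((1 + \<delta>) * ln (1 + \<delta>) - (1 + \<delta>) + 1) * ?U"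
      using sum_weight_squared_large by linarith
    have "real k \<le> (1 - 2 * \<delta>) * gain_scale" using kr sum_weight_over_sqrt_large by linarith
    hence "1 \<le> (1 - 2 * \<delta>) * gain_scale / real k" using kr by simp
    thus "1 \<le> (\<Sum>p\<in>block k. ?v p)" using sum_weight_over_sqrt_bounds(2)[OF k] by linarith
    have "4 * (\<Sum>p\<in>block k. ?v p) \<le> 4 * ((1 + \<delta>) * gain_scale / real k)"
      using sum_weight_over_sqrt_bounds(1)[OF k] by (intro mult_left_mono) auto
    also have "\<dots> = (4 * (1 + \<delta>)) * (gain_scale / real k)" by simp
    also have "\<dots> \<le> 5 * (gain_scale / real k)" using \<delta>_le gain_scale_pos
      by (intro mult_right_mono) auto
    finally show "4 * (\<Sum>p\<in>block k. ?v p) \<le> t_cap k" using t_cap_bounds(1)[of k] by simp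
  qed (use \<delta>_pos \<delta>_le in auto)
  finally show ?thesis .
qed

lemma prod_endpoint_power_le: "(\<Prod>j=1..num_blocks. endpoint (Suc j) ^ t_cap j) \<le> exp L1"
proof -
  have "(\<Prod>j=1..num_blocks. endpoint (Suc j) ^ t_cap j) =
      (\<Prod>j=1..num_blocks. exp (real (t_cap j) * ln (endpoint (Suc j))))"
    using less_le_trans[OF zero_less_one endpoint_ge_1]
      by (intro prod.cong refl) (simp add: exp_of_nat_mult)
  also have "\<dots> = exp (\<Sum>j=1..num_blocks. real (t_cap j) * ln (endpoint (Suc j)))"
    by (simp add: exp_sum)
  also have "(\<Sum>j=1..num_blocks. real (t_cap j) * ln (endpoint (Suc j))) \<le>
      (\<Sum>j=1..num_blocks. (5 * gain_scale + 1) * (2 * L2))"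
  proof (intro sum_mono mult_mono)
    fix j assume j: "j \<in> {1..num_blocks}"
    have "5 * gain_scale / real j \<le> 5 * gain_scale / 1" using j gain_scale_pos
      by (intro divide_left_mono) auto
    thus "real (t_cap j) \<le> 5 * gain_scale + 1" using t_cap_bounds(2)[of j] by simp
    have "ln (endpoint (Suc j)) \<le> (1 + \<delta>) * L2" using j by (intro ln_endpoint_Suc_le) auto
    also have "\<dots> \<le> 2 * L2" using \<delta>_le L2_ge_1 by (intro mult_right_mono) auto
    finally show "ln (endpoint (Suc j)) \<le> 2 * L2" .
  qed (use gain_scale_pos endpoint_ge_1 in auto)
  also have "\<dots> = real num_blocks * ((5 * gain_scale + 1) * (2 * L2))" by simp
  also have "\<dots> \<le> L2 * ((5 * gain_scale + 1) * (2 * L2))"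
    using num_blocks_le_L2 gain_scale_pos L2_ge_1 by (intro mult_right_mono) auto
  also note caps_small
  finally show ?thesis by simp
qed

lemma sum_block_gain_ge:
  "(1 - 9 * \<delta>) * (gain_scale * L3) - 3 * L2 \<le>
      (\<Sum>k=1..num_blocks. (1 - 8 * \<delta>) * gain_scale / real k - 3)"
proof -
  have "\<delta> * L2 / (2 * B) \<le> real num_blocks + 1" unfolding num_blocks_def by linarith
  hence "ln (\<delta> * L2 / (2 * B)) \<le> ln (real num_blocks + 1)"
    using \<delta>_pos L2_ge_1 B_ge_8 by (subst ln_le_cancel_iff) auto
  also have "\<dots> \<le> harm num_blocks" by (rule ln_le_harm)
  finally have harm: "(1 - \<delta>) * L3 \<le> harm num_blocks" using num_blocks_large by linarith
  have "(1 - 9 * \<delta>) * (gain_scale * L3) \<le> ((1 - 8 * \<delta>) * (1 - \<delta>)) * (gain_scale * L3)"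
    using gain_scale_pos L3_ge_1 by (intro mult_right_mono) (auto simp: algebra_simps)
  also have "\<dots> = (1 - 8 * \<delta>) * gain_scale * ((1 - \<delta>) * L3)" by (simp only: mult_ac)
  also have "\<dots> \<le> (1 - 8 * \<delta>) * gain_scale * harm num_blocks"
    using harm \<delta>_le gain_scale_pos by (intro mult_left_mono) auto
  finally have "(1 - 9 * \<delta>) * (gain_scale * L3) - 3 * L2 \<le>
      (1 - 8 * \<delta>) * gain_scale * harm num_blocks - 3 * real num_blocks"
    using num_blocks_le_L2 by linarith
  also have "\<dots> = (\<Sum>k=1..num_blocks. (1 - 8 * \<delta>) * gain_scale / real k - 3)"
    unfolding harm_def by (simp add: sum_subtractf sum_distrib_left divide_inverse)
  finally show ?thesis .
qed

lemma resonator_log_blocks: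
  "resonator (prime_weight weight) (support (\<lambda>k. t_cap k + s_cap k)) (prod_pairs t_cap s_cap)
    (exp L1) (exp ((1 - 9 * \<delta>) * (sqrt \<kappa> * sqrt (L1 * L3 / L2)) - 3 * L2))"
proof -
  have "resonator (prime_weight weight) (support (\<lambda>k. t_cap k + s_cap k)) (prod_pairs t_cap s_cap)
      (\<Prod>j=1..num_blocks. endpoint (Suc j) ^ t_cap j)
      (exp (\<Sum>k=1..num_blocks. (1 - 8 * \<delta>) * gain_scale / real k - 3))"
    using endpoint_ge_1 by (intro resonator_prime_weight weight_nonneg block_gain)
      (auto simp: block_def)
  thus ?thesis
    using prod_endpoint_power_le sum_block_gain_ge unfolding gain_scale_mult_L3
      by (auto intro: resonator_mono)
qed

end

lemma resonator_parameters:
  fixes c \<theta> :: real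
  assumes "0 < c" "c\<^sup>2 < \<theta>"
  obtains \<kappa> \<delta> where "\<kappa> > 0" "0 < \<delta>" "\<delta> \<le> 1/8" "(1 + \<delta>) ^ 3 * \<kappa> < \<theta>" "c < (1 - 9 * \<delta>) * sqrt \<kappa>"
proof -
  obtain \<kappa> where \<kappa>: "c\<^sup>2 < \<kappa>" "\<kappa> < \<theta>" using dense[OF assms(2)] by blast
  have "((\<lambda>\<delta>. (1 + \<delta>) ^ 3 * \<kappa>) \<longlongrightarrow> (1 + 0) ^ 3 * \<kappa>) (at_right 0)"
    by (intro tendsto_intros)
  hence "\<forall>\<^sub>F \<delta> in at_right 0. (1 + \<delta>) ^ 3 * \<kappa> < \<theta>"
    using \<kappa> by (intro order_tendstoD(2)) auto
  moreover have "((\<lambda>\<delta>. (1 - 9 * \<delta>) * sqrt \<kappa>) \<longlongrightarrow> (1 - 9 * 0) * sqrt \<kappa>) (at_right 0)"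
    by (intro tendsto_intros)
  hence "\<forall>\<^sub>F \<delta> in at_right 0. c < (1 - 9 * \<delta>) * sqrt \<kappa>"
    using real_less_rsqrt[OF \<kappa>(1)] by (intro order_tendstoD(1)) auto
  moreover have "\<forall>\<^sub>F \<delta>::real in at_right 0. \<delta> \<in> {0<..<1/8}"
    by (rule eventually_at_right_real) simp
  ultimately have "\<forall>\<^sub>F \<delta> in at_right 0. (1 + \<delta>) ^ 3 * \<kappa> < \<theta> \<and> c < (1 - 9 * \<delta>) * sqrt \<kappa> \<and>
      \<delta> \<in> {0<..<1/8}"
    by eventually_elim blast
  then obtain \<delta> where "(1 + \<delta>) ^ 3 * \<kappa> < \<theta> \<and> c < (1 - 9 * \<delta>) * sqrt \<kappa> \<and> \<delta> \<in> {0<..<1/8}"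
    using eventually_happens'[OF trivial_limit_at_right_real] by blast
  moreover have "\<kappa> > 0" using \<kappa>(1) zero_le_power2[of c] by linarith
  ultimately show ?thesis using that[of \<kappa> \<delta>] by auto
qed

lemma eventually_large_log_blocks:
  fixes \<kappa> \<delta> :: real
  assumes \<kappa>: "\<kappa> > 0" and \<delta>: "0 < \<delta>" "\<delta> \<le> 1/8"
  shows "\<forall>\<^sub>F x in at_top. large_log_blocks \<kappa> \<delta> (mertens_error / \<delta>) x (ln x) (ln (ln x))"
proof -
  define B where "B = mertens_error / \<delta>"
  define h where "h = (1 + \<delta>) * ln (1 + \<delta>) - (1 + \<delta>) + 1"
  define r where "r = \<delta> / (2 * B)"
  have B: "B > 0" unfolding B_def using mertens_error_ge_1 \<delta> by simp
  have h: "h > 0" unfolding h_def by (rule entropy_pos[OF \<delta>(1)])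
  have r: "r > 0" unfolding r_def using \<delta> B by simp
  let ?M = "\<lambda>x. sqrt (\<kappa> * x / (ln x * ln (ln x)))"
  have "\<forall>\<^sub>F x in at_top. x \<ge> 1 \<and> ln x \<ge> 1 \<and> ln (ln x) \<ge> 1 \<and> ln (ln x) + B \<le> \<delta> * ln x / 2"
    using \<delta> by (intro eventually_conj eventually_ge_at_top; real_asymp)
  moreover have "\<forall>\<^sub>F x in at_top. \<kappa> / (B\<^sup>2 * ln (ln x)) \<le> \<delta>" using \<kappa> \<delta> B by real_asymp
  moreover have "\<forall>\<^sub>F x in at_top. ?M x / (B * x) \<le> \<delta>" using \<kappa> \<delta> B by real_asymp
  moreover have "\<forall>\<^sub>F x in at_top. ln x \<le> (1 - 2 * \<delta>) * ?M x" using \<kappa> \<delta> by real_asymp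
  moreover have "\<forall>\<^sub>F x in at_top. 1 \<le> h * ((1 + \<delta>) * \<kappa> * x / (B * ln (ln x)) / (ln x)\<^sup>2)"
    using \<kappa> \<delta> B h by real_asymp
  moreover have "\<forall>\<^sub>F x in at_top. ln x * ((5 * ?M x + 1) * (2 * ln x)) \<le> x" using \<kappa> by real_asymp
  moreover have "\<forall>\<^sub>F x in at_top. (1 - \<delta>) * ln (ln x) \<le> ln (r * ln x)" using \<delta> r by real_asymp
  ultimately show ?thesis
  proof eventually_elim
    case (elim x)
    interpret log_blocks \<kappa> \<delta> B x "ln x" "ln (ln x)"
      using \<kappa> \<delta> elim(1) by unfold_locales (auto simp: B_def)
    show ?case
      using elim(2-) unfolding B_def[symmetric] h_def r_def
        by unfold_locales (simp_all add: gain_scale_def)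
  qed
qed

lemma eventually_lower_order_le:
  fixes \<kappa> \<delta> d :: real
  assumes \<kappa>: "\<kappa> > 0" and \<delta>: "0 < \<delta>" "\<delta> \<le> 1/8" and d: "d > 0"
  shows "\<forall>\<^sub>F x in at_top. log_blocks.lower_order \<kappa> \<delta> (mertens_error / \<delta>) x (ln x) (ln (ln x)) \<le>
      d * x"
proof -
  define B where "B = mertens_error / \<delta>"
  have "B > 0" unfolding B_def using mertens_error_ge_1 \<delta> by simp
  hence "\<forall>\<^sub>F x in at_top. (1 + \<delta>) * B * x / ln (ln x)
      + (1 + \<delta>)\<^sup>2 * \<kappa> * x / (B * ln (ln x)) * (B * (1 + \<delta>) + 2 * (B * (1 + \<delta>) + ln (ln (ln x))))
      + ln x * (ln x * (5 * sqrt (\<kappa> * x / (ln x * ln (ln x))) + 2)) \<le> d * x"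
    using \<kappa> \<delta> d by real_asymp
  with eventually_large_log_blocks[OF \<kappa> \<delta>] show ?thesis
  proof eventually_elim
    case (elim x)
    interpret large_log_blocks \<kappa> \<delta> B x "ln x" "ln (ln x)" using elim(1) unfolding B_def .
    show ?case using elim(2) unfolding B_def[symmetric] lower_order_def gain_scale_def .
  qed
qed

lemma resonator_exists:
  fixes c \<theta> :: real
  assumes c: "0 < c" "c\<^sup>2 < \<theta>"
  shows "\<forall>\<^sub>F x in at_top. \<exists>f I E. resonator f I E (exp x) (exp (c * sqrt (x * ln (ln x) / ln x))) \<and>
    card I \<le> exp (\<theta> * x)"
proof -
  obtain \<kappa> \<delta> where \<kappa>: "\<kappa> > 0" and \<delta>: "0 < \<delta>" "\<delta> \<le> 1/8"
      and size: "(1 + \<delta>) ^ 3 * \<kappa> < \<theta>" and gain: "c < (1 - 9 * \<delta>) * sqrt \<kappa>"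
    using resonator_parameters[OF c] by blast
  define d where "d = (1 - 9 * \<delta>) * sqrt \<kappa> - c"
  have "d > 0" unfolding d_def using gain by simp
  hence "\<forall>\<^sub>F x in at_top. 3 * ln x \<le> d * sqrt (x * ln (ln x) / ln x)" by real_asymp
  moreover note eventually_large_log_blocks[OF \<kappa> \<delta>]
  moreover have "\<theta> - (1 + \<delta>) ^ 3 * \<kappa> > 0" using size by simp
  note eventually_lower_order_le[OF \<kappa> \<delta> this]
  ultimately show ?thesis
  proof eventually_elim
    case (elim x)
    interpret large_log_blocks \<kappa> \<delta> "mertens_error / \<delta>" x "ln x" "ln (ln x)" by (rule elim(2))
    let ?I = "support (\<lambda>k. t_cap k + s_cap k)"
    have "c * sqrt (x * ln (ln x) / ln x) \<le> (1 - 9 * \<delta>) * (sqrt \<kappa> * sqrt (x * ln (ln x) / ln x))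
        - 3 * ln x"
      using elim(1) unfolding d_def by (simp add: left_diff_distrib)
    hence "resonator (prime_weight weight) ?I (prod_pairs t_cap s_cap) (exp x)
        (exp (c * sqrt (x * ln (ln x) / ln x)))"
      using resonator_log_blocks by (auto intro: resonator_mono)
    moreover have "(1 + \<delta>) ^ 3 * \<kappa> * x + lower_order \<le> \<theta> * x"
      using elim(3) by (simp add: left_diff_distrib)
    hence "card ?I \<le> exp (\<theta> * x)" using card_support_le_exp by (auto intro: order_trans)
    ultimately show ?case by blast
  qed
qed

section \<open>Large values of zeta\<close>

lemma eventually_admissible_length:
  fixes \<alpha> \<epsilon> :: real
  assumes "\<alpha> > 0" "\<epsilon> > 0"
  obtains K :: nat where "\<forall>\<^sub>F h in at_top. \<forall>l Y. real l \<le> h \<longrightarrow> h powr (1 + \<epsilon>) \<le> real Y \<longrightarrow>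
    admissible_length K (Complex (1/2) (\<alpha> * real l)) Y"
proof -
  define K where "K = nat \<lceil>1 / \<epsilon>\<rceil> + 2"
  have K: "K \<ge> 2" unfolding K_def by simp
  have "real K > 1 + 1 / \<epsilon>" unfolding K_def by linarith
  hence "\<epsilon> * real K > \<epsilon> + 1" using assms by (simp add: field_simps)
  define \<eta> where "\<eta> = (1 + \<epsilon>) * (real K - 1) - real K"
  have \<eta>: "\<eta> > 0" unfolding \<eta>_def using \<open>\<epsilon> * real K > \<epsilon> + 1\<close> by (simp add: algebra_simps)
  have "\<forall>\<^sub>F h in at_top. h powr \<eta> \<ge> (\<alpha> + 1) ^ K" using \<eta> by real_asymp
  moreover have "\<forall>\<^sub>F h::real in at_top. h \<ge> real K + 1" by (rule eventually_ge_at_top)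
  ultimately have "\<forall>\<^sub>F h in at_top. \<forall>l Y. real l \<le> h \<longrightarrow> h powr (1 + \<epsilon>) \<le> real Y \<longrightarrow>
      admissible_length K (Complex (1/2) (\<alpha> * real l)) Y"
  proof eventually_elim
    case (elim h)
    have h: "h > 0" using elim(2) by linarith
    show ?case
    proof (intro allI impI)
      fix l Y :: nat assume l: "real l \<le> h" and Y: "h powr (1 + \<epsilon>) \<le> real Y"
      have "norm (Complex (1/2) (\<alpha> * real l)) \<le> 1/2 + \<alpha> * real l"
        using cmod_le[of "Complex (1/2) (\<alpha> * real l)"] assms by simp
      also have "\<dots> \<le> 1/2 + \<alpha> * h" using l assms by simp
      finally have "norm (Complex (1/2) (\<alpha> * real l)) + K \<le> (\<alpha> + 1) * h"
        using elim(2) by (simp add: algebra_simps)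
      hence "(norm (Complex (1/2) (\<alpha> * real l)) + K) ^ K \<le> ((\<alpha> + 1) * h) ^ K"
        by (intro power_mono) auto
      also have "\<dots> = (\<alpha> + 1) ^ K * h powr real K" using h
        by (simp add: power_mult_distrib powr_realpow)
      also have "\<dots> \<le> h powr \<eta> * h powr real K" by (intro mult_right_mono elim(1)) auto
      also have "\<dots> = h powr ((1 + \<epsilon>) * (real K - 1))" unfolding \<eta>_def by (simp flip: powr_add)
      also have "\<dots> = (h powr (1 + \<epsilon>)) ^ (K - 1)"
        using K h by (simp add: powr_powr[symmetric] powr_realpow[symmetric] of_nat_diff)
      also have "\<dots> \<le> real Y ^ (K - 1)" using Y by (intro power_mono) auto
      finally show "admissible_length K (Complex (1/2) (\<alpha> * real l)) Y"
        unfolding admissible_length_def using K by simp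
    qed
  qed
  thus ?thesis by (rule that)
qed

definition smooth_weight :: "nat \<Rightarrow> nat \<Rightarrow> real" where
  "smooth_weight X k = card {Y\<in>{X..<2*X}. k \<le> Y} / real X / sqrt (real k)"

lemma smooth_weight_nonneg: "smooth_weight X k \<ge> 0"
  unfolding smooth_weight_def by simp

lemma smooth_weight_eq:
  assumes "X > 0" "k \<le> X"
  shows "smooth_weight X k = 1 / sqrt (real k)"
proof -
  have "{Y\<in>{X..<2*X}. k \<le> Y} = {X..<2*X}" using assms by auto
  thus ?thesis using assms(1) unfolding smooth_weight_def by simp
qed

lemma zeta_smooth_sum_eq:
  "zeta_smooth_sum X (Complex (1/2) t) =
      (\<Sum>k\<in>{1..2*X}. of_real (smooth_weight X k) * cis (- (t * ln (real k))))"
proof -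
  let ?e = "\<lambda>k. of_real (1 / sqrt (real k)) * cis (- (t * ln (real k)))"
  have "(\<Sum>Y=X..<2*X. zeta_sum Y (Complex (1/2) t)) = (\<Sum>Y=X..<2*X. \<Sum>k | k \<in> {1..2*X} \<and> k \<le> Y. ?e k)"
  proof (rule sum.cong[OF refl])
    fix Y assume "Y \<in> {X..<2*X}"
    hence "{k. k \<in> {1..2*X} \<and> k \<le> Y} = {1..Y}" by auto
    thus "zeta_sum Y (Complex (1/2) t) = (\<Sum>k | k \<in> {1..2*X} \<and> k \<le> Y. ?e k)"
      unfolding zeta_sum_def by (simp only:) (intro sum.cong refl of_nat_powr_critical_line, auto)
  qed
  also have "\<dots> = (\<Sum>k=1..2*X. \<Sum>Y | Y \<in> {X..<2*X} \<and> k \<le> Y. ?e k)"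
    by (rule sum.swap_restrict) auto
  also have "\<dots> = (\<Sum>k=1..2*X. of_nat (card {Y\<in>{X..<2*X}. k \<le> Y}) * ?e k)" by simp
  finally show ?thesis
    unfolding zeta_smooth_sum_def smooth_weight_def by (simp add: sum_divide_distrib mult.commute)
qed

lemma sum_inverse_sqrt_le: "(\<Sum>k=1..n. 1 / sqrt (real k)) \<le> 2 * sqrt (real n)"
proof (induction n)
  case (Suc n)
  let ?a = "sqrt (real n)" and ?b = "sqrt (real (Suc n))"
  have "1 = (?b - ?a) * (?b + ?a)" by (simp add: algebra_simps)
  also have "\<dots> \<le> (?b - ?a) * (2 * ?b)" by (intro mult_left_mono) auto
  finally have "1 / ?b \<le> 2 * (?b - ?a)"
    by (subst pos_divide_le_eq) (simp_all add: algebra_simps)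
  thus ?case using Suc by simp
qed simp

lemma norm_zeta_smooth_sum_half_le: "norm (zeta_smooth_sum X (Complex (1/2) 0)) \<le> 4 * sqrt X"
proof -
  have "norm (zeta_sum Y (Complex (1/2) 0)) \<le> 4 * sqrt X" if "Y \<le> 2 * X" for Y
  proof -
    have "norm (zeta_sum Y (Complex (1/2) 0)) \<le> (\<Sum>k=1..Y. 1 / sqrt (real k))"
      unfolding zeta_sum_def
      by (intro sum_norm_le, subst of_nat_powr_critical_line) (auto simp: norm_mult norm_divide)
    also have "\<dots> \<le> 2 * sqrt Y" by (rule sum_inverse_sqrt_le)
    also have "sqrt Y \<le> sqrt (4 * X)" using that by (intro real_sqrt_le_mono) linarith
    also have "\<dots> = 2 * sqrt X" by (simp add: real_sqrt_mult)
    finally show ?thesis by simp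
  qed
  hence "norm (\<Sum>Y=X..<2*X. zeta_sum Y (Complex (1/2) 0)) \<le> (\<Sum>Y=X..<2*X. 4 * sqrt X)"
    by (intro sum_norm_le) auto
  hence "norm (\<Sum>Y=X..<2*X. zeta_sum Y (Complex (1/2) 0)) \<le> 4 * sqrt X * real X"
    by (simp add: mult_ac)
  thus ?thesis unfolding zeta_smooth_sum_def
    by (cases "X = 0") (auto simp: norm_divide field_simps)
qed

lemma norm_zeta_smooth_sum_le_zeta_sum:
  assumes s: "Re s = 1/2" "Im s \<noteq> 0" and adm: "admissible_length K s X" "admissible_length K s Y"
  shows "norm (zeta_smooth_sum X s) \<le>
    norm (zeta_sum Y s) + (2 * zeta_error + 1) + sqrt Y / \<bar>Im s\<bar> + 8 * sqrt X / (Im s)\<^sup>2"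
proof -
  have "norm (zeta_smooth_sum X s) \<le>
      norm (riemann_zeta s) + norm (zeta_smooth_sum X s - riemann_zeta s)"
    by (rule norm_triangle_sub)
  moreover have "norm (riemann_zeta s) \<le> norm (zeta_sum Y s) + norm (zeta_sum Y s - riemann_zeta s)"
    by (metis norm_minus_commute norm_triangle_sub)
  ultimately show ?thesis
    using norm_zeta_smooth_sum_diff_le[OF s adm(1)] norm_zeta_sum_diff_le[OF s adm(2)] by linarith
qed

lemma norm_zeta_smooth_sum_progression_le:
  fixes \<alpha> :: real
  assumes \<alpha>: "\<alpha> > 0" and l: "l > 0"
    and adm: "admissible_length K (Complex (1/2) (\<alpha> * real l)) X"
      "admissible_length K (Complex (1/2) (\<alpha> * real l)) Y"
  shows "norm (zeta_smooth_sum X (Complex (1/2) (\<alpha> * real l))) \<le>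
    norm (zeta_sum Y (Complex (1/2) (\<alpha> * real l))) + (2 * zeta_error + 1)
      + sqrt Y / \<alpha> * inverse (real l) + 8 * sqrt X / \<alpha>\<^sup>2 * (1 / (real l)\<^sup>2)"
proof -
  let ?s = "Complex (1/2) (\<alpha> * real l)"
  have "norm (zeta_smooth_sum X ?s) \<le>
      norm (zeta_sum Y ?s) + (2 * zeta_error + 1) + sqrt Y / \<bar>\<alpha> * real l\<bar>
        + 8 * sqrt X / (\<alpha> * real l)\<^sup>2"
    using norm_zeta_smooth_sum_le_zeta_sum[of ?s K X Y] adm l \<alpha> by simp
  moreover have "sqrt Y / \<bar>\<alpha> * real l\<bar> = sqrt Y / \<alpha> * inverse (real l)"
    using \<alpha> by (simp add: abs_mult divide_inverse)
  moreover have "8 * sqrt X / (\<alpha> * real l)\<^sup>2 = 8 * sqrt X / \<alpha>\<^sup>2 * (1 / (real l)\<^sup>2)"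
    by (simp add: power_mult_distrib)
  ultimately show ?thesis by linarith
qed

lemma sum_norm_zeta_smooth_sum_le:
  fixes \<alpha> :: real
  assumes \<alpha>: "\<alpha> > 0" and h: "h > 0"
    and adm: "\<And>l. l < h \<Longrightarrow> admissible_length K (Complex (1/2) (\<alpha> * real l)) X"
      "\<And>l. l < h \<Longrightarrow> admissible_length K (Complex (1/2) (\<alpha> * real l)) Y"
  shows "(\<Sum>l<h. norm (zeta_smooth_sum X (Complex (1/2) (\<alpha> * real l)))) \<le>
    4 * sqrt X + (\<Sum>l<h. norm (zeta_sum Y (Complex (1/2) (\<alpha> * real l))))
    + h * (2 * zeta_error + 1) + sqrt Y / \<alpha> * (1 + ln h) + 16 * sqrt X / \<alpha>\<^sup>2"
proof -
  let ?P = "\<lambda>l::nat. norm (zeta_smooth_sum X (Complex (1/2) (\<alpha> * real l)))"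
    and ?S = "\<lambda>l::nat. norm (zeta_sum Y (Complex (1/2) (\<alpha> * real l)))"
  have "{..<h} = insert 0 {1..<h}" using h by auto
  hence "(\<Sum>l<h. ?P l) = ?P 0 + (\<Sum>l\<in>{1..<h}. ?P l)" by simp
  also have "?P 0 \<le> 4 * sqrt X" using norm_zeta_smooth_sum_half_le[of X] by simp
  also have "(\<Sum>l\<in>{1..<h}. ?P l) \<le> (\<Sum>l\<in>{1..<h}. ?S l + (2 * zeta_error + 1)
      + sqrt Y / \<alpha> * inverse (real l) + 8 * sqrt X / \<alpha>\<^sup>2 * (1 / (real l)\<^sup>2))"
    by (intro sum_mono norm_zeta_smooth_sum_progression_le[where K = K] \<alpha> adm) auto
  also have "\<dots> = (\<Sum>l\<in>{1..<h}. ?S l) + (\<Sum>l\<in>{1..<h}. 2 * zeta_error + 1)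
      + sqrt Y / \<alpha> * (\<Sum>l\<in>{1..<h}. inverse (real l)) + 8 * sqrt X / \<alpha>\<^sup>2 * (\<Sum>l\<in>{1..<h}. 1 / (real l)\<^sup>2)"
    by (simp only: sum.distrib sum_distrib_left)
  also have "\<dots> \<le> (\<Sum>l<h. ?S l) + h * (2 * zeta_error + 1) + sqrt Y / \<alpha> * (1 + ln h)
      + 8 * sqrt X / \<alpha>\<^sup>2 * 2"
  proof (intro add_mono mult_left_mono)
    show "(\<Sum>l\<in>{1..<h}. ?S l) \<le> (\<Sum>l<h. ?S l)" by (intro sum_mono2) auto
    show "(\<Sum>l\<in>{1..<h}. 2 * zeta_error + 1) \<le> h * (2 * zeta_error + 1)"
      using zeta_error_pos by (simp add: mult_right_mono)
    have "(\<Sum>l\<in>{1..<h}. inverse (real l)) \<le> harm h" unfolding harm_def by (intro sum_mono2) auto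
    also have "\<dots> \<le> 1 + ln h" by (rule harm_le_Suc_ln[OF h])
    finally show "(\<Sum>l\<in>{1..<h}. inverse (real l)) \<le> 1 + ln h" .
    have "(\<Sum>l\<in>{1..<h}. 1 / (real l)\<^sup>2) \<le> (\<Sum>l=1..h. 1 / (real l)\<^sup>2)" by (intro sum_mono2) auto
    also have "\<dots> \<le> 2" by (rule sum_inverse_squares_le)
    finally show "(\<Sum>l\<in>{1..<h}. 1 / (real l)\<^sup>2) \<le> 2" .
  qed (use \<alpha> in auto)
  finally show ?thesis by simp
qed

definition mean_square_factor :: "real \<Rightarrow> real \<Rightarrow> real" where
  "mean_square_factor \<alpha> \<Lambda> = (\<alpha> * \<Lambda> + 1) * ((1 + 16 / \<alpha> * (1 + \<Lambda>)) * (1 + \<Lambda>))"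

lemma sum_norm_zeta_sum_le:
  fixes \<alpha> \<Lambda> m :: real
  assumes \<alpha>: "\<alpha> > 0" and Y: "Y > 0" "ln Y \<le> \<Lambda>" "Y \<le> 2 * m" and h: "h \<le> m"
  shows "(\<Sum>l<h. norm (zeta_sum Y (Complex (1/2) (\<alpha> * real l)))) \<le> m * sqrt (mean_square_factor \<alpha> \<Lambda>)"
proof -
  let ?S = "\<lambda>l::nat. norm (zeta_sum Y (Complex (1/2) (\<alpha> * real l)))"
  have lnY: "ln Y \<ge> 0" using Y by simp
  have \<Lambda>: "\<Lambda> \<ge> 0" using lnY Y by linarith
  have m: "m \<ge> 0" using h by linarith
  have "(\<Sum>l<h. ?S l)\<^sup>2 \<le> (\<Sum>l<h. (?S l)\<^sup>2) * card {..<h}"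
    by (rule sum_squared_le_sum_of_squares)
  also have "\<dots> \<le> ((\<alpha> * ln Y + 1) * ((h + 8 * Y / \<alpha> * (1 + ln Y)) * (1 + ln Y))) * h"
    using zeta_sum_mean_square[OF \<alpha> Y(1), of h] by (simp add: mult_right_mono)
  also have "\<dots> \<le> ((\<alpha> * \<Lambda> + 1) * ((m + 8 * (2 * m) / \<alpha> * (1 + \<Lambda>)) * (1 + \<Lambda>))) * m"
    using \<alpha> Y lnY \<Lambda> m h
    by (intro mult_mono add_mono divide_right_mono order_refl add_nonneg_nonneg mult_nonneg_nonneg
      divide_nonneg_pos) auto
  also have "\<dots> = m\<^sup>2 * mean_square_factor \<alpha> \<Lambda>"
    unfolding mean_square_factor_def by (simp add: power2_eq_square algebra_simps)
  finally have "sqrt ((\<Sum>l<h. ?S l)\<^sup>2) \<le> sqrt (m\<^sup>2 * mean_square_factor \<alpha> \<Lambda>)"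
    by (rule real_sqrt_le_mono)
  thus ?thesis using m by (simp add: real_sqrt_mult sum_nonneg)
qed

definition short_sum_factor :: "real \<Rightarrow> real \<Rightarrow> real" where
  "short_sum_factor \<alpha> \<Lambda> =
    4 + sqrt (mean_square_factor \<alpha> \<Lambda>) + (2 * zeta_error + 1) + 2 / \<alpha> * (1 + \<Lambda>) + 16 / \<alpha>\<^sup>2"

lemma sum_norm_zeta_smooth_sum_le_factor:
  fixes \<alpha> \<Lambda> m :: real
  assumes \<alpha>: "\<alpha> > 0" and m: "m \<ge> 1" "ln (2 * m) \<le> \<Lambda>" and h: "0 < h" "h \<le> m" and X: "sqrt X \<le> m"
    and adm_X: "\<And>l. l < h \<Longrightarrow> admissible_length K (Complex (1/2) (\<alpha> * real l)) X"
    and adm: "\<And>l Y. l < h \<Longrightarrow> m \<le> real Y \<Longrightarrow> admissible_length K (Complex (1/2) (\<alpha> * real l)) Y"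
  shows "(\<Sum>l<h. norm (zeta_smooth_sum X (Complex (1/2) (\<alpha> * real l)))) \<le> m * short_sum_factor \<alpha> \<Lambda>"
proof -
  define Y where "Y = nat \<lceil>m\<rceil>"
  have Y: "m \<le> Y" "Y \<le> 2 * m" unfolding Y_def using m by linarith+
  have ln_le: "ln x \<le> \<Lambda>" if "1 \<le> x" "x \<le> 2 * m" for x
    using that m(2) ln_mono[of x "2 * m"] by linarith
  have "sqrt Y \<le> sqrt (Y * Y)" using Y m by (intro real_sqrt_le_mono) auto
  hence sqrt_Y: "sqrt Y \<le> 2 * m" using Y by simp
  have \<Lambda>: "\<Lambda> \<ge> 0" using ln_le[of 1] m by simp
  have "(\<Sum>l<h. norm (zeta_smooth_sum X (Complex (1/2) (\<alpha> * real l)))) \<le>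
      4 * sqrt X + (\<Sum>l<h. norm (zeta_sum Y (Complex (1/2) (\<alpha> * real l))))
      + h * (2 * zeta_error + 1) + sqrt Y / \<alpha> * (1 + ln h) + 16 * sqrt X / \<alpha>\<^sup>2"
    by (intro sum_norm_zeta_smooth_sum_le[where K = K] \<alpha> h adm_X adm Y)
  also have "\<dots> \<le> 4 * m + m * sqrt (mean_square_factor \<alpha> \<Lambda>) + m * (2 * zeta_error + 1)
      + 2 * m / \<alpha> * (1 + \<Lambda>) + 16 * m / \<alpha>\<^sup>2"
    using \<alpha> m h Y X sqrt_Y \<Lambda> zeta_error_pos ln_le[of "real h"] ln_le[of "real Y"]
    by (intro add_mono mult_mono divide_right_mono sum_norm_zeta_sum_le add_nonneg_nonneg) auto
  also have "\<dots> = m * short_sum_factor \<alpha> \<Lambda>" unfolding short_sum_factor_def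
    by (simp add: algebra_simps)
  finally show ?thesis .
qed

lemma sum_norm_zeta_smooth_sum_le_powr:
  fixes \<alpha> \<epsilon> T :: real
  assumes \<alpha>: "\<alpha> > 0" and \<epsilon>: "0 < \<epsilon>" "\<epsilon> \<le> 1" and T: "T \<ge> 4" "T powr \<epsilon> \<ge> 2"
    and factor: "short_sum_factor \<alpha> (2 * ln T) \<le> T powr \<epsilon>"
    and adm: "\<And>l Y. real l \<le> sqrt T \<Longrightarrow> sqrt T powr (1 + \<epsilon>) \<le> real Y \<Longrightarrow>
      admissible_length K (Complex (1/2) (\<alpha> * real l)) Y"
    and X: "T powr (1 + \<epsilon>) \<le> real X" "real X \<le> 2 * T powr (1 + \<epsilon>)"
    and h: "0 < h" "real h \<le> sqrt T + 1"
  shows "(\<Sum>l<h. norm (zeta_smooth_sum X (Complex (1/2) (\<alpha> * real l)))) \<le> sqrt T * (T powr \<epsilon>)\<^sup>2"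
proof -
  define q where "q = sqrt T"
  define R where "R = T powr \<epsilon>"
  have T_eq: "T = q * q" using T unfolding q_def by auto
  have q: "q \<ge> 2" "q \<le> T"
    using T T_eq real_le_rsqrt[of 2 T] mult_right_mono[of 1 q q] unfolding q_def by auto
  have R: "R \<ge> 2" "R \<le> T" "q powr \<epsilon> \<le> R"
    using T \<epsilon> q powr_mono[of \<epsilon> 1 T] powr_mono2[of \<epsilon> q T] unfolding R_def by auto
  have TR: "T powr (1 + \<epsilon>) = T * R" unfolding R_def using T(1) by (simp add: powr_add)
  have "q * 2 \<le> q * R" "q * R \<le> T * R" using q R by (intro mult_left_mono mult_right_mono; simp)+
  moreover have "q powr (1 + \<epsilon>) \<le> q * R" using q R by (simp add: powr_add mult_left_mono)
  ultimately have m: "q + 1 \<le> q * R" "q * R \<le> T * R" "q powr (1 + \<epsilon>) \<le> q * R" using q by linarith+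
  have "real X \<le> T * R * 2" using X(2) TR by simp
  also have "\<dots> \<le> T * R * R" using R T(1) by (intro mult_left_mono) auto
  also have "\<dots> = (q * R)\<^sup>2" unfolding T_eq by (simp add: power2_eq_square)
  finally have sqrt_X: "sqrt X \<le> q * R" using q R by (intro real_le_lsqrt) auto
  have "2 * (q * R) \<le> q * (q * T)" using q R by (intro mult_mono) auto
  hence "ln (2 * (q * R)) \<le> ln (T * T)" using q R T_eq by (intro ln_mono) (auto simp: mult.assoc)
  hence ln_m: "ln (2 * (q * R)) \<le> 2 * ln T" using T(1) by (simp add: ln_mult)
  have "(\<Sum>l<h. norm (zeta_smooth_sum X (Complex (1/2) (\<alpha> * real l)))) \<le>
      q * R * short_sum_factor \<alpha> (2 * ln T)"
  proof (rule sum_norm_zeta_smooth_sum_le_factor[OF \<alpha> _ ln_m h(1) _ sqrt_X])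
    fix l assume "l < h"
    hence "real l \<le> sqrt T" using h by linarith
    thus "admissible_length K (Complex (1/2) (\<alpha> * real l)) X"
      and "q * R \<le> real Y \<Longrightarrow> admissible_length K (Complex (1/2) (\<alpha> * real l)) Y" for Y
      using adm X(1) m unfolding TR q_def by force+
  qed (use q m h in \<open>auto simp: q_def\<close>)
  also have "\<dots> \<le> q * R * R" using factor q R unfolding R_def by (intro mult_left_mono) auto
  finally show ?thesis unfolding q_def R_def by (simp add: power2_eq_square mult.assoc)
qed

lemma eventually_sum_norm_zeta_smooth_sum_le:
  fixes \<alpha> \<epsilon> :: real
  assumes \<alpha>: "\<alpha> > 0" and \<epsilon>: "0 < \<epsilon>" "\<epsilon> \<le> 1"
  shows "\<forall>\<^sub>F T in at_top. \<forall>X h. T powr (1 + \<epsilon>) \<le> real X \<longrightarrow> real X \<le> 2 * T powr (1 + \<epsilon>) \<longrightarrow>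
    0 < h \<longrightarrow> real h \<le> sqrt T + 1 \<longrightarrow>
    (\<Sum>l<h. norm (zeta_smooth_sum X (Complex (1/2) (\<alpha> * real l)))) \<le> sqrt T * (T powr \<epsilon>)\<^sup>2"
proof -
  obtain K where K: "\<forall>\<^sub>F h in at_top. \<forall>l Y. real l \<le> h \<longrightarrow> h powr (1 + \<epsilon>) \<le> real Y \<longrightarrow>
      admissible_length K (Complex (1/2) (\<alpha> * real l)) Y"
    using eventually_admissible_length[OF \<alpha> \<epsilon>(1)] by blast
  have "filterlim (\<lambda>T::real. sqrt T) at_top at_top" by real_asymp
  note eventually_compose_filterlim[OF K this]
  moreover have "\<forall>\<^sub>F T in at_top. short_sum_factor \<alpha> (2 * ln T) \<le> T powr \<epsilon>"
    unfolding short_sum_factor_def mean_square_factor_def using \<alpha> \<epsilon> zeta_error_pos by real_asymp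
  moreover have "\<forall>\<^sub>F T::real in at_top. T \<ge> 4 \<and> T powr \<epsilon> \<ge> 2"
    using \<epsilon> by (intro eventually_conj eventually_ge_at_top; real_asymp)
  ultimately show ?thesis
  proof eventually_elim
    case (elim T)
    thus ?case using sum_norm_zeta_smooth_sum_le_powr[OF \<alpha> \<epsilon>, of T K] by blast
  qed
qed

lemma eventually_sqrt_powr_le:
  fixes \<alpha> \<epsilon> :: real
  assumes \<alpha>: "\<alpha> > 0" and \<epsilon>: "\<epsilon> < 1"
  shows "\<forall>\<^sub>F T in at_top. 8 * sqrt (2 * T powr (1 + \<epsilon>)) \<le> \<alpha>\<^sup>2 * T"
proof -
  define \<beta> where "\<beta> = (1 - \<epsilon>) / 2"
  have "\<beta> > 0" unfolding \<beta>_def using \<epsilon> by simp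
  hence "\<forall>\<^sub>F T::real in at_top. 16 / \<alpha>\<^sup>2 \<le> T powr \<beta>" by real_asymp
  moreover have "\<forall>\<^sub>F T::real in at_top. T \<ge> 1" by (rule eventually_ge_at_top)
  ultimately show ?thesis
  proof eventually_elim
    case (elim T)
    have "sqrt (2 * T powr (1 + \<epsilon>)) \<le> sqrt (4 * T powr (1 + \<epsilon>))" by (intro real_sqrt_le_mono) simp
    also have "\<dots> = 2 * T powr ((1 + \<epsilon>) / 2)"
      using elim(2) by (simp add: real_sqrt_mult powr_half_sqrt[symmetric] powr_powr)
    finally have "8 * sqrt (2 * T powr (1 + \<epsilon>)) \<le> 16 * T powr ((1 + \<epsilon>) / 2)" by simp
    also have "\<dots> \<le> (\<alpha>\<^sup>2 * T powr \<beta>) * T powr ((1 + \<epsilon>) / 2)"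
      using elim(1) \<alpha> by (intro mult_right_mono) (auto simp: field_simps)
    also have "\<dots> = \<alpha>\<^sup>2 * T powr (\<beta> + (1 + \<epsilon>) / 2)" by (simp add: powr_add)
    also have "\<dots> = \<alpha>\<^sup>2 * T" using elim(2) unfolding \<beta>_def by (simp add: field_simps)
    finally show ?case .
  qed
qed

lemma eventually_norm_zeta_smooth_sum_le:
  fixes \<alpha> \<epsilon> :: real
  assumes \<alpha>: "\<alpha> > 0" and \<epsilon>: "0 < \<epsilon>" "\<epsilon> < 1"
  shows "\<forall>\<^sub>F T in at_top. \<forall>X l. T powr (1 + \<epsilon>) \<le> real X \<longrightarrow> real X \<le> 2 * T powr (1 + \<epsilon>) \<longrightarrow>
    sqrt T \<le> real l \<longrightarrow> real l \<le> T \<longrightarrow>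
    norm (zeta_smooth_sum X (Complex (1/2) (\<alpha> * real l))) \<le>
      norm (riemann_zeta (Complex (1/2) (\<alpha> * real l))) + zeta_error + 2"
proof -
  obtain K where "\<forall>\<^sub>F T in at_top. \<forall>l Y. real l \<le> T \<longrightarrow> T powr (1 + \<epsilon>) \<le> real Y \<longrightarrow>
      admissible_length K (Complex (1/2) (\<alpha> * real l)) Y"
    using eventually_admissible_length[OF \<alpha> \<epsilon>(1)] by blast
  moreover note eventually_sqrt_powr_le[OF \<alpha> \<epsilon>(2)]
  moreover have "\<forall>\<^sub>F T::real in at_top. T \<ge> 1" by (rule eventually_ge_at_top)
  ultimately show ?thesis
  proof eventually_elim
    case (elim T)
    show ?case
    proof (intro allI impI)
      fix X l :: nat
      assume X: "T powr (1 + \<epsilon>) \<le> X" "X \<le> 2 * T powr (1 + \<epsilon>)" and l: "sqrt T \<le> l" "l \<le> T"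
      let ?s = "Complex (1/2) (\<alpha> * real l)"
      have "8 * sqrt X \<le> 8 * sqrt (2 * T powr (1 + \<epsilon>))" using X(2) by simp
      also have "\<dots> \<le> \<alpha>\<^sup>2 * (sqrt T)\<^sup>2" using elim(2,3) by simp
      also have "\<dots> \<le> \<alpha>\<^sup>2 * (real l)\<^sup>2" using l elim(3) by (intro mult_left_mono power_mono) auto
      finally have "8 * sqrt X \<le> (\<alpha> * l)\<^sup>2" by (simp add: power_mult_distrib)
      moreover have l_pos: "real l > 0" using l(1) elim(3) real_sqrt_ge_one[of T] by linarith
      hence "\<alpha> * l > 0" using \<alpha> by simp
      ultimately have "8 * sqrt X / (\<alpha> * l)\<^sup>2 \<le> 1" by (subst divide_le_eq_1_pos[OF zero_less_power])
      moreover have "admissible_length K ?s X" using elim(1) l X(1) by blast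
      hence "norm (zeta_smooth_sum X ?s - riemann_zeta ?s) \<le> zeta_error + 1 + 8 * sqrt X / (\<alpha> * l)\<^sup>2"
        using norm_zeta_smooth_sum_diff_le[of ?s K X] \<alpha> l_pos by simp
      ultimately have "norm (zeta_smooth_sum X ?s - riemann_zeta ?s) \<le> zeta_error + 2" by linarith
      thus "norm (zeta_smooth_sum X ?s) \<le> norm (riemann_zeta ?s) + zeta_error + 2"
        using norm_triangle_sub[of "zeta_smooth_sum X ?s" "riemann_zeta ?s"] by linarith
    qed
  qed
qed

lemma (in resonator) gain_le:
  fixes \<alpha> V B :: real and N X h :: nat
  assumes N: "N > 0" and X: "y \<le> real X" "X > 0"
    and V: "V \<ge> 0" "\<And>l. h \<le> l \<Longrightarrow> l < N \<Longrightarrow> norm (zeta_smooth_sum X (Complex (1/2) (\<alpha> * real l))) \<le> V"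
    and B: "(\<Sum>l<h. norm (zeta_smooth_sum X (Complex (1/2) (\<alpha> * real l)))) \<le> B"
  shows "real N * G \<le> 4 * (8 * N * V + 2 * B * card I)"
proof -
  have k_le: "k \<le> X" if "(k, m) \<in> E" for k m
    using pairs[OF that] X(1) by linarith
  interpret resonance "smooth_weight X" f "\<lambda>k. \<alpha> * ln (real k)" "{1..2*X}" I E N
  proof
    show "E \<subseteq> {1..2*X} \<times> I" using pairs k_le by fastforce
    show "0 < k \<and> k * m \<in> I \<and> \<alpha> * ln (real (k * m)) = \<alpha> * ln (real k) + \<alpha> * ln (real m)"
      if "(k, m) \<in> E" for k m
    proof -
      have "m > 0" using pairs[OF that] zero_notin_support by (cases m) auto
      thus ?thesis using pairs[OF that] by (simp add: ln_mult distrib_left)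
    qed
  qed (use N finite_support smooth_weight_nonneg nonneg in auto)
  have P: "trig_poly (int l) = zeta_smooth_sum X (Complex (1/2) (\<alpha> * real l))" for l
    unfolding trig_poly_def zeta_smooth_sum_eq by (simp add: mult_ac)
  have "(\<Sum>(k, m)\<in>E. smooth_weight X k * (f m * f (k * m))) =
      (\<Sum>(k, m)\<in>E. 1 / sqrt (real k) * (f m * f (k * m)))"
    using k_le X(2) by (intro sum.cong refl) (auto simp: smooth_weight_eq)
  hence "real N * (G * (\<Sum>m\<in>I. (f m)\<^sup>2)) \<le>
      real N * (\<Sum>(k, m)\<in>E. smooth_weight X k * (f m * f (k * m)))"
    using gain by (intro mult_left_mono) auto
  also have "\<dots> \<le> 4 * (8 * N * V + 2 * B * card I) * (\<Sum>m\<in>I. (f m)\<^sup>2)"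
    using V B by (intro resonance_inequality[of V h B]) (simp_all only: P)
  finally have "real N * G * (\<Sum>m\<in>I. (f m)\<^sup>2) \<le> 4 * (8 * N * V + 2 * B * card I) * (\<Sum>m\<in>I. (f m)\<^sup>2)"
    by (simp only: mult.assoc)
  thus ?thesis using mass_pos by (rule mult_right_le_imp_le)
qed

lemma (in resonator) exists_large_zeta_smooth_sum:
  fixes \<alpha> B :: real and N X h :: nat
  assumes h: "h < N" and X: "y \<le> real X" "X > 0"
    and B: "(\<Sum>l<h. norm (zeta_smooth_sum X (Complex (1/2) (\<alpha> * real l)))) \<le> B" "B * card I < N"
  shows "\<exists>l. h \<le> l \<and> l < N \<and> G \<le> 32 * norm (zeta_smooth_sum X (Complex (1/2) (\<alpha> * real l))) + 8"
proof (rule ccontr)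
  assume "\<not> ?thesis"
  hence small: "norm (zeta_smooth_sum X (Complex (1/2) (\<alpha> * real l))) \<le> (G - 8) / 32"
    if "h \<le> l" "l < N" for l
    using that by force
  have "0 \<le> (G - 8) / 32" using order_trans[OF norm_ge_zero small] h by blast
  hence "real N * G \<le> 4 * (8 * N * ((G - 8) / 32) + 2 * B * card I)"
    using h X B small by (intro gain_le) auto
  also have "\<dots> = real N * G - 8 * N + 8 * (B * card I)" by (simp add: field_simps)
  finally show False using B(2) by simp
qed

lemma sqrt_mult_powr_less:
  fixes N \<epsilon> :: real
  assumes N: "N > 1" and \<epsilon>: "\<epsilon> > 0" and n: "n \<le> N powr (1/2 - 4 * \<epsilon>)"
  shows "sqrt N * (N powr \<epsilon>)\<^sup>2 * n < N"
proof -
  have "sqrt N * (N powr \<epsilon>)\<^sup>2 * n \<le> sqrt N * (N powr \<epsilon>)\<^sup>2 * N powr (1/2 - 4 * \<epsilon>)"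
    using n N by (intro mult_left_mono) auto
  also have "\<dots> = N powr (1/2 + (\<epsilon> + \<epsilon>) + (1/2 - 4 * \<epsilon>))"
    using N by (simp only: powr_add powr_half_sqrt less_imp_le[OF less_trans[OF zero_less_one]]
      power2_eq_square)
  also have "\<dots> < N powr 1" using N \<epsilon> by (intro powr_less_mono) auto
  finally show ?thesis using N by simp
qed

lemma eventually_resonator_forces_large_zeta:
  fixes \<alpha> \<epsilon> :: real
  assumes \<alpha>: "\<alpha> > 0" and \<epsilon>: "0 < \<epsilon>" "\<epsilon> < 1"
  shows "\<forall>\<^sub>F N in sequentially. \<forall>f I E G. resonator f I E (real N) G \<longrightarrow>
    card I \<le> N powr (1/2 - 4 * \<epsilon>) \<longrightarrow>
    (\<exists>l. sqrt N \<le> real l \<and> l < N \<and>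
      G \<le> 32 * (norm (riemann_zeta (Complex (1/2) (\<alpha> * real l))) + zeta_error + 2) + 8)"
proof -
  note eventually_compose_filterlim[OF _ filterlim_real_sequentially]
  note this[OF eventually_sum_norm_zeta_smooth_sum_le[OF \<alpha> \<epsilon>(1) less_imp_le[OF \<epsilon>(2)]]]
    this[OF eventually_norm_zeta_smooth_sum_le[OF \<alpha> \<epsilon>]]
  moreover have "\<forall>\<^sub>F N in sequentially. N \<ge> 1 \<and> sqrt (real N) + 1 < real N"
    by (intro eventually_conj eventually_ge_at_top; real_asymp)
  ultimately show ?thesis
  proof eventually_elim
    case (elim N)
    have "N > 0" "sqrt N \<ge> 1" "sqrt N + 1 < N" using elim(3) by auto
    hence N: "N > 0" "sqrt N \<ge> 1" "real N > 1" "sqrt N + 1 < N" by linarith+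
    define X where "X = nat \<lceil>N powr (1 + \<epsilon>)\<rceil>"
    define h where "h = nat \<lceil>sqrt N\<rceil>"
    have powr_ge: "N powr (1 + \<epsilon>) \<ge> N" using N \<epsilon> powr_mono[of 1 "1 + \<epsilon>" "real N"] by simp
    have X: "N powr (1 + \<epsilon>) \<le> X" "X \<le> 2 * N powr (1 + \<epsilon>)" unfolding X_def using powr_ge N
      by linarith+
    have NX: "real N \<le> X" "X > 0" using X(1) powr_ge N by linarith+
    have h: "0 < h" "h \<le> sqrt N + 1" "\<And>l::nat. h \<le> l \<Longrightarrow> sqrt N \<le> l" unfolding h_def using N
      by linarith+
    show ?case
    proof (intro allI impI)
      fix f I E G assume "resonator f I E (real N) G" and card: "card I \<le> N powr (1/2 - 4 * \<epsilon>)"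
      then interpret resonator f I E "real N" G by simp
      have "(\<Sum>l<h. norm (zeta_smooth_sum X (Complex (1/2) (\<alpha> * real l)))) \<le> sqrt N * (N powr \<epsilon>)\<^sup>2"
        using elim(1) X h(1,2) by blast
      then obtain l where l: "h \<le> l" "l < N"
        "G \<le> 32 * norm (zeta_smooth_sum X (Complex (1/2) (\<alpha> * real l))) + 8"
        using exists_large_zeta_smooth_sum[of h N X \<alpha>] sqrt_mult_powr_less[OF N(3) \<epsilon>(1) card] h(2)
          N(4) NX
        by force
      hence "norm (zeta_smooth_sum X (Complex (1/2) (\<alpha> * real l)))
          \<le> norm (riemann_zeta (Complex (1/2) (\<alpha> * real l))) + zeta_error + 2"
        using elim(2) X h(3) by simp
      thus "\<exists>l. sqrt N \<le> real l \<and> l < N \<and>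
          G \<le> 32 * (norm (riemann_zeta (Complex (1/2) (\<alpha> * real l))) + zeta_error + 2) + 8"
        using l h(3) by (intro exI[of _ l]) auto
    qed
  qed
qed

lemma eventually_exp_dominates:
  fixes a b c d :: real
  assumes "c < d" "0 < d"
  shows "\<forall>\<^sub>F x in at_top. a * exp (c * x) + b \<le> exp (d * x)"
proof -
  define e where "e = d - c"
  have "e > 0" using assms unfolding e_def by simp
  hence "\<forall>\<^sub>F x in at_top. a \<le> exp (e * x) / 2" by real_asymp
  moreover have "\<forall>\<^sub>F x in at_top. b \<le> exp (d * x) / 2" using assms by real_asymp
  ultimately show ?thesis
  proof eventually_elim
    case (elim x)
    have "a * exp (c * x) \<le> exp (e * x) / 2 * exp (c * x)" by (intro mult_right_mono elim(1)) simp
    also have "\<dots> = exp (d * x) / 2" unfolding e_def by (simp add: left_diff_distrib flip: exp_add)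
    finally show ?case using elim(2) by linarith
  qed
qed

definition gain_exponent :: "real \<Rightarrow> real" where
  "gain_exponent N = sqrt (ln N * ln (ln (ln N)) / ln (ln N))"

lemma eventually_resonator_exists:
  fixes c \<theta> :: real
  assumes "0 < c" "c\<^sup>2 < \<theta>"
  shows "\<forall>\<^sub>F N in sequentially. \<exists>f I E. resonator f I E (real N) (exp (c * gain_exponent N)) \<and>
      card I \<le> N powr \<theta>"
proof -
  have "filterlim (\<lambda>N::nat. ln (real N)) at_top sequentially" by real_asymp
  from eventually_compose_filterlim[OF resonator_exists[OF assms] this] eventually_gt_at_top[of 0]
  show ?thesis by eventually_elim (simp add: gain_exponent_def powr_def)
qed

lemma eventually_exp_gain_exponent_le:
  fixes a b c d :: real
  assumes "c < d" "0 < d"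
  shows "\<forall>\<^sub>F N in sequentially. a * exp (c * gain_exponent (real N)) + b \<le>
      exp (d * gain_exponent (real N))"
proof -
  have "filterlim (\<lambda>N::nat. gain_exponent (real N)) at_top sequentially"
    unfolding gain_exponent_def by real_asymp
  thus ?thesis by (rule eventually_compose_filterlim[OF eventually_exp_dominates[OF assms]])
qed

theorem theorem1p2:
  fixes \<alpha> c :: real
  assumes "\<alpha> > 0" and "c < 1 / sqrt 2"
  shows "\<forall>\<^sub>F N in sequentially. N \<ge> 1 \<and>
    (\<exists>l::int. sqrt (real N) \<le> real_of_int l \<and> real_of_int l \<le> real N * ln (real N) \<and>
      norm (riemann_zeta (Complex (1/2) (\<alpha> * real_of_int l)))
        \<ge> exp (c * sqrt (ln (real N) * ln (ln (ln (real N))) / ln (ln (real N)))))"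
proof -
  obtain d where d: "max c 0 < d" "d < 1 / sqrt 2" using dense[of "max c 0" "1 / sqrt 2"] assms(2)
    by auto
  define \<epsilon> where "\<epsilon> = (1/2 - d\<^sup>2) / 8"
  have "d\<^sup>2 < (1 / sqrt 2)\<^sup>2" using d by (intro power_strict_mono) auto
  hence "d\<^sup>2 < 1/2" "8 * \<epsilon> = 1/2 - d\<^sup>2" unfolding \<epsilon>_def by (auto simp: power_divide)
  hence \<epsilon>: "0 < \<epsilon>" "\<epsilon> < 1" "d\<^sup>2 < 1/2 - 4 * \<epsilon>" using zero_le_power2[of d] by linarith+
  have "\<forall>\<^sub>F N in sequentially. N \<ge> 1 \<and> ln (real N) \<ge> 1"
    by (intro eventually_conj eventually_ge_at_top; real_asymp)
  moreover have "\<forall>\<^sub>F N in sequentially.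
      32 * exp (c * gain_exponent N) + (32 * (zeta_error + 2) + 8) \<le> exp (d * gain_exponent N)"
    using d by (intro eventually_exp_gain_exponent_le) auto
  moreover have "\<forall>\<^sub>F N in sequentially. \<exists>f I E.
      resonator f I E (real N) (exp (d * gain_exponent N)) \<and> card I \<le> N powr (1/2 - 4 * \<epsilon>)"
    using d \<epsilon>(3) by (intro eventually_resonator_exists) auto
  moreover note eventually_resonator_forces_large_zeta[OF assms(1) \<epsilon>(1,2)]
  ultimately show ?thesis
  proof eventually_elim
    case (elim N)
    then obtain l where l: "sqrt N \<le> real l" "l < N" and "exp (d * gain_exponent N)
        \<le> 32 * (norm (riemann_zeta (Complex (1/2) (\<alpha> * real l))) + zeta_error + 2) + 8" by blast
    hence "exp (c * gain_exponent N) \<le> norm (riemann_zeta (Complex (1/2) (\<alpha> * real l)))"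
      using elim(2) by simp
    moreover have "real l \<le> real N * ln (real N)"
      using l(2) elim(1) mult_mono[of "real l" "real N" 1 "ln (real N)"] by simp
    ultimately show ?case using l(1) elim(1) unfolding gain_exponent_def
      by (intro conjI exI[of _ "int l"]) auto
  qed
qed

end
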